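(* Let $B_1\subset\mathbb R^2$ be the open unit disc. There exists a strictly convex function $u\in C^1(\overline{B_1})$ with $Du\in BV(B_1;\mathbb R^2)\cap C^0(\overline{B_1};\mathbb R^2)$ and $u=0$ on $\partial B_1$, such that its Monge–Amp\`ere measure is absolutely continuous, $\mu_u=f\,dx$ with $0<f\le 1$ almost everywhere in $B_1$, but $u\notin W^{2,1}(B_1)$ (i.e. the distributional Hessian $D^2u$, which is a matrix-valued Radon measure, has a nonzero part singular with respect to Lebesgue measure).
   Context: For a convex function $u:B_1\to\mathbb R$, the Monge–Amp\`ere measure $\mu_u$ is the Borel measure defined by $\mu_u(E)=|\partial u(E)|$, where $\partial u(E)=\bigcup_{x\in E}\partial u(x)$ is the union of the subdifferentials of $u$ at points of $E$ and $|\cdot|$ denotes Lebesgue measure. A function is strictly convex if its graph contains no nontrivial line segment (equivalently, it is not affine on any nontrivial segment). *)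

theory Defs
  imports "HOL-Analysis.Analysis"
begin

definition strictly_convex_on :: "(real^2) set \<Rightarrow> (real^2 \<Rightarrow> real) \<Rightarrow> bool" where
  "strictly_convex_on S u \<longleftrightarrow> convex S \<and> convex_on S u \<and>
     (\<forall>x\<in>S. \<forall>y\<in>S. \<forall>t::real. x \<noteq> y \<and> 0 < t \<and> t < 1 \<longrightarrow>
        u ((1 - t) *\<^sub>R x + t *\<^sub>R y) < (1 - t) * u x + t * u y)"

definition pd :: "2 \<Rightarrow> (real^2 \<Rightarrow> real) \<Rightarrow> real^2 \<Rightarrow> real" where
  "pd i \<phi> x = frechet_derivative \<phi> (at x) (axis i 1)"

definition C1c :: "(real^2 \<Rightarrow> real) \<Rightarrow> (real^2) set \<Rightarrow> bool" where
  "C1c \<phi> \<Omega> \<longleftrightarrow> (\<forall>x. \<phi> differentiable (at x)) \<and> (\<forall>i. continuous_on UNIV (pd i \<phi>)) \<and>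
     compact (closure {x. \<phi> x \<noteq> 0}) \<and> closure {x. \<phi> x \<noteq> 0} \<subseteq> \<Omega>"

definition weak_partial :: "(real^2) set \<Rightarrow> (real^2 \<Rightarrow> real) \<Rightarrow> 2 \<Rightarrow> (real^2 \<Rightarrow> real) \<Rightarrow> bool" where
  "weak_partial \<Omega> w i g \<longleftrightarrow> g absolutely_integrable_on \<Omega> \<and>
     (\<forall>\<phi>. C1c \<phi> \<Omega> \<longrightarrow>
        integral \<Omega> (\<lambda>x. w x * pd i \<phi> x) = - integral \<Omega> (\<lambda>x. g x * \<phi> x))"

definition W11 :: "(real^2) set \<Rightarrow> (real^2 \<Rightarrow> real) \<Rightarrow> bool" where
  "W11 \<Omega> w \<longleftrightarrow> w absolutely_integrable_on \<Omega> \<and> (\<forall>i. \<exists>g. weak_partial \<Omega> w i g)"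

definition W21 :: "(real^2) set \<Rightarrow> (real^2 \<Rightarrow> real) \<Rightarrow> bool" where
  "W21 \<Omega> w \<longleftrightarrow> w absolutely_integrable_on \<Omega> \<and>
     (\<exists>G. \<forall>i. weak_partial \<Omega> w i (G i) \<and> W11 \<Omega> (G i))"

definition BV :: "(real^2) set \<Rightarrow> (real^2 \<Rightarrow> real) \<Rightarrow> bool" where
  "BV \<Omega> w \<longleftrightarrow> w absolutely_integrable_on \<Omega> \<and>
     (\<exists>C. \<forall>\<phi> :: 2 \<Rightarrow> real^2 \<Rightarrow> real.
        (\<forall>i. C1c (\<phi> i) \<Omega>) \<and> (\<forall>x. (\<Sum>i\<in>UNIV. (\<phi> i x)\<^sup>2) \<le> 1) \<longrightarrow>
        integral \<Omega> (\<lambda>x. w x * (\<Sum>i\<in>UNIV. pd i (\<phi> i) x)) \<le> C)"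

definition subdiff :: "(real^2) set \<Rightarrow> (real^2 \<Rightarrow> real) \<Rightarrow> real^2 \<Rightarrow> (real^2) set" where
  "subdiff S u x = {p. \<forall>y\<in>S. u y \<ge> u x + p \<bullet> (y - x)}"

definition subdiff_set :: "(real^2) set \<Rightarrow> (real^2 \<Rightarrow> real) \<Rightarrow> (real^2) set \<Rightarrow> (real^2) set" where
  "subdiff_set S u E = (\<Union>x\<in>E. subdiff S u x)"

end

(* The function is built through its partial Legendre transform: if v(x,y) is convex in x and concave
   in y, then u(v_x(x,y), y) = x v_x - v is convex, Du = (x, -v_y), and
   det D^2 u = -v_yy / v_xx, so the Monge-Ampere constraint reads 0 < -v_yy <= K v_xx while v_xy is
   unconstrained.  In the (x,y) coordinates u_xx dx dy becomes Lebesgue measure; hence u_xx has a singular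
   part as soon as v_xx vanishes on a set S of positive measure, because (v_x, y) maps S to a null set.
   Strict convexity requires every vertical line to meet {v_yy < 0} in a dense set.  We take
   S = K1 x K2 with fat nowhere dense K1, K2; above a point y off K2 the function v_xx is averaged over
   windows of radius r(y), where r vanishes exactly on K2.  Averages of v_xx over windows
   of radius r are at least of order r^2 and the averaging costs only O(l^2 r^2) in v_yy, l being
   the small horizontal scale.  All perturbations are compactly supported, and where
   v = (x^2 - y^2 + 1) / 2 the transform is u = (x^2 + y^2 - 1) / 2, which vanishes on the unit circle;
   multiplying u by 1 / sqrt K finally turns the bound K into 1. *)
theory Submission
  imports Defs
begin

section \<open>Calculus of compactly supported functions in the plane\<close>

text \<open>The obstacle is that \<open>- v_yy\<close> and \<open>v_xx\<close> have to vanish on the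
  same fat set: \<open>- v_yy <= K v_xx\<close> gives one inclusion, and f > 0 almost everywhere
  demands the other. No sum a(x) + b(y) achieves this, since over a zero of a'' the constraint would
  force b'' = 0 for every y. So above K1, at a height y off K2, \<open>v_xx\<close> has to borrow
  mass from neighbouring x, and the cost of the windows must stay below the order
  \<open>\<theta> ^ 4\<close> of \<open>v_yy\<close> at that height. This dictates the radius
  \<open>\<theta> ^ 2 / 2\<close> and a window mass of order at least r^2; the frequency ratio 16 =
  2 * 2 ^ 3 of the bumps, from the ratio 2 of their weights and the ratio 2 of their widths,
  delivers that mass. Conversely, at heights in K2 but off K1, \<open>v_yy\<close> has to be
  negative, and a factor \<open>G\<close> of x provides for that. Its product with a function
  \<open>S\<close> of y disturbs \<open>v_xx\<close> by \<open>G'' S\<close>, so two scales are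
  needed: w is made small first, absorbing \<open>G'' S\<close> into \<open>v_xx\<close>; then l is
  made small relative to w, absorbing the window term into \<open>v_yy\<close>.\<close>

definition C1 :: "(real^2 \<Rightarrow> real) \<Rightarrow> (real^2 \<Rightarrow> real) \<Rightarrow> (real^2 \<Rightarrow> real) \<Rightarrow> bool" where
  "C1 f a b \<longleftrightarrow> continuous_on UNIV a \<and> continuous_on UNIV b \<and>
     (\<forall>z. (f has_derivative (\<lambda>h. a z * h$1 + b z * h$2)) (at z))"

definition bounded_support :: "(real^2 \<Rightarrow> real) \<Rightarrow> bool" where
  "bounded_support f \<longleftrightarrow> (\<exists>R. \<forall>z. R < norm z \<longrightarrow> f z = 0)"

lemma axis_2_nth [simp]:
  "(axis 1 x :: real^2)$1 = x" "(axis 1 x :: real^2)$2 = 0"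
  "(axis 2 x :: real^2)$1 = 0" "(axis 2 x :: real^2)$2 = x"
  by (simp_all add: axis_def)

lemma C1_D:
  assumes "C1 f a b"
  shows "continuous_on UNIV a" "continuous_on UNIV b"
    "(f has_derivative (\<lambda>h. a z * h$1 + b z * h$2)) (at z within S)" "continuous_on UNIV f"
proof -
  show "continuous_on UNIV a" "continuous_on UNIV b" using assms by (auto simp: C1_def)
  have *: "\<And>z. (f has_derivative (\<lambda>h. a z * h$1 + b z * h$2)) (at z)"
    using assms by (auto simp: C1_def)
  then show "(f has_derivative (\<lambda>h. a z * h$1 + b z * h$2)) (at z within S)"
    by (rule has_derivative_at_withinI)
  show "continuous_on UNIV f"
    using * by (meson continuous_at_imp_continuous_on has_derivative_continuous)
qed

lemma C1_pd:
  assumes "C1 f a b"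
  shows "pd 1 f = a" "pd 2 f = b"
proof -
  have "frechet_derivative f (at z) = (\<lambda>h. a z * h$1 + b z * h$2)" for z
    by (rule frechet_derivative_at[symmetric], rule C1_D(3)[OF assms])
  then show "pd 1 f = a" "pd 2 f = b"
    by (simp_all add: pd_def fun_eq_iff)
qed

lemma C1c_C1:
  assumes "C1c f \<Omega>"
  shows "C1 f (pd 1 f) (pd 2 f)"
proof -
  have "(f has_derivative (\<lambda>h. pd 1 f z * h$1 + pd 2 f z * h$2)) (at z)" for z
  proof -
    let ?D = "frechet_derivative f (at z)"
    have D: "(f has_derivative ?D) (at z)"
      using assms frechet_derivative_works by (auto simp: C1c_def)
    interpret bounded_linear ?D using D by (rule has_derivative_bounded_linear)
    have "?D h = pd 1 f z * h$1 + pd 2 f z * h$2" for h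
    proof -
      have "h = h$1 *\<^sub>R axis 1 1 + h$2 *\<^sub>R axis 2 1"
        by (simp add: vec_eq_iff forall_2 axis_def)
      then have "?D h = ?D (h$1 *\<^sub>R axis 1 1 + h$2 *\<^sub>R axis 2 1)" by simp
      also have "\<dots> = h$1 * ?D (axis 1 1) + h$2 * ?D (axis 2 1)" by (simp add: add scaleR)
      finally show ?thesis by (simp add: pd_def)
    qed
    then have "?D = (\<lambda>h. pd 1 f z * h$1 + pd 2 f z * h$2)" by blast
    with D show ?thesis by simp
  qed
  then show ?thesis using assms by (auto simp: C1_def C1c_def)
qed

lemma C1_C1c:
  assumes "C1 f a b" "compact K" "K \<subseteq> \<Omega>" "\<And>z. z \<notin> K \<Longrightarrow> f z = 0"
  shows "C1c f \<Omega>"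
proof -
  have sub: "closure {z. f z \<noteq> 0} \<subseteq> K"
    using assms(2,4) by (intro closure_minimal) (auto intro: compact_imp_closed)
  moreover have "compact (closure {z. f z \<noteq> 0})"
    using sub assms(2) by (metis bounded_subset closed_closure compact_eq_bounded_closed)
  moreover have "f differentiable (at z)" for z
    using C1_D(3)[OF assms(1)] by (rule differentiableI)
  moreover have "continuous_on UNIV (pd i f)" for i
    using exhaust_2[of i] C1_pd[OF assms(1)] C1_D(1,2)[OF assms(1)] by metis
  ultimately show ?thesis using assms(3) unfolding C1c_def by blast
qed

lemma bounded_support_bounded:
  assumes "bounded S" "\<And>z. z \<notin> S \<Longrightarrow> f z = 0"
  shows "bounded_support f"
proof -
  obtain R where "\<forall>z\<in>S. norm z \<le> R" using assms(1) by (auto simp: bounded_iff)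
  then have "z \<notin> S" if "R < norm z" for z using that by force
  then have "\<forall>z. R < norm z \<longrightarrow> f z = 0" using assms(2) by blast
  then show ?thesis by (auto simp: bounded_support_def)
qed

lemma C1c_bounded_support:
  assumes "C1c f \<Omega>"
  shows "bounded_support f"
proof (rule bounded_support_bounded)
  show "bounded (closure {z. f z \<noteq> 0})" using assms by (simp add: C1c_def compact_imp_bounded)
  fix z assume "z \<notin> closure {z. f z \<noteq> 0}"
  then show "f z = 0" using closure_subset[of "{z. f z \<noteq> 0}"] by blast
qed

lemma C1_zero_on_open:
  assumes f: "C1 f a b" and "open U" "\<And>z. z \<in> U \<Longrightarrow> f z = 0" "z \<in> U"
  shows "a z = 0" "b z = 0"
proof -
  have "((\<lambda>_. 0) has_derivative (\<lambda>h. a z * h$1 + b z * h$2)) (at z)"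
    by (rule has_derivative_transform_within_open[OF C1_D(3)[OF f] assms(2,4)]) (use assms(3) in simp)
  then have *: "(\<lambda>h::real^2. a z * h$1 + b z * h$2) = (\<lambda>h. 0)"
    by (rule has_derivative_unique) (rule has_derivative_const)
  from fun_cong[OF *, of "axis 1 1"] fun_cong[OF *, of "axis 2 1"]
  show "a z = 0" "b z = 0" by simp_all
qed

lemma C1_bounded_support:
  assumes "C1 f a b" "bounded_support f"
  shows "bounded_support a" "bounded_support b"
proof -
  obtain R where R: "\<And>z. R < norm z \<Longrightarrow> f z = 0" using assms by (auto simp: bounded_support_def)
  have "open {z::real^2. R < norm z}" by (intro open_Collect_less continuous_intros)
  from C1_zero_on_open[OF assms(1) this] R
  show "bounded_support a" "bounded_support b" by (auto simp: bounded_support_def)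
qed

lemma C1c_outside:
  assumes "C1c f \<Omega>" "z \<notin> \<Omega>"
  shows "f z = 0" "pd 1 f z = 0" "pd 2 f z = 0"
proof -
  let ?U = "- closure {z. f z \<noteq> 0}"
  have U: "open ?U" "z \<in> ?U" using assms by (auto simp: C1c_def)
  have 0: "f y = 0" if "y \<in> ?U" for y using that closure_subset[of "{z. f z \<noteq> 0}"] by blast
  show "f z = 0" by (rule 0[OF U(2)])
  show "pd 1 f z = 0" "pd 2 f z = 0"
    using C1_zero_on_open[OF C1c_C1[OF assms(1)] U(1) 0 U(2)] by auto
qed

lemma bounded_support_mult:
  "bounded_support f \<Longrightarrow> bounded_support (\<lambda>z. g z * f z)"
  "bounded_support f \<Longrightarrow> bounded_support (\<lambda>z. f z * g z)"
  by (auto simp: bounded_support_def)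

lemma bounded_support_translate:
  assumes "bounded_support f"
  shows "bounded_support (\<lambda>z. f (z + c))"
proof -
  obtain R where R: "\<And>z. R < norm z \<Longrightarrow> f z = 0" using assms by (auto simp: bounded_support_def)
  have "f (z + c) = 0" if "R + norm c < norm z" for z
    using that norm_diff_triangle_ineq[of "z + c" 0 c 0] norm_triangle_ineq4[of "z+c" c]
    by (intro R) auto
  then show ?thesis by (auto simp: bounded_support_def)
qed

lemma integrable_bounded_support:
  assumes "continuous_on UNIV f" "bounded_support f"
  shows "integrable lborel f"
proof -
  obtain R where R: "\<And>z. R < norm z \<Longrightarrow> f z = 0" using assms by (auto simp: bounded_support_def)
  have "integrable lborel (\<lambda>z. indicator (cball 0 R) z *\<^sub>R f z)"
    using assms by (intro borel_integrable_compact) (auto intro: continuous_on_subset)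
  also have "(\<lambda>z. indicator (cball 0 R) z *\<^sub>R f z) = f"
    using R by (auto simp: fun_eq_iff indicator_def)
  finally show ?thesis .
qed

lemma lborel_integral_translate:
  fixes f :: "real^2 \<Rightarrow> real"
  assumes "f \<in> borel_measurable borel"
  shows "(\<integral>z. f (z + c) \<partial>lborel) = (\<integral>z. f z \<partial>lborel)"
proof -
  have "(\<integral>z. f z \<partial>lborel) = (\<integral>z. f z \<partial>distr lborel borel ((+) c))"
    by (simp add: lborel_distr_plus)
  also have "\<dots> = (\<integral>z. f (c + z) \<partial>lborel)"
    using assms by (subst integral_distr) auto
  finally show ?thesis by (simp add: add.commute)
qed

lemma C1_mult:
  assumes "C1 f a b" "C1 g c d"
  shows "C1 (\<lambda>z. f z * g z) (\<lambda>z. a z * g z + f z * c z) (\<lambda>z. b z * g z + f z * d z)"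
  unfolding C1_def
proof (intro conjI allI)
  note [continuous_intros] = C1_D(1,2,4)[OF assms(1)] C1_D(1,2,4)[OF assms(2)]
  show "continuous_on UNIV (\<lambda>z. a z * g z + f z * c z)" by (intro continuous_intros)
  show "continuous_on UNIV (\<lambda>z. b z * g z + f z * d z)" by (intro continuous_intros)
  fix z
  show "((\<lambda>z. f z * g z) has_derivative (\<lambda>h. (a z * g z + f z * c z) * h $ 1 + (b z * g z + f z * d z) * h $ 2)) (at z)"
    by (rule has_derivative_eq_rhs[OF has_derivative_mult[OF C1_D(3)[OF assms(1)] C1_D(3)[OF assms(2)]]])
      (simp add: algebra_simps)
qed

lemma C1_const: "C1 (\<lambda>z. c) (\<lambda>_. 0) (\<lambda>_. 0)"
  by (simp add: C1_def)

lemma C1_cmult: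
  assumes "C1 f a b"
  shows "C1 (\<lambda>z. c * f z) (\<lambda>z. c * a z) (\<lambda>z. c * b z)"
  unfolding C1_def
proof (intro conjI allI)
  fix z
  show "((\<lambda>z. c * f z) has_derivative (\<lambda>h. c * a z * h$1 + c * b z * h$2)) (at z)"
    by (rule has_derivative_eq_rhs[OF has_derivative_mult_right[OF C1_D(3)[OF assms]]]) (simp add: algebra_simps)
qed (intro continuous_intros C1_D[OF assms])+

lemma C1_add:
  assumes "C1 f a b" "C1 g c d"
  shows "C1 (\<lambda>z. f z + g z) (\<lambda>z. a z + c z) (\<lambda>z. b z + d z)"
  unfolding C1_def
proof (intro conjI allI)
  fix z
  show "((\<lambda>z. f z + g z) has_derivative (\<lambda>h. (a z + c z) * h$1 + (b z + d z) * h$2)) (at z)"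
    by (rule has_derivative_eq_rhs[OF has_derivative_add[OF C1_D(3)[OF assms(1)] C1_D(3)[OF assms(2)]]])
      (simp add: algebra_simps)
qed (intro continuous_intros C1_D(1,2)[OF assms(1)] C1_D(1,2)[OF assms(2)])+

lemma C1_compose:
  assumes f: "C1 f a b" and g: "\<And>z. (g has_field_derivative g' (f z)) (at (f z))"
    and cont: "continuous_on UNIV (\<lambda>z. g' (f z))"
  shows "C1 (\<lambda>z. g (f z)) (\<lambda>z. g' (f z) * a z) (\<lambda>z. g' (f z) * b z)"
  unfolding C1_def
proof (intro conjI allI)
  fix z
  have "(g has_derivative (\<lambda>h. g' (f z) * h)) (at (f z))"
    using g by (simp add: has_field_derivative_def)
  from has_derivative_compose[OF C1_D(3)[OF f] this]
  show "((\<lambda>z. g (f z)) has_derivative (\<lambda>h. g' (f z) * a z * h$1 + g' (f z) * b z * h$2)) (at z)"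
    by (rule has_derivative_eq_rhs) (simp add: algebra_simps)
qed (intro continuous_intros cont C1_D(1,2)[OF f])+

lemma C1_translate:
  assumes "C1 f a b"
  shows "C1 (\<lambda>z. f (z + c)) (\<lambda>z. a (z + c)) (\<lambda>z. b (z + c))"
  unfolding C1_def
proof (intro conjI allI)
  show "continuous_on UNIV (\<lambda>z. a (z + c))"
    by (rule continuous_on_compose2[OF C1_D(1)[OF assms]]) (auto intro!: continuous_intros)
  show "continuous_on UNIV (\<lambda>z. b (z + c))"
    by (rule continuous_on_compose2[OF C1_D(2)[OF assms]]) (auto intro!: continuous_intros)
  fix z
  have "((\<lambda>z. z + c) has_derivative (\<lambda>h. h)) (at z)" by (auto intro!: derivative_eq_intros)
  from has_derivative_compose[OF this C1_D(3)[OF assms, of "z + c" UNIV]]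
  show "((\<lambda>z. f (z + c)) has_derivative (\<lambda>h. a (z + c) * h $ 1 + b (z + c) * h $ 2)) (at z)" by simp
qed

section \<open>Integration by parts through difference quotients\<close>

lemma C1_Lipschitz_cball:
  assumes "C1 f a b"
  obtains K where "0 \<le> K" "\<And>x y. x \<in> cball 0 R \<Longrightarrow> y \<in> cball 0 R \<Longrightarrow> \<bar>f x - f y\<bar> \<le> K * norm (x - y)"
proof -
  have "bounded ((\<lambda>z. \<bar>a z\<bar> + \<bar>b z\<bar>) ` cball 0 R)"
    by (intro compact_imp_bounded compact_continuous_image continuous_intros)
      (auto intro: continuous_on_subset C1_D[OF assms])
  then obtain K where K: "\<And>z. z \<in> cball 0 R \<Longrightarrow> \<bar>a z\<bar> + \<bar>b z\<bar> \<le> K"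
    unfolding bounded_iff by fastforce
  have on: "onorm (\<lambda>h::real^2. a z * h$1 + b z * h$2) \<le> max 0 K" if "z \<in> cball 0 R" for z
  proof (rule onorm_le)
    fix h :: "real^2"
    have "norm (a z * h$1 + b z * h$2) \<le> \<bar>a z\<bar> * norm h + \<bar>b z\<bar> * norm h"
      unfolding real_norm_def
      by (rule order_trans[OF abs_triangle_ineq])
        (intro add_mono; simp add: abs_mult mult_left_mono component_le_norm_cart)
    also have "\<dots> \<le> max 0 K * norm h"
      using K[OF that] by (auto simp: distrib_right[symmetric] intro!: mult_right_mono)
    finally show "norm (a z * h$1 + b z * h$2) \<le> max 0 K * norm h" .
  qed
  show ?thesis
  proof
    fix x y :: "real^2" assume "x \<in> cball 0 R" "y \<in> cball 0 R"
    then show "\<bar>f x - f y\<bar> \<le> max 0 K * norm (x - y)"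
      using differentiable_bound[OF convex_cball C1_D(3)[OF assms] on, of 0 R x y] by auto
  qed auto
qed

text \<open>Dominated convergence with a local Lipschitz bound. The support condition is put on the
  whole product because in \<open>integral_jacobian_0\<close> the compact support belongs once to
  the differenced function \<open>f\<close> and once to the multiplier \<open>c\<close>.\<close>

lemma difference_quotient_limit:
  fixes e :: "real^2"
  assumes f: "C1 f a b" and c: "continuous_on UNIV c"
    and supp: "\<And>z s. \<bar>s\<bar> \<le> 1 \<Longrightarrow> R < norm z \<Longrightarrow> c z * (f (z + s *\<^sub>R e) - f z) = 0"
    and s: "s \<longlonglongrightarrow> 0" "\<And>n. s n \<noteq> 0" "\<And>n. \<bar>s n\<bar> \<le> 1"
  shows "(\<lambda>n. \<integral>z. c z * ((f (z + s n *\<^sub>R e) - f z) / s n) \<partial>lborel)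
           \<longlonglongrightarrow> (\<integral>z. c z * (a z * e$1 + b z * e$2) \<partial>lborel)"
proof -
  obtain K where K: "0 \<le> K" "\<And>x y. x \<in> cball 0 (R + norm e) \<Longrightarrow> y \<in> cball 0 (R + norm e) \<Longrightarrow>
      \<bar>f x - f y\<bar> \<le> K * norm (x - y)"
    using C1_Lipschitz_cball[OF f] by blast
  have "bounded (c ` cball 0 R)"
    by (intro compact_imp_bounded compact_continuous_image) (auto intro: continuous_on_subset[OF c])
  then obtain M where M: "\<And>z. z \<in> cball 0 R \<Longrightarrow> \<bar>c z\<bar> \<le> M"
    unfolding bounded_iff by fastforce
  note [measurable] = borel_measurable_continuous_onI[OF C1_D(1)[OF f]]
    borel_measurable_continuous_onI[OF C1_D(2)[OF f]]
    borel_measurable_continuous_onI[OF C1_D(4)[OF f]] borel_measurable_continuous_onI[OF c]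
  show ?thesis
  proof (rule integral_dominated_convergence[where w = "\<lambda>z. indicator (cball 0 R) z *\<^sub>R (M * (K * norm e))"])
    show "integrable lborel (\<lambda>z. indicator (cball 0 R) z *\<^sub>R (M * (K * norm e)))"
      by (intro borel_integrable_compact) auto
    show "AE z in lborel. (\<lambda>n. c z * ((f (z + s n *\<^sub>R e) - f z) / s n)) \<longlonglongrightarrow> c z * (a z * e$1 + b z * e$2)"
    proof (intro AE_I2 tendsto_intros)
      fix z
      have "((\<lambda>t. z + t *\<^sub>R e) has_derivative (\<lambda>h. h *\<^sub>R e)) (at 0)"
        by (auto intro!: derivative_eq_intros)
      from has_derivative_compose[OF this C1_D(3)[OF f, of _ UNIV]]
      have "((\<lambda>t. f (z + t *\<^sub>R e)) has_field_derivative (a z * e$1 + b z * e$2)) (at 0)"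
        by (rule has_derivative_imp_has_field_derivative) (simp add: algebra_simps)
      then have "((\<lambda>t. (f (z + t *\<^sub>R e) - f z) / t) \<longlongrightarrow> a z * e$1 + b z * e$2) (at 0)"
        by (simp add: has_field_derivative_iff)
      moreover have "filterlim s (at 0) sequentially"
        using s by (intro filterlim_atI) auto
      ultimately show "(\<lambda>n. (f (z + s n *\<^sub>R e) - f z) / s n) \<longlonglongrightarrow> a z * e$1 + b z * e$2"
        by (rule filterlim_compose)
    qed
    show "AE z in lborel. norm (c z * ((f (z + s n *\<^sub>R e) - f z) / s n))
        \<le> indicator (cball 0 R) z *\<^sub>R (M * (K * norm e))" for n
    proof (intro AE_I2)
      fix z
      show "norm (c z * ((f (z + s n *\<^sub>R e) - f z) / s n)) \<le> indicator (cball 0 R) z *\<^sub>R (M * (K * norm e))"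
      proof (cases "norm z \<le> R")
        case True
        have "norm (s n *\<^sub>R e) \<le> norm e" using s(3)[of n] by (auto intro!: mult_left_le_one_le)
        then have "\<bar>f (z + s n *\<^sub>R e) - f z\<bar> \<le> K * norm (z + s n *\<^sub>R e - z)"
          using True norm_triangle_ineq[of z "s n *\<^sub>R e"] norm_ge_zero[of e]
          by (intro K) (auto intro: order_trans)
        then have "\<bar>f (z + s n *\<^sub>R e) - f z\<bar> / \<bar>s n\<bar> \<le> K * norm e"
          using s(2)[of n] by (simp add: field_simps)
        then have "\<bar>c z\<bar> * (\<bar>f (z + s n *\<^sub>R e) - f z\<bar> / \<bar>s n\<bar>) \<le> M * (K * norm e)"
          using M[of z] True by (intro mult_mono) (auto intro: order_trans[OF abs_ge_zero])
        moreover have "norm (c z * ((f (z + s n *\<^sub>R e) - f z) / s n))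
            = \<bar>c z\<bar> * (\<bar>f (z + s n *\<^sub>R e) - f z\<bar> / \<bar>s n\<bar>)"
          by (simp add: abs_mult)
        moreover have "0 \<le> M * (K * norm e)"
          using M[of z] K(1) True by (intro mult_nonneg_nonneg) auto
        ultimately have "norm (c z * ((f (z + s n *\<^sub>R e) - f z) / s n)) \<le> M * (K * norm e)" "0 \<le> M * (K * norm e)"
          by linarith+
        moreover have "indicator (cball 0 R) z = (1::real)" using True by simp
        ultimately show ?thesis by (metis scaleR_one)
      next
        case False
        then have "c z * (f (z + s n *\<^sub>R e) - f z) = 0" using s supp by auto
        then show ?thesis using False by auto
      qed
    qed
  qed measurable
qed

text \<open>Translation invariance makes the integral of every difference quotient zero, so the
  limit is zero; no iterated integral is involved.\<close>

lemma integral_partial_derivative_0: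
  fixes e :: "real^2"
  assumes f: "C1 f a b" and supp: "bounded_support f"
  shows "(\<integral>z. a z * e$1 + b z * e$2 \<partial>lborel) = 0"
proof -
  obtain R where R: "\<And>z. R < norm z \<Longrightarrow> f z = 0" using supp by (auto simp: bounded_support_def)
  let ?s = "\<lambda>n. 1 / real (Suc n)"
  have "(\<lambda>n. \<integral>z. 1 * ((f (z + ?s n *\<^sub>R e) - f z) / ?s n) \<partial>lborel)
           \<longlonglongrightarrow> (\<integral>z. 1 * (a z * e$1 + b z * e$2) \<partial>lborel)"
  proof (rule difference_quotient_limit[OF f, where R = "R + norm e"])
    fix z :: "real^2" and s assume *: "\<bar>s\<bar> \<le> (1::real)" "R + norm e < norm z"
    then have "norm (s *\<^sub>R e) \<le> norm e" by (auto intro!: mult_left_le_one_le)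
    then show "1 * (f (z + s *\<^sub>R e) - f z) = 0"
      using *(2) R[of z] R[of "z + s *\<^sub>R e"] norm_triangle_ineq4[of "z + s *\<^sub>R e" "s *\<^sub>R e"]
       norm_ge_zero[of e] by simp
  qed (use LIMSEQ_inverse_real_of_nat in \<open>auto simp: inverse_eq_divide\<close>)
  moreover have "(\<integral>z. 1 * ((f (z + ?s n *\<^sub>R e) - f z) / ?s n) \<partial>lborel) = 0" for n
  proof -
    have i: "integrable lborel f" "integrable lborel (\<lambda>z. f (z + ?s n *\<^sub>R e))"
      using f supp by (auto intro!: integrable_bounded_support bounded_support_translate C1_D(4) C1_translate)
    then have "(\<integral>z. f (z + ?s n *\<^sub>R e) - f z \<partial>lborel) = 0"
      by (subst Bochner_Integration.integral_diff)
        (auto simp: lborel_integral_translate borel_measurable_continuous_onI[OF C1_D(4)[OF f]])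
    then show ?thesis by simp
  qed
  ultimately have "(\<lambda>n::nat. 0) \<longlonglongrightarrow> (\<integral>z. 1 * (a z * e$1 + b z * e$2) \<partial>lborel)" by simp
  from LIMSEQ_unique[OF this tendsto_const] show ?thesis by simp
qed

lemma integral_partial_0:
  assumes f: "C1 f a b" and supp: "bounded_support f"
  shows "(\<integral>z. a z \<partial>lborel) = 0" "(\<integral>z. b z \<partial>lborel) = 0"
proof -
  show "(\<integral>z. a z \<partial>lborel) = 0" "(\<integral>z. b z \<partial>lborel) = 0"
    using integral_partial_derivative_0[OF assms, of "axis 1 1"]
      integral_partial_derivative_0[OF assms, of "axis 2 1"] by simp_all
qed

text \<open>Only one derivative of \<open>X\<close> and \<open>f\<close> is available, so the mixed second derivatives in the usual
  divergence-form argument are replaced by difference quotients.\<close>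

lemma integral_jacobian_0:
  assumes X: "C1 X X1 X2" and f: "C1 f a b" and supp: "bounded_support f"
  shows "(\<integral>z. X1 z * b z \<partial>lborel) = (\<integral>z. X2 z * a z \<partial>lborel)"
proof -
  obtain R where R: "\<And>z. R < norm z \<Longrightarrow> f z = 0" using supp by (auto simp: bounded_support_def)
  obtain R' where R': "\<And>z. R' < norm z \<Longrightarrow> a z = 0"
    using C1_bounded_support[OF f supp] by (auto simp: bounded_support_def)
  define e :: "real^2" where "e = axis 2 1"
  have e: "e$1 = 0" "e$2 = 1" "norm e = 1" by (simp_all add: e_def norm_axis_1)
  let ?s = "\<lambda>n. 1 / real (Suc n)"
  note [continuous_intros] = C1_D(1,2,4)[OF f] C1_D(1,2,4)[OF X]
  have cont_tr: "continuous_on UNIV (\<lambda>z. g (z + c))" if "continuous_on UNIV g" for g :: "real^2 \<Rightarrow> real" and c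
    by (rule continuous_on_compose2[OF that]) (auto intro!: continuous_intros)
  have lim1: "(\<lambda>n. \<integral>z. X1 z * ((f (z + ?s n *\<^sub>R e) - f z) / ?s n) \<partial>lborel)
           \<longlonglongrightarrow> (\<integral>z. X1 z * (a z * e$1 + b z * e$2) \<partial>lborel)"
  proof (rule difference_quotient_limit[OF f C1_D(1)[OF X], where R = "R + 1"])
    fix z :: "real^2" and s assume *: "\<bar>s\<bar> \<le> (1::real)" "R + 1 < norm z"
    then have "norm (s *\<^sub>R e) \<le> 1" by (simp add: e)
    then show "X1 z * (f (z + s *\<^sub>R e) - f z) = 0"
      using *(2) R[of z] R[of "z + s *\<^sub>R e"] norm_triangle_ineq4[of "z + s *\<^sub>R e" "s *\<^sub>R e"] by simp
  qed (use LIMSEQ_inverse_real_of_nat in \<open>auto simp: inverse_eq_divide\<close>)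
  \<comment> \<open>The backward quotient appears because moving the shift by \<open>c\<close> from
    \<open>a\<close> to \<open>X\<close> through translation invariance replaces
    \<open>z + c\<close> by \<open>z - c\<close>.\<close>
  have lim2: "(\<lambda>n. \<integral>z. a z * ((X (z + (- ?s n) *\<^sub>R e) - X z) / (- ?s n)) \<partial>lborel)
           \<longlonglongrightarrow> (\<integral>z. a z * (X1 z * e$1 + X2 z * e$2) \<partial>lborel)"
  proof (rule difference_quotient_limit[OF X C1_D(1)[OF f], where R = "R'"])
    have "(\<lambda>n. - inverse (real (Suc n))) \<longlonglongrightarrow> - 0"
      by (intro tendsto_minus LIMSEQ_inverse_real_of_nat)
    then show "(\<lambda>n. - (1 / real (Suc n))) \<longlonglongrightarrow> 0" by (simp add: inverse_eq_divide)
  qed (use R' in auto)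
  have eq: "(\<integral>z. X1 z * ((f (z + ?s n *\<^sub>R e) - f z) / ?s n) \<partial>lborel)
     = (\<integral>z. a z * ((X (z + (- ?s n) *\<^sub>R e) - X z) / (- ?s n)) \<partial>lborel)" for n
  proof -
    define c where "c = ?s n *\<^sub>R e"
    have ints: "integrable lborel (\<lambda>z. X1 z * f z)" "integrable lborel (\<lambda>z. X z * a z)"
      "integrable lborel (\<lambda>z. X1 z * f (z + c))" "integrable lborel (\<lambda>z. X z * a (z + c))"
      "integrable lborel (\<lambda>z. X (z - c) * a z)"
      using cont_tr[OF C1_D(4)[OF f]] cont_tr[OF C1_D(1)[OF f]] cont_tr[OF C1_D(4)[OF X], of "- c"]
      by (auto intro!: integrable_bounded_support continuous_intros bounded_support_mult(1)
           bounded_support_translate C1_bounded_support[OF f supp] supp)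
    \<comment> \<open>Horizontal integration by parts, applied below to \<open>f\<close> and to its
      translate. It moves the horizontal derivative off \<open>X\<close> before the vertical
      difference is moved onto \<open>X\<close>, so \<open>X\<close> is never differentiated
      twice.\<close>
    have p: "(\<integral>z. X1 z * g z \<partial>lborel) = - (\<integral>z. X z * g1 z \<partial>lborel)"
      if g: "C1 g g1 g2" "bounded_support g" for g g1 g2
    proof -
      have "(\<integral>z. X1 z * g z + X z * g1 z \<partial>lborel) = 0"
        using integral_partial_0(1)[OF C1_mult[OF X g(1)] bounded_support_mult(1)[OF g(2)]] .
      moreover have "integrable lborel (\<lambda>z. X1 z * g z)" "integrable lborel (\<lambda>z. X z * g1 z)"
        using C1_bounded_support[OF g] C1_D[OF g(1)] g(2)
        by (auto intro!: integrable_bounded_support continuous_intros bounded_support_mult(1))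
      ultimately show ?thesis by simp
    qed
    have "(\<integral>z. X1 z * (f (z + c) - f z) \<partial>lborel)
        = (\<integral>z. X1 z * f (z + c) \<partial>lborel) - (\<integral>z. X1 z * f z \<partial>lborel)"
      using ints by (simp add: right_diff_distrib)
    also have "\<dots> = (\<integral>z. X z * a z \<partial>lborel) - (\<integral>z. X z * a (z + c) \<partial>lborel)"
      using p[OF f supp] p[OF C1_translate[OF f, of c] bounded_support_translate[OF supp, of c]] by simp
    also have "(\<integral>z. X z * a (z + c) \<partial>lborel) = (\<integral>z. X (z - c) * a z \<partial>lborel)"
    proof -
      have "(\<lambda>z. X (z - c) * a z) \<in> borel_measurable borel"
        using ints(5) by simp
      from lborel_integral_translate[OF this, of c] show ?thesis by simp
    qed
    also have "(\<integral>z. X z * a z \<partial>lborel) - (\<integral>z. X (z - c) * a z \<partial>lborel)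
       = (\<integral>z. - (a z * (X (z - c) - X z)) \<partial>lborel)"
      using ints by (subst Bochner_Integration.integral_diff[symmetric]) (auto simp: algebra_simps)
    finally have "(\<integral>z. X1 z * (f (z + c) - f z) \<partial>lborel) = (\<integral>z. - (a z * (X (z - c) - X z)) \<partial>lborel)" .
    then have "(\<integral>z. X1 z * (f (z + c) - f z) \<partial>lborel) / ?s n
        = (\<integral>z. - (a z * (X (z - c) - X z)) \<partial>lborel) / ?s n" by simp
    moreover have "X1 z * ((f (z + ?s n *\<^sub>R e) - f z) / ?s n) = X1 z * (f (z + c) - f z) / ?s n"
      "a z * ((X (z + (- ?s n) *\<^sub>R e) - X z) / (- ?s n)) = - (a z * (X (z - c) - X z)) / ?s n" for z
      by (simp_all add: c_def)
    ultimately show ?thesis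
      by (simp only: integral_divide_zero)
  qed
  show ?thesis
    using LIMSEQ_unique[OF lim1[unfolded eq] lim2] by (simp add: e mult.commute)
qed

section \<open>Partial Legendre transform\<close>

abbreviation pt :: "real \<Rightarrow> real \<Rightarrow> real^2" where
  "pt a b \<equiv> vector [a, b]"

lemma pt_eta [simp]: "pt (z$1) (z$2) = z"
  by (simp add: vec_eq_iff forall_2)

lemma pt_eq_iff: "pt a b = pt c d \<longleftrightarrow> a = c \<and> b = d"
  by (metis vector_2)

lemma pt_axis: "pt a b = a *\<^sub>R axis 1 1 + b *\<^sub>R axis 2 1"
  by (simp add: vec_eq_iff forall_2 axis_def)

lemma has_derivative_pt:
  assumes "(f has_derivative f') F" "(g has_derivative g') F"
  shows "((\<lambda>z. pt (f z) (g z)) has_derivative (\<lambda>h. pt (f' h) (g' h))) F"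
  unfolding pt_axis by (intro has_derivative_add has_derivative_scaleR_left assms)

lemma continuous_on_pt [continuous_intros]:
  assumes "continuous_on S f" "continuous_on S g"
  shows "continuous_on S (\<lambda>z. pt (f z) (g z))"
  unfolding pt_axis by (intro continuous_intros assms)

lemma det_matrix_pt:
  "det (matrix (\<lambda>h::real^2. pt (a * h$1 + b * h$2) (c * h$1 + d * h$2))) = a * d - b * c"
  by (simp add: det_2 matrix_def axis_def)

lemma has_derivative_nth:
  "((\<lambda>z::real^2. z$i) has_derivative (\<lambda>h. h$i)) F"
  by (rule bounded_linear_imp_has_derivative) (rule bounded_linear_vec_nth)

lemma C1_nth: "C1 (\<lambda>z. z$1) (\<lambda>_. 1) (\<lambda>_. 0)" "C1 (\<lambda>z. z$2) (\<lambda>_. 0) (\<lambda>_. 1)"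
  by (simp_all add: C1_def has_derivative_nth)

lemma norm_pt_ge: "\<bar>a\<bar> \<le> norm (pt a b)"
  using component_le_norm_cart[of "pt a b" 1] by simp

lemma has_absolute_integral_change_of_variables_real:
  fixes f :: "real^'m::{finite,wellorder} \<Rightarrow> real" and g :: "real^'m::_ \<Rightarrow> real^'m::_"
  assumes S: "S \<in> sets lebesgue"
    and der_g: "\<And>x. x \<in> S \<Longrightarrow> (g has_derivative g' x) (at x within S)"
    and inj: "inj_on g S"
  shows "(\<lambda>x. \<bar>det (matrix (g' x))\<bar> * f(g x)) absolutely_integrable_on S \<and>
           integral S (\<lambda>x. \<bar>det (matrix (g' x))\<bar> * f(g x)) = b
     \<longleftrightarrow> f absolutely_integrable_on (g ` S) \<and> integral (g ` S) f = b"
proof -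
  have "(\<lambda>x. \<bar>det (matrix (g' x))\<bar> *\<^sub>R vec (f(g x)) :: real ^ 1) absolutely_integrable_on S \<and>
           integral S (\<lambda>x. \<bar>det (matrix (g' x))\<bar> *\<^sub>R vec (f(g x))) = (vec b :: real ^ 1)
         \<longleftrightarrow> (\<lambda>x. vec (f x) :: real ^ 1) absolutely_integrable_on (g ` S) \<and>
           integral (g ` S) (\<lambda>x. vec (f x)) = (vec b :: real ^ 1)"
    by (intro has_absolute_integral_change_of_variables assms)
  thus ?thesis
    by (simp add: absolutely_integrable_on_1_iff integral_on_1_eq)
qed

lemma integral_eq_lborel:
  fixes g :: "real^2 \<Rightarrow> real"
  assumes "integrable lborel g" "\<And>z. z \<notin> S \<Longrightarrow> g z = 0"
  shows "g absolutely_integrable_on S" "integral S g = (\<integral>z. g z \<partial>lborel)"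
proof -
  have eq: "(\<lambda>z. if z \<in> S then g z else 0) = g" using assms by auto
  have "g absolutely_integrable_on UNIV"
    using assms(1) by (simp add: set_integrable_def integrable_completion)
  then show "g absolutely_integrable_on S"
    using absolutely_integrable_restrict_UNIV[of S g] by (simp add: eq)
  show "integral S g = (\<integral>z. g z \<partial>lborel)"
    using integral_restrict_UNIV[of S g] integral_lborel[OF assms(1)] by (simp add: eq)
qed

text \<open>Strict monotonicity of the derivative stands in for positivity of the second derivative,
  which fails here on a set of positive measure.\<close>

lemma above_tangent_if_derivative_strict_mono:
  fixes f :: "real \<Rightarrow> real"
  assumes f: "\<And>x. (f has_field_derivative f' x) (at x)" and mono: "\<And>x y. x < y \<Longrightarrow> f' x < f' y"
    and "t \<noteq> s"
  shows "f s + f' s * (t - s) < f t"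
proof (cases "s < t")
  case True
  then have "\<exists>z>s. z < t \<and> f t - f s = (t - s) * f' z" by (rule MVT2) (rule f)
  then obtain z where z: "s < z" "f t - f s = (t - s) * f' z" by blast
  have "(t - s) * f' s < (t - s) * f' z" using True mono[OF z(1)] by (intro mult_strict_left_mono) auto
  then show ?thesis using z(2) by (simp add: mult.commute)
next
  case False
  then have "t < s" using assms(3) by simp
  then have "\<exists>z>t. z < s \<and> f s - f t = (s - t) * f' z" by (rule MVT2) (rule f)
  then obtain z where z: "z < s" "f s - f t = (s - t) * f' z" by blast
  have "(s - t) * f' z < (s - t) * f' s" using \<open>t < s\<close> mono[OF z(1)] by (intro mult_strict_left_mono) auto
  then show ?thesis using z(2) by (simp add: algebra_simps)
qed

text \<open>Strictness is demanded of the first derivatives only (\<open>vx_less\<close>,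
  \<open>vy_less\<close>), because \<open>vxx\<close> must be allowed to vanish on a non-negligible
  set. \<open>degenerate\<close> makes the density \<open>- vyy / vxx\<close> positive wherever its
  denominator is nonzero.\<close>

locale partial_legendre =
  fixes v vx vy vxx vxy vyx vyy :: "real^2 \<Rightarrow> real" and K :: real
  assumes v: "C1 v vx vy" and vx: "C1 vx vxx vxy" and vy: "C1 vy vyx vyy"
    and outside: "\<And>z. 3/4 \<le> norm z \<Longrightarrow> v z = ((z$1)\<^sup>2 - (z$2)\<^sup>2 + 1) / 2"
    and vyy_nonpos: "\<And>z. vyy z \<le> 0"
    and K: "0 < K" "\<And>z. - vyy z \<le> K * vxx z"
    and degenerate: "\<And>z. vyy z = 0 \<Longrightarrow> vxx z = 0"
    and vx_less: "\<And>s t y. s < t \<Longrightarrow> vx (pt s y) < vx (pt t y)"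
    and vy_less: "\<And>x s t. s < t \<Longrightarrow> vy (pt x t) < vy (pt x s)"
    and not_negligible: "\<not> negligible {z. vxx z = 0}"
begin

section \<open>The coordinate change \<open>F\<close> and its continuous inverse
  \<open>H\<close>\<close>

lemma vxx_nonneg: "0 \<le> vxx z"
proof -
  have "0 \<le> K * vxx z" using K(2)[of z] vyy_nonpos[of z] by linarith
  then show ?thesis using K(1) by (simp add: zero_le_mult_iff)
qed

lemma outside_derivatives:
  assumes "3/4 < norm z"
  shows "vx z = z$1" "vy z = - z$2"
proof -
  have "open {z::real^2. 3/4 < norm z}" by (intro open_Collect_less continuous_intros)
  then have "((\<lambda>z. ((z$1)\<^sup>2 - (z$2)\<^sup>2 + 1) / 2) has_derivative (\<lambda>h. vx z * h$1 + vy z * h$2)) (at z)"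
    by (rule has_derivative_transform_within_open[OF C1_D(3)[OF v]]) (use assms outside in auto)
  moreover have "((\<lambda>z::real^2. ((z$1)\<^sup>2 - (z$2)\<^sup>2 + 1) / 2) has_derivative (\<lambda>h. z$1 * h$1 - z$2 * h$2)) (at z)"
    by (rule derivative_eq_intros has_derivative_nth refl)+ (auto simp: fun_eq_iff field_simps)
  ultimately have *: "(\<lambda>h::real^2. vx z * h$1 + vy z * h$2) = (\<lambda>h. z$1 * h$1 - z$2 * h$2)"
    by (rule has_derivative_unique)
  from fun_cong[OF this, of "pt 1 0"] fun_cong[OF this, of "pt 0 1"]
  show "vx z = z$1" "vy z = - z$2" by simp_all
qed

lemma outside_vxx:
  assumes "3/4 < norm z"
  shows "vxx z = 1"
proof -
  have "open {z::real^2. 3/4 < norm z}" by (intro open_Collect_less continuous_intros)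
  then have "((\<lambda>z. z$1) has_derivative (\<lambda>h. vxx z * h$1 + vxy z * h$2)) (at z)"
    by (rule has_derivative_transform_within_open[OF C1_D(3)[OF vx]]) (use assms outside_derivatives in auto)
  then have "(\<lambda>h::real^2. vxx z * h$1 + vxy z * h$2) = (\<lambda>h. h$1)"
    by (rule has_derivative_unique) (rule has_derivative_nth)
  from fun_cong[OF this, of "pt 1 0"] show ?thesis by simp
qed

definition F :: "real^2 \<Rightarrow> real^2" where "F z = pt (vx z) (z$2)"
definition H :: "real^2 \<Rightarrow> real^2" where "H = inv F"
definition Du :: "real^2 \<Rightarrow> real^2" where "Du z = pt (H z $ 1) (- vy (H z))"
definition u :: "real^2 \<Rightarrow> real" where "u z = H z $ 1 * z$1 - v (H z)"

lemma F_nth [simp]: "F z $ 1 = vx z" "F z $ 2 = z$2"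
  by (simp_all add: F_def)

lemma F_outside: "3/4 < norm z \<Longrightarrow> F z = z"
  by (simp add: F_def outside_derivatives)

text \<open>The second component is written with the coefficients 0 and 1 so that
  \<open>det_matrix_pt\<close> applies literally.\<close>

definition DF :: "real^2 \<Rightarrow> real^2 \<Rightarrow> real^2" where
  "DF z h = pt (vxx z * h$1 + vxy z * h$2) (0 * h$1 + 1 * h$2)"

lemma F_derivative: "(F has_derivative DF z) (at z within S)"
  unfolding F_def[abs_def] DF_def[abs_def] by (rule has_derivative_pt) (use C1_D(3)[OF vx] has_derivative_nth in auto)

lemma continuous_on_F: "continuous_on S F"
  using F_derivative by (meson continuous_on_eq_continuous_within has_derivative_continuous)

lemma inj_F: "inj F"
proof (rule injI)
  fix a b assume "F a = F b"
  then have eq: "vx a = vx b" "a$2 = b$2" by (metis F_nth)+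
  show "a = b"
  proof (cases "a$1" "b$1" rule: linorder_cases)
    case less
    from vx_less[OF this, of "a$2"] eq show ?thesis by (metis less_irrefl pt_eta)
  next
    case greater
    from vx_less[OF this, of "a$2"] eq show ?thesis by (metis less_irrefl pt_eta)
  qed (metis eq(2) pt_eta)
qed

text \<open>On each horizontal line \<open>vx\<close> is continuous and agrees with the first
  coordinate beyond distance 1, so the intermediate value theorem applies.\<close>

lemma surj_F: "surj F"
  unfolding surj_def
proof
  fix z :: "real^2"
  define R where "R = 1 + \<bar>z$1\<bar>"
  have out: "vx (pt t y) = t" if "1 \<le> \<bar>t\<bar>" for t y
    using outside_derivatives(1)[of "pt t y"] norm_pt_ge[of t y] that by simp
  have "continuous_on {-R..R} (\<lambda>t. vx (pt t (z$2)))"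
    by (rule continuous_on_compose2[OF C1_D(4)[OF vx]]) (auto intro!: continuous_intros)
  moreover have "vx (pt (-R) (z$2)) \<le> z$1" "z$1 \<le> vx (pt R (z$2))"
    using out[of "-R"] out[of R] by (auto simp: R_def)
  moreover have "-R \<le> R" by (simp add: R_def)
  ultimately obtain t where "vx (pt t (z$2)) = z$1" using IVT'[of "\<lambda>t. vx (pt t (z$2))" "-R" "z$1" R] by blast
  then have "F (pt t (z$2)) = z" by (simp add: F_def)
  then show "\<exists>x. z = F x" by metis
qed

lemma FH [simp]: "F (H z) = z" and HF [simp]: "H (F z) = z"
  using inj_F surj_F by (simp_all add: H_def surj_f_inv_f)

lemma H_2 [simp]: "H z $ 2 = z$2" and vx_H [simp]: "vx (H z) = z$1"
  by (metis FH F_nth(2)) (metis FH F_nth(1))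

lemma H_outside: "3/4 < norm z \<Longrightarrow> H z = z"
  using F_outside[of z] HF[of z] by simp

lemma F_fixed_if_large: "3/4 < norm (F z) \<Longrightarrow> F z = z"
  using F_outside[of "F z"] inj_F by (simp add: inj_eq)

text \<open>\<open>F\<close> fixes every point outside the disc of radius 3/4; by injectivity it
  then cannot send a point of that disc outside it.\<close>

lemma norm_F_iff:
  assumes "3/4 < r"
  shows "norm (F z) < r \<longleftrightarrow> norm z < r" "norm (F z) \<le> r \<longleftrightarrow> norm z \<le> r"
proof -
  consider "F z = z" | "norm (F z) \<le> 3/4" "norm z \<le> 3/4"
    using F_outside[of z] F_fixed_if_large[of z] by linarith
  then show "norm (F z) < r \<longleftrightarrow> norm z < r" "norm (F z) \<le> r \<longleftrightarrow> norm z \<le> r"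
    using assms by (cases; simp)+
qed

lemma F_ball: "3/4 < r \<Longrightarrow> F ` ball 0 r = ball 0 r"
proof -
  assume r: "3/4 < r"
  have "z \<in> F ` ball 0 r" if "z \<in> ball 0 r" for z
  proof (rule image_eqI)
    show "z = F (H z)" by simp
    show "H z \<in> ball 0 r" using that norm_F_iff(1)[OF r, of "H z"] by simp
  qed
  then show ?thesis using norm_F_iff(1)[OF r] by auto
qed

lemma F_cball: "F ` cball 0 1 = cball 0 1"
proof -
  have "z \<in> F ` cball 0 1" if "z \<in> cball 0 1" for z
  proof (rule image_eqI)
    show "z = F (H z)" by simp
    show "H z \<in> cball 0 1" using that norm_F_iff(2)[of 1 "H z"] by simp
  qed
  then show ?thesis using norm_F_iff(2)[of 1] by auto
qed

text \<open>\<open>DF\<close> is singular where \<open>vxx = 0\<close>, so the inverse function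
  theorem is of no help. On the closed disc compactness yields the continuity of the inverse;
  outside the open disc \<open>H\<close> is the identity.\<close>

lemma continuous_on_H: "continuous_on S H"
proof -
  have "continuous_on (F ` cball 0 1) H"
    by (rule continuous_on_inv[OF continuous_on_F]) auto
  moreover have "continuous_on (- ball 0 1) H"
    by (rule continuous_on_eq[OF continuous_on_id]) (auto simp: H_outside)
  ultimately have "continuous_on (cball 0 1 \<union> - ball 0 1) H"
    by (intro continuous_on_closed_Un) (auto simp: F_cball)
  moreover have "cball 0 1 \<union> - ball 0 1 = (UNIV :: (real^2) set)" by auto
  ultimately show ?thesis by (auto intro: continuous_on_subset)
qed

section \<open>Convexity, differentiability and subdifferential of \<open>u\<close>\<close>

lemma v_above_tangent_x:
  assumes "t \<noteq> s"
  shows "v (pt t y) > v (pt s y) + vx (pt s y) * (t - s)"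
proof (rule above_tangent_if_derivative_strict_mono[OF _ vx_less assms])
  show "((\<lambda>t. v (pt t y)) has_field_derivative vx (pt t y)) (at t)" for t
  proof -
    have "((\<lambda>t. pt t y) has_derivative (\<lambda>h. pt h 0)) (at t)"
      by (rule has_derivative_pt) (auto intro!: derivative_eq_intros)
    from has_derivative_compose[OF this C1_D(3)[OF v, of _ UNIV]] show ?thesis
      by (rule has_derivative_imp_has_field_derivative) simp
  qed
qed

lemma v_below_tangent_y:
  assumes "t \<noteq> s"
  shows "v (pt x t) < v (pt x s) + vy (pt x s) * (t - s)"
proof -
  have "- v (pt x s) + - vy (pt x s) * (t - s) < - v (pt x t)"
  proof (rule above_tangent_if_derivative_strict_mono[where f = "\<lambda>t. - v (pt x t)" and f' = "\<lambda>t. - vy (pt x t)", OF _ _ assms])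
    show "((\<lambda>t. - v (pt x t)) has_field_derivative - vy (pt x t)) (at t)" for t
    proof -
      have "((\<lambda>t. pt x t) has_derivative (\<lambda>h. pt 0 h)) (at t)"
        by (rule has_derivative_pt) (auto intro!: derivative_eq_intros)
      from has_derivative_compose[OF this C1_D(3)[OF v, of _ UNIV]]
      have "((\<lambda>t. v (pt x t)) has_field_derivative vy (pt x t)) (at t)"
        by (rule has_derivative_imp_has_field_derivative) simp
      then show ?thesis by (rule DERIV_minus)
    qed
  qed (simp add: vy_less)
  then show ?thesis by simp
qed

lemma inner_pt: "pt a b \<bullet> z = a * z$1 + b * z$2"
  by (simp add: inner_vec_def sum_2)

text \<open>The values of \<open>v\<close> at the preimages \<open>a\<close> and \<open>a'\<close>
  are compared through the mixed point \<open>pt (a$1) (z'$2)\<close>: concavity in y bounds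
  \<open>v\<close> there from above by its tangent at \<open>a\<close>, convexity in x bounds it
  from below by its tangent at \<open>a'\<close>. At least one of the two bounds is strict, since
  otherwise \<open>a = a'\<close> and hence \<open>z = z'\<close>.\<close>

lemma u_above_tangent:
  assumes "z' \<noteq> z"
  shows "u z' > u z + Du z \<bullet> (z' - z)"
proof -
  define a where "a = H z"
  define a' where "a' = H z'"
  have a2: "a$2 = z$2" "a'$2 = z'$2" by (simp_all add: a_def a'_def)
  then have a: "pt (a$1) (z$2) = a" "pt (a'$1) (z'$2) = a'" by (metis pt_eta)+
  have va: "vx a = z$1" "vx a' = z'$1" by (simp_all add: a_def a'_def)
  have t1s: "v (pt (a$1) (z'$2)) < v a + vy a * (z'$2 - z$2)" if "z'$2 \<noteq> z$2"
    using v_below_tangent_y[OF that, of "a$1"] unfolding a .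
  have t1: "v (pt (a$1) (z'$2)) \<le> v a + vy a * (z'$2 - z$2)"
  proof (cases "z'$2 = z$2")
    case True
    then show ?thesis by (simp add: a)
  qed (use t1s in simp)
  have t2s: "v a' + z'$1 * (a$1 - a'$1) < v (pt (a$1) (z'$2))" if "a$1 \<noteq> a'$1"
    using v_above_tangent_x[OF that, of "z'$2"] unfolding a va .
  have t2: "v a' + z'$1 * (a$1 - a'$1) \<le> v (pt (a$1) (z'$2))"
  proof (cases "a$1 = a'$1")
    case True
    then show ?thesis by (simp add: a)
  qed (use t2s in simp)
  have "z'$2 \<noteq> z$2 \<or> a$1 \<noteq> a'$1"
  proof (rule ccontr)
    assume "\<not> ?thesis"
    then have "a = a'" using a by simp
    then have "F a = F a'" by simp
    then show False using assms by (simp add: a_def a'_def)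
  qed
  then have "v a' + z'$1 * (a$1 - a'$1) < v a + vy a * (z'$2 - z$2)"
    using t1 t1s t2 t2s by linarith
  then show ?thesis
    by (simp add: u_def Du_def inner_pt a_def[symmetric] a'_def[symmetric] algebra_simps)
qed

lemma u_ge_tangent: "u z' \<ge> u z + Du z \<bullet> (z' - z)"
  using u_above_tangent[of z' z] by (cases "z' = z") auto

lemma continuous_on_Du: "continuous_on S Du"
  unfolding Du_def[abs_def]
  by (intro continuous_intros continuous_on_H continuous_on_compose2[OF C1_D(4)[OF vy]]) auto

lemma u_derivative: "(u has_derivative (\<lambda>h. Du z \<bullet> h)) (at z within S)"
proof (rule has_derivative_at_withinI)
  show "(u has_derivative (\<lambda>h. Du z \<bullet> h)) (at z)"
    unfolding has_derivative_at_within
  proof (intro conjI)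
    show "bounded_linear ((\<bullet>) (Du z))" by (rule bounded_linear_inner_right)
    have "continuous (at z) Du" using continuous_on_Du[of UNIV] by (simp add: continuous_on_eq_continuous_at)
    then have "((\<lambda>y. norm (Du y - Du z)) \<longlongrightarrow> 0) (at z)"
      using isCont_def LIM_zero tendsto_norm_zero by blast
    moreover have "norm ((u y - u z - Du z \<bullet> (y - z)) /\<^sub>R norm (y - z)) \<le> norm (Du y - Du z)" for y
    proof -
      have "0 \<le> u y - u z - Du z \<bullet> (y - z)" using u_ge_tangent[of z y] by simp
      moreover have "u y - u z - Du z \<bullet> (y - z) \<le> (Du y - Du z) \<bullet> (y - z)"
        using u_ge_tangent[of y z] by (simp add: inner_diff_left inner_diff_right)
      moreover have "(Du y - Du z) \<bullet> (y - z) \<le> norm (Du y - Du z) * norm (y - z)"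
        by (rule norm_cauchy_schwarz)
      ultimately show ?thesis
        by (cases "y = z") (simp_all add: divide_simps)
    qed
    ultimately show "((\<lambda>y. (u y - u z - Du z \<bullet> (y - z)) /\<^sub>R norm (y - z)) \<longlongrightarrow> 0) (at z)"
      by (rule Lim_null_comparison[OF always_eventually[rule_format], rotated])
  qed
qed

lemma u_sphere: "norm z = 1 \<Longrightarrow> u z = 0"
proof -
  assume z: "norm z = 1"
  then have "(z$1)\<^sup>2 + (z$2)\<^sup>2 = 1" by (simp add: norm_vec_def L2_set_def sum_2)
  then show "u z = 0" using z H_outside[of z] outside[of z]
    by (simp add: u_def power2_eq_square field_simps)
qed

lemma strictly_convex_u:
  assumes "0 < c" "convex S"
  shows "strictly_convex_on S (\<lambda>z. c * u z)"
proof -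
  have less: "u ((1 - t) *\<^sub>R x + t *\<^sub>R y) < (1 - t) * u x + t * u y"
    if "x \<noteq> y" "0 < t" "t < 1" for x y t
  proof -
    define z where "z = (1 - t) *\<^sub>R x + t *\<^sub>R y"
    have xz: "x - z = t *\<^sub>R (x - y)" and yz: "y - z = (1 - t) *\<^sub>R (y - x)"
      by (simp_all add: z_def algebra_simps)
    have "x \<noteq> z" "y \<noteq> z" using xz yz that by auto
    then have "u z + Du z \<bullet> (x - z) < u x" "u z + Du z \<bullet> (y - z) < u y"
      by (simp_all add: u_above_tangent)
    then have "(1 - t) * (u z + Du z \<bullet> (x - z)) + t * (u z + Du z \<bullet> (y - z)) < (1 - t) * u x + t * u y"
      using that by (intro add_strict_mono mult_strict_left_mono) auto
    moreover have "(1 - t) * (u z + Du z \<bullet> (x - z)) + t * (u z + Du z \<bullet> (y - z)) = u z"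
      by (simp add: xz yz inner_diff_right algebra_simps)
    ultimately show ?thesis by (simp add: z_def)
  qed
  have lessc: "c * u ((1 - t) *\<^sub>R x + t *\<^sub>R y) < (1 - t) * (c * u x) + t * (c * u y)"
    if "x \<noteq> y" "0 < t" "t < 1" for x y t
    using mult_strict_left_mono[OF less[OF that] assms(1)] by (simp add: algebra_simps)
  have "convex_on S (\<lambda>z. c * u z)"
  proof (rule convex_onI)
    fix t x y assume "0 < (t::real)" "t < 1" "x \<in> S" "y \<in> S"
    then show "c * u ((1 - t) *\<^sub>R x + t *\<^sub>R y) \<le> (1 - t) * (c * u x) + t * (c * u y)"
      using lessc[of x y t] by (cases "x = y") (auto simp: algebra_simps)
  qed fact
  then show ?thesis using lessc assms by (auto simp: strictly_convex_on_def)
qed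

lemma subdiff_u:
  assumes "0 < c" "open S" "z \<in> S"
  shows "subdiff S (\<lambda>z. c * u z) z = {c *\<^sub>R Du z}"
proof
  show "{c *\<^sub>R Du z} \<subseteq> subdiff S (\<lambda>z. c * u z) z"
    using mult_left_mono[OF u_ge_tangent[of z] less_imp_le[OF assms(1)]]
    by (auto simp: subdiff_def algebra_simps)
  show "subdiff S (\<lambda>z. c * u z) z \<subseteq> {c *\<^sub>R Du z}"
  proof
    fix p assume p: "p \<in> subdiff S (\<lambda>z. c * u z) z"
    define g where "g y = c * u y - p \<bullet> y" for y
    have "(g has_derivative (\<lambda>h. c * (Du z \<bullet> h) - p \<bullet> h)) (at z)"
      unfolding g_def
      by (intro has_derivative_diff has_derivative_mult_right u_derivative bounded_linear_imp_has_derivative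
         bounded_linear_inner_right)
    moreover have "\<forall>y\<in>S. g z \<le> g y"
      using p by (auto simp: subdiff_def g_def inner_diff_right algebra_simps)
    ultimately have "(\<lambda>h. c * (Du z \<bullet> h) - p \<bullet> h) = (\<lambda>h. 0)"
      using differential_zero_maxmin[OF assms(3,2)] by blast
    then have "(c *\<^sub>R Du z - p) \<bullet> h = 0" for h
      by (simp add: fun_eq_iff inner_diff_left)
    then have "c *\<^sub>R Du z - p = 0" using inner_eq_zero_iff by blast
    then show "p \<in> {c *\<^sub>R Du z}" by simp
  qed
qed

end

section \<open>Bounded variation and the Monge-Ampere measure\<close>

lemma continuous_absolutely_integrable_ball:
  fixes w :: "real^2 \<Rightarrow> real"
  assumes "continuous_on (cball 0 1) w"
  shows "w absolutely_integrable_on ball 0 1"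
proof -
  have "set_integrable lborel (cball 0 1) w"
    unfolding set_integrable_def by (rule borel_integrable_compact[OF compact_cball assms])
  then have "set_integrable lborel (ball 0 1) w"
    by (rule set_integrable_subset) auto
  then show ?thesis
    by (auto simp: set_integrable_def intro!: integrable_completion[THEN iffD2])
qed

context partial_legendre
begin

section \<open>Push-forward by \<open>F\<close> and the total variation of functions of
  \<open>H\<close>\<close>

lemma C1_comp_F:
  assumes "C1 f a b"
  shows "C1 (\<lambda>z. f (F z)) (\<lambda>z. vxx z * a (F z)) (\<lambda>z. vxy z * a (F z) + b (F z))"
  unfolding C1_def
proof (intro conjI allI)
  have *: "continuous_on UNIV (\<lambda>z. g (F z))" if "continuous_on UNIV g" for g :: "real^2 \<Rightarrow> real"
    by (rule continuous_on_compose2[OF that continuous_on_F]) auto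
  show "continuous_on UNIV (\<lambda>z. vxx z * a (F z))" "continuous_on UNIV (\<lambda>z. vxy z * a (F z) + b (F z))"
    by (intro continuous_intros * C1_D[OF assms] C1_D[OF vx])+
  fix z
  have "((\<lambda>z. f (F z)) has_derivative (\<lambda>h. a (F z) * pt (vxx z * h$1 + vxy z * h$2) (0 * h$1 + 1 * h$2) $ 1
     + b (F z) * pt (vxx z * h$1 + vxy z * h$2) (0 * h$1 + 1 * h$2) $ 2)) (at z)"
    by (rule has_derivative_compose[OF F_derivative[unfolded DF_def[abs_def]] C1_D(3)[OF assms]])
  then show "((\<lambda>z. f (F z)) has_derivative (\<lambda>h. vxx z * a (F z) * h $ 1 + (vxy z * a (F z) + b (F z)) * h $ 2)) (at z)"
    by (rule has_derivative_eq_rhs) (simp add: algebra_simps)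
qed

lemma det_DF: "det (matrix (DF z)) = vxx z"
  unfolding DF_def[abs_def] det_matrix_pt by simp

lemma abs_det_DF: "\<bar>det (matrix (DF z))\<bar> = vxx z"
  using vxx_nonneg by (simp add: det_DF)

lemma F_in_ball_iff: "F z \<in> ball 0 1 \<longleftrightarrow> z \<in> ball 0 1"
  using norm_F_iff(1)[of 1 z] by simp

text \<open>Injectivity and differentiability of \<open>F\<close> suffice for the change of
  variables; zeros of the Jacobian \<open>vxx\<close> do no harm.\<close>

lemma integral_ball_F:
  assumes "integrable lborel (\<lambda>z. vxx z * g (F z))" "\<And>z. z \<notin> ball 0 1 \<Longrightarrow> g z = 0"
  shows "g absolutely_integrable_on ball 0 1"
    "integral (ball 0 1) g = (\<integral>z. vxx z * g (F z) \<partial>lborel)"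
proof -
  have 0: "vxx z * g (F z) = 0" if "z \<notin> ball 0 1" for z
    using assms(2)[of "F z"] F_in_ball_iff[of z] that by simp
  have int: "(\<lambda>z. vxx z * g (F z)) absolutely_integrable_on ball 0 1"
    "integral (ball 0 1) (\<lambda>z. vxx z * g (F z)) = (\<integral>z. vxx z * g (F z) \<partial>lborel)"
    by (rule integral_eq_lborel[OF assms(1) 0], simp)+
  have "g absolutely_integrable_on F ` ball 0 1 \<and> integral (F ` ball 0 1) g = (\<integral>z. vxx z * g (F z) \<partial>lborel)"
    by (rule iffD1[OF has_absolute_integral_change_of_variables_real])
      (use int F_derivative inj_F in \<open>auto simp: abs_det_DF inj_on_def\<close>)
  then show "g absolutely_integrable_on ball 0 1"
    "integral (ball 0 1) g = (\<integral>z. vxx z * g (F z) \<partial>lborel)"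
    using F_ball[of 1] by auto
qed

lemma integrable_comp_F:
  assumes "C1c \<phi> (ball 0 1)" "continuous_on UNIV g"
  shows "bounded_support (\<lambda>z. \<phi> (F z))" "integrable lborel (\<lambda>z. g z * \<phi> (F z))"
proof -
  have "\<phi> (F z) = 0" if "z \<notin> ball 0 1" for z
    using C1c_outside(1)[OF assms(1), of "F z"] F_in_ball_iff[of z] that by simp
  from bounded_support_bounded[OF bounded_ball this]
  show *: "bounded_support (\<lambda>z. \<phi> (F z))" .
  show "integrable lborel (\<lambda>z. g z * \<phi> (F z))"
    by (rule integrable_bounded_support)
      (intro continuous_intros assms(2) C1_D(4)[OF C1_comp_F[OF C1c_C1[OF assms(1)]]]
        bounded_support_mult *)+
qed

text \<open>In distributional terms, the first derivative of \<open>q (H z)\<close> is the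
  push-forward under \<open>F\<close> of the measure with density \<open>q1\<close>: the Jacobian
  \<open>vxx\<close> of the substitution is exactly the factor produced by differentiating
  \<open>\<phi> (F z)\<close> horizontally.\<close>

lemma integral_H_pd1:
  assumes q: "C1 q q1 q2" and \<phi>: "C1c \<phi> (ball 0 1)"
  shows "(\<lambda>z. q (H z) * pd 1 \<phi> z) absolutely_integrable_on ball 0 1"
    "integral (ball 0 1) (\<lambda>z. q (H z) * pd 1 \<phi> z) = - (\<integral>z. q1 z * \<phi> (F z) \<partial>lborel)"
proof -
  note \<psi> = C1_comp_F[OF C1c_C1[OF \<phi>]]
  note supp = integrable_comp_F(1)[OF \<phi> continuous_on_const]
  note q\<psi> = C1_mult[OF q \<psi>]
  have i1: "integrable lborel (\<lambda>z. q1 z * \<phi> (F z))"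
    by (rule integrable_comp_F(2)[OF \<phi> C1_D(1)[OF q]])
  have i2: "integrable lborel (\<lambda>z. q z * (vxx z * pd 1 \<phi> (F z)))"
    by (intro integrable_bounded_support continuous_intros bounded_support_mult C1_D[OF q] C1_D[OF \<psi>]
         C1_bounded_support(1)[OF \<psi> supp])
  have "(\<integral>z. q1 z * \<phi> (F z) + q z * (vxx z * pd 1 \<phi> (F z)) \<partial>lborel) = 0"
    by (rule integral_partial_0(1)[OF q\<psi> bounded_support_mult(1)[OF supp]])
  then have eq: "(\<integral>z. q z * (vxx z * pd 1 \<phi> (F z)) \<partial>lborel) = - (\<integral>z. q1 z * \<phi> (F z) \<partial>lborel)"
    using i1 i2 by simp
  have rew: "(\<lambda>z. q z * (vxx z * pd 1 \<phi> (F z))) = (\<lambda>z. vxx z * (q (H (F z)) * pd 1 \<phi> (F z)))"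
    by (simp add: fun_eq_iff mult_ac)
  have 0: "q (H z) * pd 1 \<phi> z = 0" if "z \<notin> ball 0 1" for z
    using C1c_outside(2)[OF \<phi> that] by simp
  from integral_ball_F[of "\<lambda>z. q (H z) * pd 1 \<phi> z", OF i2[unfolded rew] 0] eq
  show "(\<lambda>z. q (H z) * pd 1 \<phi> z) absolutely_integrable_on ball 0 1"
    "integral (ball 0 1) (\<lambda>z. q (H z) * pd 1 \<phi> z) = - (\<integral>z. q1 z * \<phi> (F z) \<partial>lborel)"
    by (simp_all add: rew)
qed

text \<open>In distributional terms, the second derivative is the push-forward under
  \<open>F\<close> of the density \<open>vxx q2 - vxy q1\<close>.\<close>

lemma integral_H_pd2:
  assumes q: "C1 q q1 q2" and \<phi>: "C1c \<phi> (ball 0 1)"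
  shows "(\<lambda>z. q (H z) * pd 2 \<phi> z) absolutely_integrable_on ball 0 1"
    "integral (ball 0 1) (\<lambda>z. q (H z) * pd 2 \<phi> z) = (\<integral>z. (vxy z * q1 z - vxx z * q2 z) * \<phi> (F z) \<partial>lborel)"
proof -
  let ?\<psi>1 = "\<lambda>z. vxx z * pd 1 \<phi> (F z)"
  let ?\<psi>2 = "\<lambda>z. vxy z * pd 1 \<phi> (F z) + pd 2 \<phi> (F z)"
  note \<psi> = C1_comp_F[OF C1c_C1[OF \<phi>]]
  note supp = integrable_comp_F(1)[OF \<phi> continuous_on_const]
  note q\<psi> = C1_mult[OF q \<psi>]
  note cont = C1_D(1,2,4)[OF q] C1_D(1,2)[OF \<psi>] C1_D(1,2)[OF vx]
  have i: "integrable lborel (\<lambda>z. vxx z * q2 z * \<phi> (F z))" "integrable lborel (\<lambda>z. vxy z * q1 z * \<phi> (F z))"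
    by (intro integrable_comp_F(2)[OF \<phi>] continuous_intros cont)+
  have j: "integrable lborel (\<lambda>z. vxx z * q z * ?\<psi>2 z)" "integrable lborel (\<lambda>z. vxy z * q z * ?\<psi>1 z)"
    by (rule integrable_bounded_support, intro continuous_intros cont,
        rule bounded_support_mult, rule C1_bounded_support[OF \<psi> supp])+
  \<comment> \<open>The two products are the cross terms of the Jacobian determinant of
    \<open>vx\<close> and \<open>q z * \<phi> (F z)\<close>. Using
    \<open>integral_jacobian_0\<close> here keeps third derivatives of \<open>v\<close> out of the
    argument.\<close>
  have "(\<integral>z. vxx z * (q2 z * \<phi> (F z) + q z * ?\<psi>2 z) \<partial>lborel)
      = (\<integral>z. vxy z * (q1 z * \<phi> (F z) + q z * ?\<psi>1 z) \<partial>lborel)"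
    by (rule integral_jacobian_0[OF vx q\<psi> bounded_support_mult(1)[OF supp]])
  also have "(\<integral>z. vxx z * (q2 z * \<phi> (F z) + q z * ?\<psi>2 z) \<partial>lborel)
     = (\<integral>z. vxx z * q2 z * \<phi> (F z) + vxx z * q z * ?\<psi>2 z \<partial>lborel)"
    by (simp add: algebra_simps)
  also have "(\<integral>z. vxy z * (q1 z * \<phi> (F z) + q z * ?\<psi>1 z) \<partial>lborel)
     = (\<integral>z. vxy z * q1 z * \<phi> (F z) + vxy z * q z * ?\<psi>1 z \<partial>lborel)"
    by (simp add: algebra_simps)
  finally have "(\<integral>z. vxx z * q z * ?\<psi>2 z \<partial>lborel) - (\<integral>z. vxy z * q z * ?\<psi>1 z \<partial>lborel)
     = (\<integral>z. vxy z * q1 z * \<phi> (F z) \<partial>lborel) - (\<integral>z. vxx z * q2 z * \<phi> (F z) \<partial>lborel)"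
    using i j by simp
  then have eq: "(\<integral>z. vxx z * q z * ?\<psi>2 z - vxy z * q z * ?\<psi>1 z \<partial>lborel)
     = (\<integral>z. (vxy z * q1 z - vxx z * q2 z) * \<phi> (F z) \<partial>lborel)"
    using i j by (simp add: left_diff_distrib)
  have i2: "integrable lborel (\<lambda>z. vxx z * q z * ?\<psi>2 z - vxy z * q z * ?\<psi>1 z)" using j by simp
  \<comment> \<open>The terms containing \<open>pd 1 \<phi>\<close> cancel.\<close>
  have rew: "(\<lambda>z. vxx z * q z * ?\<psi>2 z - vxy z * q z * ?\<psi>1 z) = (\<lambda>z. vxx z * (q (H (F z)) * pd 2 \<phi> (F z)))"
    by (simp add: fun_eq_iff algebra_simps)
  have 0: "q (H z) * pd 2 \<phi> z = 0" if "z \<notin> ball 0 1" for z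
    using C1c_outside(3)[OF \<phi> that] by simp
  from integral_ball_F[of "\<lambda>z. q (H z) * pd 2 \<phi> z", OF i2[unfolded rew] 0] eq[unfolded rew]
  show "(\<lambda>z. q (H z) * pd 2 \<phi> z) absolutely_integrable_on ball 0 1"
    "integral (ball 0 1) (\<lambda>z. q (H z) * pd 2 \<phi> z) = (\<integral>z. (vxy z * q1 z - vxx z * q2 z) * \<phi> (F z) \<partial>lborel)"
    by simp_all
qed

text \<open>Both distributional derivatives are push-forwards of continuous densities, so the
  integrals of these over the disc bound the variation, even where \<open>F\<close> collapses a set
  of positive measure to a null set.\<close>

lemma BV_comp_H:
  assumes q: "C1 q q1 q2"
  shows "BV (ball 0 1) (\<lambda>z. q (H z))"
proof -
  have cq: "continuous_on (cball 0 1) (\<lambda>z. q (H z))"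
    by (rule continuous_on_compose2[OF C1_D(4)[OF q] continuous_on_H]) auto
  let ?r = "\<lambda>z. vxy z * q1 z - vxx z * q2 z"
  let ?B = "\<lambda>z. indicator (cball 0 1) z *\<^sub>R (\<bar>q1 z\<bar> + \<bar>?r z\<bar>)"
  note cont = C1_D(1,2)[OF q] C1_D(1,2)[OF vx]
  have cr: "continuous_on UNIV ?r" by (intro continuous_intros cont)
  have "integral (ball 0 1) (\<lambda>z. q (H z) * (\<Sum>i\<in>UNIV. pd i (\<phi> i) z)) \<le> (\<integral>z. ?B z \<partial>lborel)"
    if \<phi>: "\<forall>i. C1c (\<phi> i) (ball 0 1)" and le: "\<forall>z. (\<Sum>i\<in>UNIV. (\<phi> i z)\<^sup>2) \<le> 1" for \<phi> :: "2 \<Rightarrow> real^2 \<Rightarrow> real"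
  proof -
    have \<phi>1: "C1c (\<phi> 1) (ball 0 1)" and \<phi>2: "C1c (\<phi> 2) (ball 0 1)" using \<phi> by auto
    have le1: "\<bar>\<phi> 1 z\<bar> \<le> 1" "\<bar>\<phi> 2 z\<bar> \<le> 1" for z
    proof -
      have "(\<phi> 1 z)\<^sup>2 + (\<phi> 2 z)\<^sup>2 \<le> 1" using le by (simp add: sum_2)
      then have "(\<phi> 1 z)\<^sup>2 \<le> 1" "(\<phi> 2 z)\<^sup>2 \<le> 1"
        using zero_le_power2[of "\<phi> 1 z"] zero_le_power2[of "\<phi> 2 z"] by linarith+
      then show "\<bar>\<phi> 1 z\<bar> \<le> 1" "\<bar>\<phi> 2 z\<bar> \<le> 1" by (simp_all add: abs_square_le_1)
    qed
    note I1 = integral_H_pd1[OF q \<phi>1] and I2 = integral_H_pd2[OF q \<phi>2]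
    have "integral (ball 0 1) (\<lambda>z. q (H z) * (\<Sum>i\<in>UNIV. pd i (\<phi> i) z))
       = integral (ball 0 1) (\<lambda>z. q (H z) * pd 1 (\<phi> 1) z + q (H z) * pd 2 (\<phi> 2) z)"
      by (simp add: sum_2 distrib_left)
    also have "\<dots> = integral (ball 0 1) (\<lambda>z. q (H z) * pd 1 (\<phi> 1) z) + integral (ball 0 1) (\<lambda>z. q (H z) * pd 2 (\<phi> 2) z)"
      using I1(1) I2(1) by (intro integral_add) (auto simp: absolutely_integrable_on_def)
    also have "\<dots> = (\<integral>z. ?r z * \<phi> 2 (F z) \<partial>lborel) - (\<integral>z. q1 z * \<phi> 1 (F z) \<partial>lborel)"
      using I1(2) I2(2) by simp
    also have "\<dots> = (\<integral>z. ?r z * \<phi> 2 (F z) - q1 z * \<phi> 1 (F z) \<partial>lborel)"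
      by (intro Bochner_Integration.integral_diff[symmetric] integrable_comp_F(2)[OF \<phi>1] integrable_comp_F(2)[OF \<phi>2]
          cr C1_D(1)[OF q])
    also have "\<dots> \<le> (\<integral>z. ?B z \<partial>lborel)"
    proof (rule integral_mono)
      show "integrable lborel (\<lambda>z. ?r z * \<phi> 2 (F z) - q1 z * \<phi> 1 (F z))"
        by (intro Bochner_Integration.integrable_diff integrable_comp_F(2)[OF \<phi>1] integrable_comp_F(2)[OF \<phi>2]
          cr C1_D(1)[OF q])
      have "continuous_on (cball 0 1) (\<lambda>z. \<bar>q1 z\<bar> + \<bar>?r z\<bar>)"
        by (rule continuous_on_subset[of UNIV]) (intro continuous_intros cont, simp)
      then show "integrable lborel ?B" by (intro borel_integrable_compact) auto
      fix z
      show "?r z * \<phi> 2 (F z) - q1 z * \<phi> 1 (F z) \<le> ?B z"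
      proof (cases "z \<in> ball 0 1")
        case True
        have "?r z * \<phi> 2 (F z) \<le> \<bar>?r z\<bar> * 1" "- (q1 z * \<phi> 1 (F z)) \<le> \<bar>q1 z\<bar> * 1"
          using le1[of "F z"] mult_left_mono[of "\<bar>\<phi> 2 (F z)\<bar>" 1 "\<bar>?r z\<bar>"] mult_left_mono[of "\<bar>\<phi> 1 (F z)\<bar>" 1 "\<bar>q1 z\<bar>"]
          unfolding abs_mult[symmetric] by linarith+
        moreover have "indicator (cball 0 1) z = (1::real)" using True by simp
        ultimately show ?thesis by simp
      next
        case False
        then have "F z \<notin> ball 0 1" using F_in_ball_iff by simp
        then have "\<phi> 1 (F z) = 0" "\<phi> 2 (F z) = 0" using C1c_outside(1)[OF \<phi>1] C1c_outside(1)[OF \<phi>2] by auto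
        then show ?thesis by simp
      qed
    qed
    finally show ?thesis .
  qed
  then show ?thesis
    unfolding BV_def using continuous_absolutely_integrable_ball[OF cq] by blast
qed

lemma BV_Du: "BV (ball 0 1) (\<lambda>z. (c *\<^sub>R Du z) $ j)"
proof -
  have "BV (ball 0 1) (\<lambda>z. c * H z $ 1)" "BV (ball 0 1) (\<lambda>z. - c * vy (H z))"
    using BV_comp_H[OF C1_cmult[OF C1_nth(1), of c]] BV_comp_H[OF C1_cmult[OF vy, of "- c"]] by simp_all
  then show ?thesis using exhaust_2[of j] by (auto simp: Du_def)
qed

section \<open>The Monge-Ampere density and the image of the gradient\<close>

definition density :: "real \<Rightarrow> real^2 \<Rightarrow> real" where
  "density c z = c\<^sup>2 * (- vyy (H z) / vxx (H z))"

lemma density_nonneg: "0 \<le> density c z"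
  unfolding density_def using vyy_nonpos[of "H z"] vxx_nonneg[of "H z"]
  by (intro mult_nonneg_nonneg divide_nonneg_nonneg) auto

lemma borel_measurable_density: "density c \<in> borel_measurable borel"
proof -
  have [measurable]: "H \<in> borel_measurable borel" "vxx \<in> borel_measurable borel" "vyy \<in> borel_measurable borel"
    using continuous_on_H C1_D[OF vx] C1_D[OF vy] by (auto intro: borel_measurable_continuous_onI)
  show ?thesis unfolding density_def[abs_def] by measurable
qed

text \<open>Sard's theorem: the differential of \<open>F\<close> drops rank on this set. The same
  null set is the exceptional set for the bounds on the density and, later, the carrier of singular
  mass of \<open>u_xx\<close>.\<close>

lemma negligible_F_degenerate: "negligible (F ` {z. vxx z = 0})"
proof (rule baby_Sard)
  fix z assume "z \<in> {z. vxx z = 0}"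
  then show "rank (matrix (DF z)) < CARD(2)"
    using det_DF[of z] by (simp add: det_eq_0_rank)
qed (auto intro: F_derivative)

lemma density_bounds:
  assumes "0 < c" "c\<^sup>2 * K \<le> 1"
  shows "AE z in lebesgue. 0 < density c z \<and> density c z \<le> 1"
proof -
  have "AE z in lebesgue. z \<notin> F ` {z. vxx z = 0}"
    using negligible_F_degenerate by (intro AE_not_in) (simp add: negligible_iff_null_sets)
  then show ?thesis
  proof (rule AE_mp, intro AE_I2 impI)
    fix z assume z: "z \<notin> F ` {z. vxx z = 0}"
    have "vxx (H z) \<noteq> 0"
    proof
      assume "vxx (H z) = 0"
      then have "F (H z) \<in> F ` {z. vxx z = 0}" by blast
      then show False using z by simp
    qed
    then have pos: "0 < vxx (H z)" "0 < - vyy (H z)"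
      using vxx_nonneg[of "H z"] vyy_nonpos[of "H z"] degenerate[of "H z"] by linarith+
    have "- vyy (H z) / vxx (H z) \<le> K" using pos K(2)[of "H z"] by (simp add: divide_simps)
    then have "c\<^sup>2 * (- vyy (H z) / vxx (H z)) \<le> c\<^sup>2 * K" by (rule mult_left_mono) simp
    moreover have "0 < c\<^sup>2 * (- vyy (H z) / vxx (H z))"
      using pos assms(1) by (intro mult_pos_pos divide_pos_pos) auto
    ultimately show "0 < density c z \<and> density c z \<le> 1"
      using assms(2) unfolding density_def by linarith
  qed
qed

text \<open>This is \<open>c *\<^sub>R Du (F z)\<close>, the gradient read in the coordinates in
  which it is continuously differentiable.\<close>

definition gradient_map :: "real \<Rightarrow> real^2 \<Rightarrow> real^2" where
  "gradient_map c z = pt (c * z$1) (- c * vy z)"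

definition D_gradient_map :: "real \<Rightarrow> real^2 \<Rightarrow> real^2 \<Rightarrow> real^2" where
  "D_gradient_map c z h = pt (c * h$1 + 0 * h$2) (- c * vyx z * h$1 + - c * vyy z * h$2)"

lemma gradient_map_derivative:
  "(gradient_map c has_derivative D_gradient_map c z) (at z within S)"
proof -
  have "((\<lambda>z. c * z$1) has_derivative (\<lambda>h. c * h$1 + 0 * h$2)) (at z within S)"
    using has_derivative_mult_right[OF has_derivative_nth, of c] by simp
  moreover have "((\<lambda>z. - c * vy z) has_derivative (\<lambda>h. - c * vyx z * h$1 + - c * vyy z * h$2)) (at z within S)"
    by (rule has_derivative_eq_rhs[OF has_derivative_mult_right[OF C1_D(3)[OF vy]]]) (simp add: algebra_simps)
  ultimately show ?thesis
    unfolding gradient_map_def[abs_def] D_gradient_map_def[abs_def] by (rule has_derivative_pt)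
qed

lemma abs_det_D_gradient_map: "\<bar>det (matrix (D_gradient_map c z))\<bar> = - (c\<^sup>2 * vyy z)"
proof -
  have "det (matrix (D_gradient_map c z)) = - (c\<^sup>2 * vyy z)"
    unfolding D_gradient_map_def[abs_def] det_matrix_pt by (simp add: power2_eq_square)
  moreover have "c\<^sup>2 * vyy z \<le> 0" using vyy_nonpos[of z] by (simp add: mult_nonneg_nonpos)
  ultimately show ?thesis by simp
qed

lemma inj_gradient_map:
  assumes "c \<noteq> 0"
  shows "inj (gradient_map c)"
proof (rule injI)
  fix a b assume "gradient_map c a = gradient_map c b"
  then have eq: "a$1 = b$1" "vy a = vy b" using assms by (simp_all add: gradient_map_def pt_eq_iff)
  have b: "pt (a$1) (b$2) = b" using eq by simp
  show "a = b"
  proof (cases "a$2" "b$2" rule: linorder_cases)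
    case less
    from vy_less[OF this, of "a$1"] show ?thesis unfolding b pt_eta using eq(2) by simp
  next
    case equal
    then have "a = pt (a$1) (b$2)" by (metis pt_eta)
    then show ?thesis using b by simp
  next
    case greater
    from vy_less[OF this, of "a$1"] show ?thesis unfolding b pt_eta using eq(2) by simp
  qed
qed

text \<open>Two substitutions start from the same set \<open>T\<close>, the preimage of
  \<open>E\<close> under \<open>F\<close>: the gradient map with Jacobian \<open>- c^2 vyy\<close>
  produces the image of the gradient, and \<open>F\<close> with Jacobian \<open>vxx\<close> produces
  \<open>E\<close>. The density is the quotient of the two Jacobians.\<close>

lemma gradient_image_measure:
  assumes c: "0 < c" and E: "E \<in> sets borel" "E \<subseteq> ball 0 1"
  shows "(\<lambda>z. c *\<^sub>R Du z) ` E \<in> sets lebesgue"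
    "emeasure lebesgue ((\<lambda>z. c *\<^sub>R Du z) ` E) = (\<integral>\<^sup>+ z\<in>E. ennreal (density c z) \<partial>lebesgue)"
proof -
  define T where "T = F -` E"
  have FT: "F ` T = E" using surj_F by (simp add: T_def surj_image_vimage_eq)
  have "F \<in> borel_measurable borel" by (intro borel_measurable_continuous_onI continuous_on_F)
  then have Tb: "T \<in> sets borel" using E(1) unfolding T_def by (rule measurable_sets_borel)
  have Tball: "T \<subseteq> ball 0 1" 
  proof
    fix z assume "z \<in> T"
    then have "F z \<in> ball 0 1" using E(2) by (auto simp: T_def)
    then show "z \<in> ball 0 1" by (simp only: F_in_ball_iff)
  qed
  have Tl: "T \<in> sets lebesgue" using Tb by simp
  have "(\<lambda>z. c *\<^sub>R Du z) ` E = (\<lambda>a. c *\<^sub>R Du (F a)) ` T"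
    unfolding FT[symmetric] image_image ..
  also have "\<dots> = gradient_map c ` T"
    by (rule image_cong) (simp_all add: Du_def gradient_map_def vec_eq_iff forall_2)
  finally have image: "(\<lambda>z. c *\<^sub>R Du z) ` E = gradient_map c ` T" .
  let ?J = "\<lambda>z. - (c\<^sup>2 * vyy z)"
  have J: "?J absolutely_integrable_on T"
  proof -
    have "continuous_on (cball 0 1) ?J"
      by (rule continuous_on_subset[of UNIV]) (intro continuous_intros C1_D[OF vy], simp)
    from set_integrable_subset[OF continuous_absolutely_integrable_ball[OF this] Tl Tball]
    show ?thesis .
  qed
  have "(\<lambda>_. 1::real) absolutely_integrable_on gradient_map c ` T \<and> integral (gradient_map c ` T) (\<lambda>_. 1) = integral T ?J"
    using has_absolute_integral_change_of_variables_real[OF Tl gradient_map_derivative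
        inj_on_subset[OF inj_gradient_map subset_UNIV], of c "\<lambda>_. 1" "integral T ?J"] J c
    by (simp only: abs_det_D_gradient_map mult_1_right) simp
  then have L: "gradient_map c ` T \<in> lmeasurable" "measure lebesgue (gradient_map c ` T) = integral T ?J"
    by (simp_all add: lmeasurable_iff_integrable_on lmeasure_integral absolutely_integrable_on_def)
  then show "(\<lambda>z. c *\<^sub>R Du z) ` E \<in> sets lebesgue" by (simp add: image fmeasurableD)
  \<comment> \<open>Where \<open>vxx = 0\<close> the quotient in \<open>density\<close> has the
    default value 0, and the bound by \<open>K\<close> forces \<open>vyy = 0\<close>, so both sides
    vanish.\<close>
  have rew: "vxx z * density c (F z) = ?J z" for z
  proof (cases "vxx z = 0")
    case True
    then have "- vyy z \<le> 0" using K(2)[of z] by simp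
    then have "vyy z = 0" using vyy_nonpos[of z] by linarith
    then show ?thesis using True by simp
  qed (simp add: density_def)
  have D: "density c absolutely_integrable_on F ` T \<and> integral (F ` T) (density c) = integral T ?J"
    using has_absolute_integral_change_of_variables_real[OF Tl F_derivative
        inj_on_subset[OF inj_F subset_UNIV], of "density c" "integral T ?J"] J
    by (simp only: abs_det_DF rew) simp
  then have int: "integrable lebesgue (\<lambda>z. indicator E z * density c z)" unfolding FT set_integrable_def by simp
  have "(\<integral>\<^sup>+ z\<in>E. ennreal (density c z) \<partial>lebesgue) = (\<integral>\<^sup>+ z. ennreal (indicator E z * density c z) \<partial>lebesgue)"
    by (intro nn_integral_cong) (auto simp: indicator_def)
  also have "\<dots> = ennreal (\<integral>z. indicator E z * density c z \<partial>lebesgue)"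
    by (rule nn_integral_eq_integral[OF int]) (auto simp: density_nonneg)
  also have "(\<integral>z. indicator E z * density c z \<partial>lebesgue) = integral E (density c)"
    using set_lebesgue_integral_eq_integral(2)[of E "density c"] D unfolding FT set_lebesgue_integral_def by simp
  also have "\<dots> = measure lebesgue (gradient_map c ` T)" using D L(2) unfolding FT by simp
  also have "ennreal \<dots> = emeasure lebesgue (gradient_map c ` T)"
    using L(1) by (simp add: emeasure_eq_measure2 fmeasurableD)
  finally show "emeasure lebesgue ((\<lambda>z. c *\<^sub>R Du z) ` E) = (\<integral>\<^sup>+ z\<in>E. ennreal (density c z) \<partial>lebesgue)"
    by (simp add: image)
qed

end

section \<open>The distributional Hessian is not integrable\<close>

text \<open>Truncated powers are the smoothing device of the construction: squares of positive parts
  are C^1 and cubes are C^2. At the corner the difference quotient is bounded by a lower truncated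
  power.\<close>

lemma positive_part_power_derivative:
  "((\<lambda>t::real. max 0 t ^ Suc (Suc n)) has_field_derivative real (Suc (Suc n)) * max 0 t ^ Suc n) (at t)"
proof (cases t "0::real" rule: linorder_cases)
  case less
  have "((\<lambda>t::real. 0) has_field_derivative 0) (at t)" by simp
  then have "((\<lambda>t::real. max 0 t ^ Suc (Suc n)) has_field_derivative 0) (at t)"
    by (rule has_field_derivative_transform_within_open[of _ _ _ "{..<0}"]) (use less in auto)
  then show ?thesis using less by simp
next
  case greater
  have "((\<lambda>t::real. t ^ Suc (Suc n)) has_field_derivative real (Suc (Suc n)) * t ^ Suc n) (at t)"
    by (rule derivative_eq_intros refl | simp)+
  then have "((\<lambda>t::real. max 0 t ^ Suc (Suc n)) has_field_derivative real (Suc (Suc n)) * t ^ Suc n) (at t)"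
    by (rule has_field_derivative_transform_within_open[of _ _ _ "{0<..}"]) (use greater in auto)
  then show ?thesis using greater by simp
next
  case equal
  have "((\<lambda>h::real. max 0 h ^ Suc n) \<longlongrightarrow> max 0 0 ^ Suc n) (at 0)"
    by (intro tendsto_intros)
  then have "((\<lambda>h::real. max 0 h ^ Suc n) \<longlongrightarrow> 0) (at 0)" by simp
  moreover have "norm (max 0 h ^ Suc (Suc n) / h) \<le> max 0 h ^ Suc n" for h :: real
    by (cases "0 < h") (auto simp: max_def)
  ultimately have "((\<lambda>h::real. max 0 h ^ Suc (Suc n) / h) \<longlongrightarrow> 0) (at 0)"
    by (rule Lim_null_comparison[OF always_eventually[rule_format], rotated])
  then show ?thesis using equal by (simp add: has_field_derivative_iff)
qed

text \<open>The cube of the positive part of \<open>r^2 - dist^2\<close>. The second derivatives of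
  \<open>s\<close> are supplied through \<open>s1\<close> only, because the test functions are
  differentiated twice in the first direction.\<close>

lemma C1_ball_bump:
  fixes a :: "real^2" and r :: real
  obtains s s1 s2 s11 s12 where "C1 s s1 s2" "C1 s1 s11 s12" "\<And>z. 0 \<le> s z" "\<And>z. 0 < s z \<longleftrightarrow> z \<in> ball a r \<and> 0 < r"
proof (cases "0 < r")
  case False
  show ?thesis
    by (rule that[of "\<lambda>_. 0", OF C1_const C1_const]) (use False in auto)
next
  case True
  define w where "w z = r\<^sup>2 + (- 1) * (z$1 + (- (a$1))) * (z$1 + (- (a$1))) + (- 1) * (z$2 + (- (a$2))) * (z$2 + (- (a$2)))" for z :: "real^2"
  have w: "C1 w (\<lambda>z. (-2) * (z$1 + (- (a$1)))) (\<lambda>z. (-2) * (z$2 + (- (a$2))))"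
  proof -
    have "C1 w (\<lambda>z. 0 + (((0 * (z$1 + (- (a$1))) + (- 1) * (1 + 0)) * (z$1 + (- (a$1))) + (- 1) * (z$1 + (- (a$1))) * (1 + 0)))
       + ((0 * (z$2 + (- (a$2))) + (- 1) * (0 + 0)) * (z$2 + (- (a$2))) + (- 1) * (z$2 + (- (a$2))) * (0 + 0)))
       (\<lambda>z. 0 + (((0 * (z$1 + (- (a$1))) + (- 1) * (0 + 0)) * (z$1 + (- (a$1))) + (- 1) * (z$1 + (- (a$1))) * (0 + 0)))
       + ((0 * (z$2 + (- (a$2))) + (- 1) * (1 + 0)) * (z$2 + (- (a$2))) + (- 1) * (z$2 + (- (a$2))) * (1 + 0)))"
      unfolding w_def[abs_def] by (intro C1_add C1_mult C1_const C1_nth)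
    then show ?thesis by (simp add: algebra_simps)
  qed
  have w_eq: "w z = r\<^sup>2 - (dist a z)\<^sup>2" for z
  proof -
    have "(dist a z)\<^sup>2 = (a$1 - z$1)\<^sup>2 + (a$2 - z$2)\<^sup>2"
      by (simp add: dist_vec_def L2_set_def sum_2 dist_real_def)
    then show ?thesis by (simp add: w_def power2_eq_square algebra_simps)
  qed
  have pos: "0 < w z \<longleftrightarrow> z \<in> ball a r" for z
    unfolding w_eq using True by (auto intro: power_strict_mono dest: power_less_imp_less_base)
  note cw = C1_D(4)[OF w]
  have s: "C1 (\<lambda>z. max 0 (w z) ^ 3) (\<lambda>z. (3 * max 0 (w z) ^ 2) * ((-2) * (z$1 + (- (a$1))))) (\<lambda>z. (3 * max 0 (w z) ^ 2) * ((-2) * (z$2 + (- (a$2)))))"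
  proof (rule C1_compose[OF w, where g = "\<lambda>t. max 0 t ^ 3" and g' = "\<lambda>t. 3 * max 0 t ^ 2"])
    show "((\<lambda>t. max 0 t ^ 3) has_field_derivative 3 * max 0 (w z) ^ 2) (at (w z))" for z
      using positive_part_power_derivative[of 1 "w z"] by (simp add: numeral_3_eq_3 numeral_2_eq_2)
  qed (intro continuous_intros cw)
  have "C1 (\<lambda>z. max 0 (w z) ^ 2) (\<lambda>z. (2 * max 0 (w z)) * ((-2) * (z$1 + (- (a$1))))) (\<lambda>z. (2 * max 0 (w z)) * ((-2) * (z$2 + (- (a$2)))))"
  proof (rule C1_compose[OF w, where g = "\<lambda>t. max 0 t ^ 2" and g' = "\<lambda>t. 2 * max 0 t"])
    show "((\<lambda>t. max 0 t ^ 2) has_field_derivative 2 * max 0 (w z)) (at (w z))" for z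
      using positive_part_power_derivative[of 0 "w z"] by (simp add: numeral_2_eq_2)
  qed (intro continuous_intros cw)
  note s1 = C1_mult[OF C1_cmult[OF this, of 3] C1_mult[OF C1_const[of "-2"] C1_add[OF C1_nth(1) C1_const[of "- (a$1)"]]]]
  have nonneg: "0 \<le> max 0 (w z) ^ 3" and pos3: "0 < max 0 (w z) ^ 3 \<longleftrightarrow> z \<in> ball a r \<and> 0 < r" for z
    using pos[of z] True by (auto simp: max_def)
  show ?thesis by (rule that[OF s s1 nonneg pos3])
qed

lemma C1_finite_balls_bump:
  assumes "finite I"
  obtains s s1 s2 s11 s12 where "C1 s s1 s2" "C1 s1 s11 s12" "\<And>z. 0 \<le> s z"
    "\<And>z. 0 < s z \<longleftrightarrow> z \<in> (\<Union>(a, r)\<in>I. ball a r)"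
proof -
  have "\<exists>s s1 s2 s11 s12. C1 s s1 s2 \<and> C1 s1 s11 s12 \<and> (\<forall>z. 0 \<le> s z) \<and> (\<forall>z. 0 < s z \<longleftrightarrow> z \<in> (\<Union>(a, r)\<in>I. ball a r))"
    using assms
  proof (induction I rule: finite_induct)
    case empty
    show ?case
      by (rule exI[of _ "\<lambda>_. 0"], rule exI[of _ "\<lambda>_. 0"], rule exI[of _ "\<lambda>_. 0"], rule exI[of _ "\<lambda>_. 0"], rule exI[of _ "\<lambda>_. 0"])
        (simp add: C1_const)
  next
    case (insert x I)
    obtain s s1 s2 s11 s12 where s: "C1 s s1 s2" "C1 s1 s11 s12" "\<forall>z. 0 \<le> s z"
      "\<forall>z. 0 < s z \<longleftrightarrow> z \<in> (\<Union>(a, r)\<in>I. ball a r)" using insert.IH by blast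
    obtain a r where x: "x = (a, r)" by (cases x)
    obtain t t1 t2 t11 t12 where t: "C1 t t1 t2" "C1 t1 t11 t12" "\<And>z. 0 \<le> t z"
      "\<And>z. 0 < t z \<longleftrightarrow> z \<in> ball a r \<and> 0 < r" using C1_ball_bump[of a r] by blast
    have "0 < s z + t z \<longleftrightarrow> z \<in> (\<Union>(a, r)\<in>insert x I. ball a r)" for z
    proof -
      have "0 < s z + t z \<longleftrightarrow> 0 < s z \<or> 0 < t z"
        using s(3)[rule_format, of z] t(3)[of z] by linarith
      moreover have "0 < r" if "z \<in> ball a r"
        using that zero_le_dist[of a z] unfolding mem_ball by linarith
      ultimately show ?thesis using s(4) t(4) by (auto simp: x)
    qed
    moreover have "0 \<le> s z + t z" for z using s(3) t(3) by simp
    ultimately show ?case using C1_add[OF s(1) t(1)] C1_add[OF s(2) t(2)] by blast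
  qed
  then show ?thesis using that by blast
qed

lemma integrable_sub_ball:
  fixes g :: "real^2 \<Rightarrow> real"
  assumes g: "integrable lebesgue (\<lambda>z. indicator B z * g z)" and "\<phi> \<in> borel_measurable borel" "\<And>z. \<bar>\<phi> z\<bar> \<le> 1"
  shows "integrable lebesgue (\<lambda>z. indicator B z * g z * \<phi> z)"
proof (rule Bochner_Integration.integrable_bound[OF g])
  have "\<phi> \<in> borel_measurable lebesgue" using assms(2) by (simp add: measurable_completion)
  then show "(\<lambda>z. indicator B z * g z * \<phi> z) \<in> borel_measurable lebesgue"
    using borel_measurable_integrable[OF g] by (rule borel_measurable_times[rotated])
  show "AE z in lebesgue. norm (indicator B z * g z * \<phi> z) \<le> norm (indicator B z * g z)"
    using assms(3) by (intro AE_I2) (simp add: abs_mult mult_left_le)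
qed

lemma integrable_sub_ball_indicator:
  fixes g :: "real^2 \<Rightarrow> real"
  assumes "integrable lebesgue (\<lambda>z. indicator B z * g z)" "V \<in> sets borel"
  shows "integrable lebesgue (\<lambda>z. indicator B z * g z * indicator V z)"
  by (rule integrable_sub_ball[OF assms(1) borel_measurable_indicator[OF assms(2)]]) simp

section \<open>The second derivative \<open>u_xx\<close> as the push-forward of Lebesgue
  measure\<close>

context partial_legendre
begin

lemma C1_u: "C1 u (\<lambda>z. H z $ 1) (\<lambda>z. - vy (H z))"
  unfolding C1_def
proof (intro conjI allI)
  have *: "continuous_on UNIV (\<lambda>z. Du z $ i)" for i
    by (rule continuous_on_component[OF continuous_on_Du])
  show "continuous_on UNIV (\<lambda>z. H z $ 1)" "continuous_on UNIV (\<lambda>z. - vy (H z))"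
    using *[of 1] *[of 2] by (simp_all add: Du_def)
  fix z
  show "(u has_derivative (\<lambda>h. H z $ 1 * h$1 + - vy (H z) * h$2)) (at z)"
    using u_derivative[of z UNIV] by (simp add: Du_def inner_pt)
qed

text \<open>Both weak derivatives are moved onto \<open>\<phi>\<close>, one is moved back onto the
  classical derivative \<open>H z $ 1\<close> of \<open>u\<close>, and \<open>integral_H_pd1\<close>
  with the first coordinate as \<open>q\<close> turns the result into an integral of
  \<open>\<phi> (F z)\<close>: a weak density \<open>g\<close> would have to represent
  \<open>c\<close> times the push-forward of Lebesgue measure under \<open>F\<close>.\<close>

lemma weak_second_derivative:
  assumes G: "weak_partial (ball 0 1) (\<lambda>z. c * u z) 1 G" and g: "weak_partial (ball 0 1) G 1 g"
    and \<phi>: "C1 \<phi> p1 p2" "C1 p1 r1 r2" "compact L" "L \<subseteq> ball 0 1" "\<And>z. z \<notin> L \<Longrightarrow> \<phi> z = 0"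
  shows "integral (ball 0 1) (\<lambda>z. g z * \<phi> z) = c * (\<integral>z. \<phi> (F z) \<partial>lborel)"
proof -
  have openL: "open (- L)" using \<phi>(3) by (simp add: compact_imp_closed open_Compl)
  have p0: "p1 z = 0" if "z \<notin> L" for z
    using C1_zero_on_open(1)[OF \<phi>(1) openL, of z] \<phi>(5) that by simp
  have \<phi>c: "C1c \<phi> (ball 0 1)" by (rule C1_C1c[OF \<phi>(1,3,4,5)])
  have pc: "C1c p1 (ball 0 1)" by (rule C1_C1c[OF \<phi>(2,3,4) p0])
  have r0: "r1 z = 0" if "z \<notin> ball 0 1" for z
    using C1c_outside(2)[OF pc that] C1_pd[OF \<phi>(2)] by simp
  note supp = C1c_bounded_support[OF pc]
  have iu: "integrable lborel (\<lambda>z. u z * r1 z)"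
    by (intro integrable_bounded_support continuous_on_mult C1_D(4)[OF C1_u] C1_D(1)[OF \<phi>(2)]
         bounded_support_mult(1) C1_bounded_support(1)[OF \<phi>(2) supp])
  have iH: "integrable lborel (\<lambda>z. H z $ 1 * p1 z)"
    by (intro integrable_bounded_support continuous_on_mult C1_D(1)[OF C1_u] C1_D(4)[OF \<phi>(2)]
         bounded_support_mult(1) supp)
  have pd: "pd 1 \<phi> = p1" "pd 1 p1 = r1" by (rule C1_pd[OF \<phi>(1)], rule C1_pd[OF \<phi>(2)])
  have "integral (ball 0 1) (\<lambda>z. G z * p1 z) = - integral (ball 0 1) (\<lambda>z. g z * \<phi> z)"
    using g[unfolded weak_partial_def, THEN conjunct2, rule_format, OF \<phi>c] unfolding pd .
  moreover have "integral (ball 0 1) (\<lambda>z. c * u z * r1 z) = - integral (ball 0 1) (\<lambda>z. G z * p1 z)"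
    using G[unfolded weak_partial_def, THEN conjunct2, rule_format, OF pc] unfolding pd .
  ultimately have "integral (ball 0 1) (\<lambda>z. g z * \<phi> z) = integral (ball 0 1) (\<lambda>z. c * u z * r1 z)" by simp
  also have "\<dots> = c * integral (ball 0 1) (\<lambda>z. u z * r1 z)" by (simp add: mult.assoc)
  also have "integral (ball 0 1) (\<lambda>z. u z * r1 z) = (\<integral>z. u z * r1 z \<partial>lborel)"
    by (rule integral_eq_lborel(2)[OF iu]) (simp add: r0)
  also have "\<dots> = - (\<integral>z. H z $ 1 * p1 z \<partial>lborel)"
  proof -
    have "(\<integral>z. H z $ 1 * p1 z + u z * r1 z \<partial>lborel) = 0"
      by (rule integral_partial_0(1)[OF C1_mult[OF C1_u \<phi>(2)] bounded_support_mult(1)[OF supp]])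
    then show ?thesis using iu iH by simp
  qed
  also have "(\<integral>z. H z $ 1 * p1 z \<partial>lborel) = integral (ball 0 1) (\<lambda>z. H z $ 1 * p1 z)"
    by (rule integral_eq_lborel(2)[OF iH, symmetric]) (simp add: C1c_outside(1)[OF pc])
  also have "\<dots> = - (\<integral>z. 1 * \<phi> (F z) \<partial>lborel)"
    using integral_H_pd1(2)[OF C1_nth(1) \<phi>c] by (simp only: pd)
  finally show ?thesis by simp
qed

definition degenerate_set :: "(real^2) set" where "degenerate_set = {z. vxx z = 0}"

lemma degenerate_set:
  "compact degenerate_set" "degenerate_set \<subseteq> ball 0 1" "0 < measure lebesgue degenerate_set"
proof -
  have sub: "degenerate_set \<subseteq> cball 0 (3/4)"
    using outside_vxx by (force simp: degenerate_set_def not_le[symmetric])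
  have "closed degenerate_set"
    unfolding degenerate_set_def by (intro closed_Collect_eq C1_D[OF vx] continuous_on_const)
  then show c: "compact degenerate_set"
    using sub by (metis bounded_cball bounded_subset compact_eq_bounded_closed)
  show "degenerate_set \<subseteq> ball 0 1" using sub by force
  have "measure lebesgue degenerate_set \<noteq> 0"
    using not_negligible c by (simp add: degenerate_set_def negligible_iff_measure0 lmeasurable_compact)
  then show "0 < measure lebesgue degenerate_set" by (simp add: less_le)
qed

text \<open>The pushforward of Lebesgue measure under \<open>F\<close> is the measure \<open>u_xx\<close>. The density that a weak second
  derivative would provide is tested against smooth approximations of the indicator of a finite union of
  balls covering the null set \<open>F ` degenerate_set\<close>.\<close>

lemma weak_second_derivative_mass:
  assumes G: "weak_partial (ball 0 1) (\<lambda>z. c * u z) 1 G" and g: "weak_partial (ball 0 1) G 1 g" and c: "0 < c"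
    and U: "open U" "F ` degenerate_set \<subseteq> U"
  shows "c * measure lebesgue degenerate_set \<le> (\<integral>z. indicator (ball 0 1) z * \<bar>g z\<bar> * indicator U z \<partial>lebesgue)"
proof -
  let ?Z = "F ` degenerate_set"
  have Zc: "compact ?Z" by (rule compact_continuous_image[OF continuous_on_F degenerate_set(1)])
  have Zs: "?Z \<subseteq> U \<inter> ball 0 1" using U(2) degenerate_set(2) F_in_ball_iff by blast
  have "open (U \<inter> ball 0 1)" using U(1) by (intro open_Int) auto
  then have "\<forall>z\<in>?Z. \<exists>r>0. cball z r \<subseteq> U \<inter> ball 0 1" using Zs by (meson open_contains_cball subsetD)
  then obtain \<rho> where \<rho>: "\<And>z. z \<in> ?Z \<Longrightarrow> 0 < \<rho> z" "\<And>z. z \<in> ?Z \<Longrightarrow> cball z (\<rho> z) \<subseteq> U \<inter> ball 0 1"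
    by metis
  have "?Z \<subseteq> (\<Union>z\<in>?Z. ball z (\<rho> z))" using \<rho>(1) by force
  then obtain D where D: "D \<subseteq> ?Z" "finite D" "?Z \<subseteq> (\<Union>z\<in>D. ball z (\<rho> z))"
    using compactE_image[OF Zc, of ?Z "\<lambda>z. ball z (\<rho> z)"] by auto
  define V where "V = (\<Union>z\<in>D. ball z (\<rho> z))"
  define L where "L = (\<Union>z\<in>D. cball z (\<rho> z))"
  have L: "compact L" "L \<subseteq> U \<inter> ball 0 1" unfolding L_def using D(1,2) \<rho>(2) by (auto intro!: compact_UN)
  have "V \<subseteq> L" unfolding V_def L_def using ball_subset_cball by blast
  have "V \<in> sets borel" unfolding V_def by (intro borel_open open_UN) auto
  obtain s s1 s2 s11 s12 where s: "C1 s s1 s2" "C1 s1 s11 s12" "\<And>z. 0 \<le> s z"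
    "\<And>z. 0 < s z \<longleftrightarrow> z \<in> (\<Union>(a, r)\<in>(\<lambda>z. (z, \<rho> z)) ` D. ball a r)"
    using C1_finite_balls_bump[of "(\<lambda>z. (z, \<rho> z)) ` D"] D(2) by blast
  have sV: "0 < s z \<longleftrightarrow> z \<in> V" for z using s(4) by (simp add: V_def)
  have s0: "s z = 0" if "z \<notin> V" for z using that sV[of z] s(3)[of z] by simp
  note cs = C1_D(4)[OF s(1)]
  define e where "e n = inverse (real (Suc n))" for n
  have e: "0 < e n" for n by (simp add: e_def)
  have e0: "e \<longlonglongrightarrow> 0" unfolding e_def by (rule LIMSEQ_inverse_real_of_nat)
  \<comment> \<open>These quotients inherit smoothness and support from \<open>s\<close>, stay below
    1, and tend pointwise to the indicator of the set where \<open>s\<close> is positive.\<close>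
  define \<phi> where "\<phi> n z = s z / (s z + e n)" for n z
  have ne: "s z + e n \<noteq> 0" for z n using s(3)[of z] e[of n] by linarith
  have \<phi>1: "C1 (\<phi> n) (\<lambda>z. (e n / (s z + e n)^2) * s1 z) (\<lambda>z. (e n / (s z + e n)^2) * s2 z)" for n
    unfolding \<phi>_def[abs_def]
  proof (rule C1_compose[OF s(1), where g = "\<lambda>t. t / (t + e n)"])
    fix z
    show "((\<lambda>t. t / (t + e n)) has_field_derivative e n / (s z + e n)\<^sup>2) (at (s z))"
      using ne[of z n] by (auto intro!: derivative_eq_intros simp: power2_eq_square)
    show "continuous_on UNIV (\<lambda>z. e n / (s z + e n)\<^sup>2)"
      using ne by (intro continuous_intros cs) auto
  qed
  have \<psi>: "C1 (\<lambda>z. e n / (s z + e n)^2) (\<lambda>z. (- 2 * e n / (s z + e n)^3) * s1 z) (\<lambda>z. (- 2 * e n / (s z + e n)^3) * s2 z)" for n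
  proof (rule C1_compose[OF s(1), where g = "\<lambda>t. e n / (t + e n)^2"])
    fix z
    show "((\<lambda>t. e n / (t + e n)^2) has_field_derivative - 2 * e n / (s z + e n)^3) (at (s z))"
      using ne[of z n] by (auto intro!: derivative_eq_intros simp: power2_eq_square power3_eq_cube divide_simps)
    show "continuous_on UNIV (\<lambda>z. - 2 * e n / (s z + e n)^3)"
      using ne by (intro continuous_intros cs) auto
  qed
  have \<phi>b: "\<bar>\<phi> n z\<bar> \<le> 1" for n z using s(3)[of z] e[of n] ne[of z n] by (simp add: \<phi>_def divide_simps)
  have \<phi>0: "\<phi> n z = 0" if "z \<notin> V" for n z using s0[OF that] by (simp add: \<phi>_def)
  have eq: "integral (ball 0 1) (\<lambda>z. g z * \<phi> n z) = c * (\<integral>z. \<phi> n (F z) \<partial>lborel)" for n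
    by (rule weak_second_derivative[OF G g \<phi>1 C1_mult[OF \<psi> s(2)] L(1)])
      (use L(2) \<open>V \<subseteq> L\<close> \<phi>0 in auto)
  have lim: "(\<lambda>n. \<phi> n z) \<longlonglongrightarrow> indicator V z" for z
  proof (cases "z \<in> V")
    case True
    then have "(\<lambda>n. s z / (s z + e n)) \<longlonglongrightarrow> s z / (s z + 0)"
      using sV[of z] by (intro tendsto_intros e0) auto
    then show ?thesis using True sV[of z] by (simp add: \<phi>_def)
  qed (simp add: \<phi>0)
  have \<phi>m: "\<phi> n \<in> borel_measurable borel" for n
    by (rule borel_measurable_continuous_onI[OF C1_D(4)[OF \<phi>1]])
  have gi: "integrable lebesgue (\<lambda>z. indicator (ball 0 1) z * g z)"
    using g by (simp add: weak_partial_def set_integrable_def)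
  have lhs: "integral (ball 0 1) (\<lambda>z. g z * \<phi> n z) = (\<integral>z. indicator (ball 0 1) z * g z * \<phi> n z \<partial>lebesgue)" for n
  proof -
    have "set_integrable lebesgue (ball 0 1) (\<lambda>z. g z * \<phi> n z)"
      using integrable_sub_ball[OF gi \<phi>m \<phi>b, of n] by (simp add: set_integrable_def mult.assoc)
    from set_lebesgue_integral_eq_integral(2)[OF this] show ?thesis
      by (simp add: set_lebesgue_integral_def mult.assoc)
  qed
  have "(\<lambda>n. \<integral>z. indicator (ball 0 1) z * g z * \<phi> n z \<partial>lebesgue) \<longlonglongrightarrow> (\<integral>z. indicator (ball 0 1) z * g z * indicator V z \<partial>lebesgue)"
  proof (rule integral_dominated_convergence[where w = "\<lambda>z. \<bar>indicator (ball 0 1) z * g z\<bar>"])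
    show "integrable lebesgue (\<lambda>z. \<bar>indicator (ball 0 1) z * g z\<bar>)" using gi by (rule integrable_abs)
    show "(\<lambda>z. indicator (ball 0 1) z * g z * indicator V z) \<in> borel_measurable lebesgue"
      by (rule borel_measurable_integrable[OF integrable_sub_ball_indicator[OF gi \<open>V \<in> sets borel\<close>]])
    show "(\<lambda>z. indicator (ball 0 1) z * g z * \<phi> n z) \<in> borel_measurable lebesgue" for n
      by (rule borel_measurable_integrable[OF integrable_sub_ball[OF gi \<phi>m \<phi>b]])
    show "AE z in lebesgue. (\<lambda>n. indicator (ball 0 1) z * g z * \<phi> n z) \<longlonglongrightarrow> indicator (ball 0 1) z * g z * indicator V z"
      by (intro AE_I2 tendsto_intros lim)
    show "AE z in lebesgue. norm (indicator (ball 0 1) z * g z * \<phi> n z) \<le> \<bar>indicator (ball 0 1) z * g z\<bar>" for n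
      using \<phi>b by (intro AE_I2) (simp add: abs_mult mult_left_le)
  qed
  moreover have "(\<lambda>n. c * (\<integral>z. \<phi> n (F z) \<partial>lborel)) \<longlonglongrightarrow> c * (\<integral>z. indicator V (F z) \<partial>lborel)"
  proof (intro tendsto_mult tendsto_const, rule integral_dominated_convergence[where w = "indicator (ball 0 1)"])
    have Fm: "F \<in> borel_measurable borel" by (intro borel_measurable_continuous_onI continuous_on_F)
    show "(\<lambda>z. indicator V (F z) :: real) \<in> borel_measurable lborel"
      using Fm \<open>V \<in> sets borel\<close> by (intro borel_measurable_indicator'[unfolded comp_def] measurable_compose[OF Fm]) auto
    show "(\<lambda>z. \<phi> n (F z)) \<in> borel_measurable lborel" for n
      using measurable_compose[OF Fm \<phi>m] by simp
    show "integrable lborel (indicator (ball 0 1) :: real^2 \<Rightarrow> real)"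
      by (simp add: integrable_indicator_iff emeasure_lborel_ball_finite[unfolded infinity_ennreal_def])
    show "AE z in lborel. (\<lambda>n. \<phi> n (F z)) \<longlonglongrightarrow> indicator V (F z)" by (intro AE_I2 lim)
    show "AE z in lborel. norm (\<phi> n (F z)) \<le> indicator (ball 0 1) z" for n
    proof (intro AE_I2)
      fix z
      show "norm (\<phi> n (F z)) \<le> indicator (ball 0 1) z"
      proof (cases "z \<in> ball 0 1")
        case True
        then show ?thesis using \<phi>b[of n "F z"] by simp
      next
        case False
        then have "F z \<notin> ball 0 1" by (simp only: F_in_ball_iff not_False_eq_True)
        then have "F z \<notin> V" using \<open>V \<subseteq> L\<close> L(2) by blast
        then show ?thesis by (simp add: \<phi>0)
      qed
    qed
  qed
  ultimately have main: "(\<integral>z. indicator (ball 0 1) z * g z * indicator V z \<partial>lebesgue) = c * (\<integral>z. indicator V (F z) \<partial>lborel)"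
    using LIMSEQ_unique by (simp only: lhs[symmetric] eq)
  have "measure lebesgue degenerate_set = (\<integral>z. indicator degenerate_set z \<partial>lborel)"
    using degenerate_set(1) by (simp add: compact_imp_closed measure_completion)
  also have "\<dots> \<le> (\<integral>z. indicator V (F z) \<partial>lborel)"
  proof (rule integral_mono)
    show "integrable lborel (indicator degenerate_set :: real^2 \<Rightarrow> real)"
      using emeasure_bounded_finite[OF compact_imp_bounded[OF degenerate_set(1)]] degenerate_set(1)
      by (simp add: integrable_indicator_iff compact_imp_closed)
    show "integrable lborel (\<lambda>z. indicator V (F z) :: real)"
    proof (rule Bochner_Integration.integrable_bound)
      show "integrable lborel (indicator (ball 0 1) :: real^2 \<Rightarrow> real)"
        by (simp add: integrable_indicator_iff emeasure_lborel_ball_finite[unfolded infinity_ennreal_def])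
      have Fm: "F \<in> borel_measurable borel" by (intro borel_measurable_continuous_onI continuous_on_F)
      show "(\<lambda>z. indicator V (F z) :: real) \<in> borel_measurable lborel"
        using Fm \<open>V \<in> sets borel\<close> by (intro borel_measurable_indicator'[unfolded comp_def] measurable_compose[OF Fm]) auto
      show "AE z in lborel. norm (indicator V (F z) :: real) \<le> norm (indicator (ball 0 1) z :: real)"
      proof (intro AE_I2)
        fix z
        have "z \<in> ball 0 1" if "F z \<in> V"
        proof -
          have "F z \<in> ball 0 1" using \<open>V \<subseteq> L\<close> L(2) that by blast
          then show ?thesis by (simp only: F_in_ball_iff)
        qed
        then show "norm (indicator V (F z) :: real) \<le> norm (indicator (ball 0 1) z :: real)"
          by (simp add: indicator_def)
      qed
    qed
    fix z
    show "indicator degenerate_set z \<le> (indicator V (F z) :: real)"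
    proof (cases "z \<in> degenerate_set")
      case True
      then have "F z \<in> V" using D(3) unfolding V_def by blast
      then show ?thesis by (simp add: indicator_def)
    qed simp
  qed
  finally have "c * measure lebesgue degenerate_set \<le> c * (\<integral>z. indicator V (F z) \<partial>lborel)"
    using c by simp
  also have "\<dots> \<le> (\<integral>z. indicator (ball 0 1) z * \<bar>g z\<bar> * indicator U z \<partial>lebesgue)"
    unfolding main[symmetric]
  proof (rule integral_mono)
    show "integrable lebesgue (\<lambda>z. indicator (ball 0 1) z * g z * indicator V z)"
      by (rule integrable_sub_ball_indicator[OF gi \<open>V \<in> sets borel\<close>])
    have "integrable lebesgue (\<lambda>z. indicator (ball 0 1) z * \<bar>g z\<bar>)"
      using integrable_abs[OF gi] by (simp add: abs_mult)
    then show "integrable lebesgue (\<lambda>z. indicator (ball 0 1) z * \<bar>g z\<bar> * indicator U z)"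
      by (rule integrable_sub_ball_indicator[OF _ borel_open[OF U(1)]])
    fix z
    show "indicator (ball 0 1) z * g z * indicator V z \<le> indicator (ball 0 1) z * \<bar>g z\<bar> * indicator U z"
      using \<open>V \<subseteq> L\<close> L(2) by (auto simp: indicator_def)
  qed
  finally show ?thesis .
qed

lemma not_W21_u:
  assumes "0 < c"
  shows "\<not> W21 (ball 0 1) (\<lambda>z. c * u z)"
proof
  assume "W21 (ball 0 1) (\<lambda>z. c * u z)"
  then obtain G where "\<forall>i. weak_partial (ball 0 1) (\<lambda>z. c * u z) i (G i) \<and> W11 (ball 0 1) (G i)"
    by (auto simp: W21_def)
  then obtain g where G: "weak_partial (ball 0 1) (\<lambda>z. c * u z) 1 (G 1)"
    and g: "weak_partial (ball 0 1) (G 1) 1 g"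
    unfolding W11_def by blast
  let ?Z = "F ` degenerate_set"
  have Z: "?Z \<in> null_sets lebesgue"
    using negligible_F_degenerate by (simp add: degenerate_set_def negligible_iff_null_sets)
  have "\<forall>n::nat. \<exists>T. open T \<and> ?Z \<subseteq> T \<and> T - ?Z \<in> lmeasurable \<and> emeasure lebesgue (T - ?Z) < ennreal ((1/2)^n)"
  proof
    fix n :: nat
    have "(0::real) < (1/2)^n" by simp
    then obtain T where "open T" "?Z \<subseteq> T" "T - ?Z \<in> lmeasurable" "emeasure lebesgue (T - ?Z) < ennreal ((1/2)^n)"
      by (rule sets_lebesgue_outer_open[OF null_setsD2[OF Z]])
    then show "\<exists>T. open T \<and> ?Z \<subseteq> T \<and> T - ?Z \<in> lmeasurable \<and> emeasure lebesgue (T - ?Z) < ennreal ((1/2)^n)"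
      by (intro exI[of _ T] conjI)
  qed
  from choice[OF this] obtain T where
    T: "\<forall>n. open (T n) \<and> ?Z \<subseteq> T n \<and> T n - ?Z \<in> lmeasurable \<and> emeasure lebesgue (T n - ?Z) < ennreal ((1/2)^n)" ..
  define N where "N = (\<Inter>n. T n)"
  \<comment> \<open>Finite intersections stay open, and almost every point lies outside
    \<open>U n\<close> for all large n. This gives dominated convergence directly.\<close>
  define U where "U n = (\<Inter>i\<le>n. T i)" for n
  have U: "open (U n)" "?Z \<subseteq> U n" for n
  proof -
    show "open (U n)" unfolding U_def using T by (intro open_INT) auto
    show "?Z \<subseteq> U n" unfolding U_def by (rule INT_greatest) (rule T[rule_format, THEN conjunct2, THEN conjunct1])
  qed
  have Tb: "T n \<in> sets lebesgue" for n using T by simp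
  have "emeasure lebesgue N \<le> ennreal ((1/2)^n)" for n
  proof -
    have "emeasure lebesgue N \<le> emeasure lebesgue (T n)"
      by (rule emeasure_mono) (use Tb in \<open>auto simp: N_def\<close>)
    also have "\<dots> = emeasure lebesgue (T n - ?Z)" using emeasure_Diff_null_set[OF Z Tb] by simp
    finally show ?thesis using T by (meson order.strict_implies_order order.trans order_eq_refl)
  qed
  moreover have "(\<lambda>n. ennreal ((1/2)^n)) \<longlonglongrightarrow> ennreal 0"
    by (intro tendsto_ennrealI LIMSEQ_power_zero) simp
  ultimately have "emeasure lebesgue N \<le> ennreal 0"
    by (intro LIMSEQ_le_const) auto
  moreover have "N \<in> sets lebesgue" unfolding N_def using Tb by (intro sets.countable_INT) auto
  ultimately have N: "N \<in> null_sets lebesgue" by auto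
  let ?g = "\<lambda>z. indicator (ball 0 1) z * \<bar>g z\<bar>"
  have gi: "integrable lebesgue ?g"
    using g integrable_abs[of lebesgue "\<lambda>z. indicator (ball 0 1) z * g z"]
    by (simp add: weak_partial_def set_integrable_def abs_mult)
  have gU: "integrable lebesgue (\<lambda>z. ?g z * indicator (U n) z)" for n
    by (rule integrable_sub_ball_indicator[OF gi borel_open[OF U(1)]])
  have "(\<lambda>n. \<integral>z. ?g z * indicator (U n) z \<partial>lebesgue) \<longlonglongrightarrow> (\<integral>z. (0::real) \<partial>(lebesgue :: (real^2) measure))"
  proof (rule integral_dominated_convergence[OF _ _ gi])
    show "(\<lambda>z. ?g z * indicator (U n) z) \<in> borel_measurable lebesgue" for n
      by (rule borel_measurable_integrable[OF gU])
    have "AE z in lebesgue. z \<notin> N" by (rule AE_not_in[OF N])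
    then show "AE z in lebesgue. (\<lambda>n. ?g z * indicator (U n) z) \<longlonglongrightarrow> 0"
    proof (rule AE_mp, intro AE_I2 impI)
      fix z assume "z \<notin> N"
      then obtain m where m: "z \<notin> T m" by (auto simp: N_def)
      have "eventually (\<lambda>n. ?g z * indicator (U n) z = 0) sequentially"
        using eventually_ge_at_top[of m]
      proof eventually_elim
        case (elim n)
        then have "z \<notin> U n" using m by (auto simp: U_def)
        then show ?case by simp
      qed
      then show "(\<lambda>n. ?g z * indicator (U n) z) \<longlonglongrightarrow> 0" by (rule tendsto_eventually)
    qed
    show "AE z in lebesgue. norm (?g z * indicator (U n) z) \<le> ?g z" for n
      by (intro AE_I2) (auto simp: indicator_def)
  qed auto
  then have "(\<lambda>n. \<integral>z. ?g z * indicator (U n) z \<partial>lebesgue) \<longlonglongrightarrow> 0" by simp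
  moreover have "c * measure lebesgue degenerate_set \<le> (\<integral>z. ?g z * indicator (U n) z \<partial>lebesgue)" for n
    by (rule weak_second_derivative_mass[OF G g assms U])
  ultimately have "c * measure lebesgue degenerate_set \<le> 0"
    by (intro LIMSEQ_le_const) auto
  moreover have "0 < c * measure lebesgue degenerate_set"
    using assms degenerate_set(3) by simp
  ultimately show False by simp
qed

theorem counterexample:
  "\<exists>(u :: real^2 \<Rightarrow> real) (Du :: real^2 \<Rightarrow> real^2) (f :: real^2 \<Rightarrow> real).
     continuous_on (cball 0 1) Du \<and>
     (\<forall>x\<in>cball 0 1. (u has_derivative (\<lambda>h. Du x \<bullet> h)) (at x within cball 0 1)) \<and>
     (\<forall>j. BV (ball 0 1) (\<lambda>x. Du x $ j)) \<and>
     (\<forall>x\<in>sphere 0 1. u x = 0) \<and>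
     strictly_convex_on (ball 0 1) u \<and>
     f \<in> borel_measurable lebesgue \<and>
     (AE x in lebesgue. x \<in> ball 0 1 \<longrightarrow> 0 < f x \<and> f x \<le> 1) \<and>
     (\<forall>E \<in> sets borel. E \<subseteq> ball 0 1 \<longrightarrow>
        subdiff_set (ball 0 1) u E \<in> sets lebesgue \<and>
        emeasure lebesgue (subdiff_set (ball 0 1) u E) = (\<integral>\<^sup>+ x\<in>E. ennreal (f x) \<partial>lebesgue)) \<and>
     \<not> W21 (ball 0 1) u"
proof -
  define c where "c = 1 / sqrt K"
  have c: "0 < c" "c\<^sup>2 * K \<le> 1" using K(1) by (simp_all add: c_def power_divide)
  have sub: "subdiff_set (ball 0 1) (\<lambda>z. c * u z) E = (\<lambda>z. c *\<^sub>R Du z) ` E" if "E \<subseteq> ball 0 1" for E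
    using subdiff_u[OF c(1) open_ball] that by (fastforce simp: subdiff_set_def)
  show ?thesis
  proof (intro exI conjI ballI allI impI)
    show "continuous_on (cball 0 1) (\<lambda>z. c *\<^sub>R Du z)" by (intro continuous_intros continuous_on_Du)
    show "((\<lambda>z. c * u z) has_derivative (\<lambda>h. (c *\<^sub>R Du x) \<bullet> h)) (at x within cball 0 1)" for x
      using has_derivative_mult_right[OF u_derivative, of c] by simp
    show "BV (ball 0 1) (\<lambda>x. (c *\<^sub>R Du x) $ j)" for j by (rule BV_Du)
    show "c * u x = 0" if "x \<in> sphere 0 1" for x using u_sphere[of x] that by simp
    show "strictly_convex_on (ball 0 1) (\<lambda>z. c * u z)" by (rule strictly_convex_u[OF c(1) convex_ball])
    show "density c \<in> borel_measurable lebesgue"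
      using borel_measurable_density by (simp add: measurable_completion)
    show "AE x in lebesgue. x \<in> ball 0 1 \<longrightarrow> 0 < density c x \<and> density c x \<le> 1"
      using density_bounds[OF c] by (rule AE_mp) (intro AE_I2 impI)
    show "subdiff_set (ball 0 1) (\<lambda>z. c * u z) E \<in> sets lebesgue" if "E \<in> sets borel" "E \<subseteq> ball 0 1" for E
      using gradient_image_measure(1)[OF c(1) that] sub[OF that(2)] by simp
    show "emeasure lebesgue (subdiff_set (ball 0 1) (\<lambda>z. c * u z) E) = (\<integral>\<^sup>+ x\<in>E. ennreal (density c x) \<partial>lebesgue)"
      if "E \<in> sets borel" "E \<subseteq> ball 0 1" for E
      using gradient_image_measure(2)[OF c(1) that] sub[OF that(2)] by simp
    show "\<not> W21 (ball 0 1) (\<lambda>z. c * u z)" by (rule not_W21_u[OF c(1)])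
  qed
qed

end

section \<open>A fat zero set with quantitative complement\<close>

text \<open>The zero sets are complements of bumps of width \<open>bump_width n / 16 ^ n\<close> around \<open>2\<pi>\<int> / 16 ^ n\<close>. The widths are
  summable after multiplication by the number of bumps per unit length, which leaves a fat zero set, while
  \<open>weight n * bump_width n ^ 3\<close> is of order \<open>16 ^ (- n)\<close>: a window of radius \<open>r \<approx> 16 ^ (- n)\<close> contains a whole
  bump, of mass of order \<open>r\<^sup>2\<close>.\<close>

definition bump_width :: "nat \<Rightarrow> real" where "bump_width n = (1/2) ^ (n + 6)"
definition bump :: "nat \<Rightarrow> real \<Rightarrow> real" where
  "bump n x = max 0 (cos (16 ^ n * x) - 1 + (bump_width n)\<^sup>2)"
definition weight :: "nat \<Rightarrow> real" where "weight n = (1/2) ^ (n + 1)"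
definition bump3' :: "nat \<Rightarrow> real \<Rightarrow> real" where
  "bump3' n x = 3 * bump n x ^ 2 * (- (16 ^ n * sin (16 ^ n * x)))"
definition bump3'' :: "nat \<Rightarrow> real \<Rightarrow> real" where
  "bump3'' n x = 256 ^ n * (6 * bump n x * sin (16 ^ n * x) ^ 2 - 3 * bump n x ^ 2 * cos (16 ^ n * x))"
definition rough0 :: "real \<Rightarrow> real" where "rough0 x = (\<Sum>n. weight n * bump n x)"
text \<open>The divisor 256 ^ n is the square of the frequency 16 ^ n: two derivatives restore
  exactly the weights of \<open>rough0\<close>. The cube makes each term C^2.\<close>

definition smooth0 :: "real \<Rightarrow> real" where "smooth0 x = (\<Sum>n. weight n / 256 ^ n * bump n x ^ 3)"
definition smooth0' :: "real \<Rightarrow> real" where "smooth0' x = (\<Sum>n. weight n / 256 ^ n * bump3' n x)"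
definition smooth0'' :: "real \<Rightarrow> real" where "smooth0'' x = (\<Sum>n. weight n / 256 ^ n * bump3'' n x)"

lemma bump_width: "0 < bump_width n" "bump_width n \<le> 1"
  by (simp_all add: bump_width_def power_le_one)

lemma bump_bounds: "0 \<le> bump n x" "bump n x \<le> 1"
proof -
  have "(bump_width n)\<^sup>2 \<le> 1" using bump_width[of n] by (simp add: power_le_one)
  then show "0 \<le> bump n x" "bump n x \<le> 1"
    using cos_le_one[of "16 ^ n * x"] unfolding bump_def by linarith+
qed

lemma weight: "0 < weight n" "weight sums 1"
proof -
  have "(\<lambda>n. (1/2) * (1/2) ^ n) sums ((1/2) * (1 / (1 - 1/2 :: real)))"
    by (intro sums_mult geometric_sums) simp
  then show "weight sums 1" by (simp add: weight_def[abs_def])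
qed (simp add: weight_def)

lemma summable_weight: "summable weight" using weight(2) by (rule sums_summable)

lemma bump_even: "bump n (- x) = bump n x" by (simp add: bump_def)

lemma bump_affine_derivative:
  "((\<lambda>x. cos (16 ^ n * x) - 1 + (bump_width n)\<^sup>2) has_field_derivative - (16 ^ n * sin (16 ^ n * x))) (at x)"
  by (auto intro!: derivative_eq_intros)

lemma bump3_derivative: "((\<lambda>x. bump n x ^ 3) has_field_derivative bump3' n x) (at x)"
  unfolding bump_def[abs_def] bump3'_def bump_def
  by (rule DERIV_chain2[where f = "\<lambda>t. max 0 t ^ 3", OF _ bump_affine_derivative])
    (use positive_part_power_derivative[of 1 "cos (16 ^ n * x) - 1 + (bump_width n)\<^sup>2"] in
      \<open>simp add: numeral_3_eq_3 numeral_2_eq_2\<close>)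

lemma bump2_derivative:
  "((\<lambda>x. bump n x ^ 2) has_field_derivative 2 * bump n x * (- (16 ^ n * sin (16 ^ n * x)))) (at x)"
  unfolding bump_def[abs_def] bump_def
  by (rule DERIV_chain2[where f = "\<lambda>t. max 0 t ^ 2", OF _ bump_affine_derivative])
    (use positive_part_power_derivative[of 0 "cos (16 ^ n * x) - 1 + (bump_width n)\<^sup>2"] in
      \<open>simp add: numeral_2_eq_2\<close>)

lemma bump3'_derivative: "(bump3' n has_field_derivative bump3'' n x) (at x)"
proof -
  have "((\<lambda>x. 3 * bump n x ^ 2 * (- (16 ^ n * sin (16 ^ n * x)))) has_field_derivative
     3 * (2 * bump n x * (- (16 ^ n * sin (16 ^ n * x)))) * (- (16 ^ n * sin (16 ^ n * x)))
     + - (16 ^ n * (cos (16 ^ n * x) * 16 ^ n)) * (3 * bump n x ^ 2)) (at x)"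
    by (intro DERIV_mult DERIV_cmult bump2_derivative) (auto intro!: derivative_eq_intros)
  moreover have "(256::real) ^ n = 16 ^ n * 16 ^ n" by (simp flip: power_mult_distrib)
  ultimately show ?thesis
    unfolding bump3'_def[abs_def] bump3''_def by (simp add: power2_eq_square algebra_simps)
qed

lemma bump3'_bound: "\<bar>weight n / 256 ^ n * bump3' n x\<bar> \<le> 3 * (weight n * bump n x)"
proof -
  have b: "bump n x ^ 2 \<le> bump n x"
    using bump_bounds[of n x] by (simp add: power2_eq_square mult_left_le)
  have "\<bar>bump3' n x\<bar> = 3 * bump n x ^ 2 * (16 ^ n * \<bar>sin (16 ^ n * x)\<bar>)"
    by (simp add: bump3'_def abs_mult)
  also have "\<dots> \<le> 3 * bump n x * (256 ^ n * 1)"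
    using b by (intro mult_mono) (auto intro: power_mono bump_bounds)
  finally have "weight n / 256 ^ n * \<bar>bump3' n x\<bar> \<le> weight n / 256 ^ n * (3 * bump n x * (256 ^ n * 1))"
    using weight(1)[of n] by (intro mult_left_mono) auto
  then show ?thesis using weight(1)[of n] by (simp add: abs_mult)
qed

text \<open>After two derivatives the cube still retains a factor \<open>bump n x\<close>. Keeping
  it, instead of estimating by the weight alone, makes the second derivative of the sum vanish
  wherever \<open>rough0\<close> does.\<close>

lemma bump3''_bound: "\<bar>weight n / 256 ^ n * bump3'' n x\<bar> \<le> 9 * (weight n * bump n x)"
proof -
  have b: "bump n x ^ 2 \<le> bump n x"
    using bump_bounds[of n x] by (simp add: power2_eq_square mult_left_le)
  have s: "6 * bump n x * sin (16 ^ n * x) ^ 2 \<le> 6 * bump n x * 1"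
    using bump_bounds(1)[of n x] by (intro mult_left_mono) (auto simp: abs_square_le_1)
  have "\<bar>3 * bump n x ^ 2 * cos (16 ^ n * x)\<bar> \<le> 3 * bump n x * 1"
    unfolding abs_mult using b bump_bounds(1)[of n x] by (intro mult_mono) auto
  moreover have "0 \<le> 6 * bump n x * sin (16 ^ n * x) ^ 2" using bump_bounds(1)[of n x] by simp
  ultimately have "\<bar>6 * bump n x * sin (16 ^ n * x) ^ 2 - 3 * bump n x ^ 2 * cos (16 ^ n * x)\<bar> \<le> 9 * bump n x"
    using s by linarith
  then have "weight n * \<bar>6 * bump n x * sin (16 ^ n * x) ^ 2 - 3 * bump n x ^ 2 * cos (16 ^ n * x)\<bar> \<le> weight n * (9 * bump n x)"
    using weight(1)[of n] by (intro mult_left_mono) auto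
  then show ?thesis using weight(1)[of n] by (simp add: bump3''_def abs_mult)
qed

lemma bump3_bound: "0 \<le> weight n / 256 ^ n * bump n x ^ 3" "weight n / 256 ^ n * bump n x ^ 3 \<le> weight n * bump n x"
proof -
  have "bump n x ^ 3 \<le> bump n x ^ 1" using bump_bounds[of n x] by (intro power_decreasing) auto
  moreover have "weight n / 256 ^ n \<le> weight n" using weight(1)[of n] by (simp add: divide_simps)
  ultimately show "weight n / 256 ^ n * bump n x ^ 3 \<le> weight n * bump n x"
    using bump_bounds[of n x] weight(1)[of n] by (intro mult_mono) auto
  show "0 \<le> weight n / 256 ^ n * bump n x ^ 3"
    using bump_bounds[of n x] weight(1)[of n] by simp
qed

lemma weight_bump_le: "0 \<le> weight n * bump n x" "weight n * bump n x \<le> weight n"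
  using bump_bounds[of n x] weight(1)[of n] by (simp_all add: mult_left_le)

lemma summable_rough0: "summable (\<lambda>n. weight n * bump n x)"
  by (rule summable_comparison_test'[OF summable_weight]) (use weight_bump_le in auto)

lemma summable_smooth0: "summable (\<lambda>n. weight n / 256 ^ n * bump n x ^ 3)"
  by (rule summable_comparison_test'[OF summable_rough0[of x]])
    (simp only: real_norm_def abs_of_nonneg[OF bump3_bound(1)] bump3_bound(2))

lemma summable_smooth0': "summable (\<lambda>n. weight n / 256 ^ n * bump3' n x)"
  by (rule summable_comparison_test'[OF summable_mult[OF summable_rough0[of x], of 3]])
    (use bump3'_bound in auto)

lemma uniformly_convergent_of_weight_bound:
  fixes f :: "nat \<Rightarrow> real \<Rightarrow> real"
  assumes "\<And>n x. \<bar>f n x\<bar> \<le> C * (weight n * bump n x)" "0 \<le> C"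
  shows "uniform_limit UNIV (\<lambda>n x. \<Sum>i<n. f i x) (\<lambda>x. \<Sum>i. f i x) sequentially"
proof (rule Weierstrass_m_test)
  fix n and x :: real
  show "norm (f n x) \<le> C * weight n"
    using assms(1)[of n x] mult_left_mono[OF weight_bump_le(2)[of n x] assms(2)] by simp
qed (intro summable_mult summable_weight)

lemma continuous_on_bump: "continuous_on S (bump n)"
  unfolding bump_def[abs_def] by (intro continuous_intros)

lemma continuous_on_rough0: "continuous_on UNIV rough0"
  unfolding rough0_def[abs_def]
  by (rule uniform_limit_theorem[OF _ uniformly_convergent_of_weight_bound[where C = 1]])
    (use weight_bump_le(1) in \<open>auto intro!: always_eventually continuous_intros continuous_on_bump simp: abs_of_nonneg\<close>)

lemma continuous_on_smooth0'': "continuous_on UNIV smooth0''"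
  unfolding smooth0''_def[abs_def]
proof (rule uniform_limit_theorem[OF _ uniformly_convergent_of_weight_bound[where C = 9]])
  show "\<forall>\<^sub>F n in sequentially. continuous_on UNIV (\<lambda>x. \<Sum>i<n. weight i / 256 ^ i * bump3'' i x)"
    unfolding bump3''_def
    by (intro always_eventually allI continuous_intros continuous_on_bump)
qed (use bump3''_bound in auto)

lemma smooth0_derivative: "(smooth0 has_field_derivative smooth0' x) (at x)"
  unfolding smooth0_def[abs_def] smooth0'_def
proof (rule has_field_derivative_series'(2)[where S = UNIV and ?x0.0 = 0
      and f = "\<lambda>n x. weight n / 256 ^ n * bump n x ^ 3" and f' = "\<lambda>n x. weight n / 256 ^ n * bump3' n x"])
  show "uniformly_convergent_on UNIV (\<lambda>n x. \<Sum>i<n. weight i / 256 ^ i * bump3' i x)"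
    using uniformly_convergent_of_weight_bound[OF bump3'_bound] by (auto simp: uniformly_convergent_on_def)
  show "((\<lambda>x. weight n / 256 ^ n * bump n x ^ 3) has_field_derivative weight n / 256 ^ n * bump3' n x) (at x within UNIV)" for n x
    by (rule DERIV_cmult[OF bump3_derivative])
  show "summable (\<lambda>n. weight n / 256 ^ n * bump n 0 ^ 3)" by (rule summable_smooth0)
qed simp_all

lemma smooth0'_derivative: "(smooth0' has_field_derivative smooth0'' x) (at x)"
  unfolding smooth0'_def[abs_def] smooth0''_def
proof (rule has_field_derivative_series'(2)[where S = UNIV and ?x0.0 = 0
      and f = "\<lambda>n x. weight n / 256 ^ n * bump3' n x" and f' = "\<lambda>n x. weight n / 256 ^ n * bump3'' n x"])
  show "uniformly_convergent_on UNIV (\<lambda>n x. \<Sum>i<n. weight i / 256 ^ i * bump3'' i x)"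
    using uniformly_convergent_of_weight_bound[OF bump3''_bound] by (auto simp: uniformly_convergent_on_def)
  show "((\<lambda>x. weight n / 256 ^ n * bump3' n x) has_field_derivative weight n / 256 ^ n * bump3'' n x) (at x within UNIV)" for n x
    by (rule DERIV_cmult[OF bump3'_derivative])
  show "summable (\<lambda>n. weight n / 256 ^ n * bump3' n 0)" by (rule summable_smooth0')
qed simp_all

lemma rough0_bounds: "0 \<le> rough0 x" "rough0 x \<le> 1"
proof -
  show "0 \<le> rough0 x" unfolding rough0_def by (intro suminf_nonneg summable_rough0 weight_bump_le)
  have "rough0 x \<le> suminf weight"
    unfolding rough0_def by (intro suminf_le weight_bump_le summable_rough0 summable_weight)
  then show "rough0 x \<le> 1" using weight(2) by (simp add: sums_iff)
qed

lemma smooth0_bounds: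
  "0 \<le> smooth0 x" "smooth0 x \<le> rough0 x" "\<bar>smooth0' x\<bar> \<le> 3 * rough0 x" "\<bar>smooth0'' x\<bar> \<le> 9 * rough0 x"
proof -
  show "0 \<le> smooth0 x" unfolding smooth0_def by (intro suminf_nonneg summable_smooth0 bump3_bound)
  show "smooth0 x \<le> rough0 x" unfolding smooth0_def rough0_def
    by (intro suminf_le bump3_bound summable_smooth0 summable_rough0)
  have abs_le: "\<bar>suminf f\<bar> \<le> C * rough0 x"
    if f: "\<And>n. \<bar>f n\<bar> \<le> C * (weight n * bump n x)" for f :: "nat \<Rightarrow> real" and C
  proof -
    have s: "summable (\<lambda>n. C * (weight n * bump n x))" by (intro summable_mult summable_rough0)
    have a: "summable (\<lambda>n. \<bar>f n\<bar>)" by (rule summable_comparison_test'[OF s]) (use f in auto)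
    have "\<bar>suminf f\<bar> \<le> (\<Sum>n. \<bar>f n\<bar>)" by (rule summable_rabs[OF a])
    also have "\<dots> \<le> (\<Sum>n. C * (weight n * bump n x))" by (rule suminf_le[OF f a s])
    also have "\<dots> = C * rough0 x" unfolding rough0_def by (rule suminf_mult[OF summable_rough0])
    finally show ?thesis .
  qed
  show "\<bar>smooth0' x\<bar> \<le> 3 * rough0 x" unfolding smooth0'_def by (rule abs_le[OF bump3'_bound])
  show "\<bar>smooth0'' x\<bar> \<le> 9 * rough0 x" unfolding smooth0''_def by (rule abs_le[OF bump3''_bound])
qed

lemma rough0_ge: "weight n * bump n x \<le> rough0 x"
  using sum_le_suminf[OF summable_rough0, of "{n}" x] weight_bump_le by (simp add: rough0_def)

lemma rough0_eq_0_iff: "rough0 x = 0 \<longleftrightarrow> (\<forall>n. bump n x = 0)"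
  unfolding rough0_def using suminf_eq_zero_iff[OF summable_rough0 weight_bump_le(1), of x] weight(1)
  by (metis less_irrefl mult_eq_0_iff)

lemma smooth0_eq_0_iff: "smooth0 x = 0 \<longleftrightarrow> rough0 x = 0"
proof -
  have "smooth0 x = 0 \<longleftrightarrow> (\<forall>n. weight n / 256 ^ n * bump n x ^ 3 = 0)"
    unfolding smooth0_def by (rule suminf_eq_zero_iff[OF summable_smooth0 bump3_bound(1)])
  also have "\<dots> \<longleftrightarrow> (\<forall>n. bump n x = 0)" using weight(1) by (simp add: less_imp_neq[symmetric])
  finally show ?thesis by (simp add: rough0_eq_0_iff)
qed

lemma even0: "rough0 (- x) = rough0 x" "smooth0 (- x) = smooth0 x"
  by (simp_all add: rough0_def smooth0_def bump_even)

text \<open>Any window of radius r contains a complete bump of some level n with 16 ^ (- n)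
  comparable to r. The function \<open>H\<close> plays the role of a primitive, so its increment is
  the mass of \<open>h\<close> in the window.\<close>

lemma rough0_window:
  fixes H :: "real \<Rightarrow> real"
  assumes H: "\<And>x. (H has_field_derivative h x) (at x)" and h: "\<And>x. rough0 x \<le> h x" and r: "0 < r" "r \<le> 1/2"
  shows "r\<^sup>2 / (2 ^ 19 * 6400) \<le> H (q + r) - H (q - r)"
proof -
  \<comment> \<open>The nearest bump centre is within \<open>pi / 16 ^ n\<close> of
    \<open>q\<close>, and \<open>pi + bump_width n <= 5\<close>, so the bump fits. Minimality of n
    gives \<open>r < 80 / 16 ^ n\<close>, whose square is the source of 6400.\<close>
  define n where "n = (LEAST n. 5 / 16 ^ n \<le> r)"
  have ex: "\<exists>n. 5 / 16 ^ n \<le> r"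
  proof -
    obtain n where "(1/16::real) ^ n < r / 5" using real_arch_pow_inv[of "r/5" "1/16"] r by auto
    then show ?thesis by (intro exI[of _ n]) (simp add: power_divide divide_simps)
  qed
  have n: "5 / 16 ^ n \<le> r" unfolding n_def by (rule LeastI_ex[OF ex])
  have "n \<noteq> 0" using n r by (intro notI) simp
  then obtain m where m: "n = Suc m" by (cases n) auto
  have "\<not> 5 / 16 ^ m \<le> r" using not_less_Least[of m "\<lambda>n. 5 / 16 ^ n \<le> r"] m by (simp add: n_def)
  then have rn: "r < 80 / 16 ^ n" by (simp add: m)
  define a where "a = 16 ^ n * q / (2 * pi)"
  define k where "k = \<lfloor>a + 1/2\<rfloor>"
  define z where "z = 2 * pi * of_int k / 16 ^ n"
  define d where "d = bump_width n / 16 ^ n"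
  have "\<bar>a - of_int k\<bar> \<le> 1/2" unfolding k_def by linarith
  moreover have "16 ^ n * q - 2 * pi * of_int k = (a - of_int k) * (2 * pi)"
    by (simp add: a_def left_diff_distrib)
  then have "\<bar>16 ^ n * q - 2 * pi * of_int k\<bar> = \<bar>a - of_int k\<bar> * (2 * pi)" by (simp add: abs_mult)
  ultimately have "\<bar>16 ^ n * q - 2 * pi * of_int k\<bar> \<le> pi"
    using mult_right_mono[of "\<bar>a - of_int k\<bar>" "1/2" "2 * pi"] by simp
  moreover have "q - z = (16 ^ n * q - 2 * pi * of_int k) / 16 ^ n" by (simp add: z_def field_simps)
  ultimately have qz: "\<bar>q - z\<bar> \<le> pi / 16 ^ n" by (simp add: abs_divide divide_right_mono)
  have "pi + bump_width n \<le> 5" using pi_less_4 bump_width(2)[of n] by simp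
  then have "pi / 16 ^ n + d \<le> 5 / 16 ^ n" unfolding d_def add_divide_distrib[symmetric] by (rule divide_right_mono) simp
  then have inside: "q - r \<le> z - d" "z + d \<le> q + r" using qz n by linarith+
  have d: "0 < d" using bump_width(1)[of n] by (simp add: d_def)
  let ?\<kappa> = "weight n * ((bump_width n)\<^sup>2 / 2)"
  have low: "?\<kappa> \<le> rough0 x" if "\<bar>x - z\<bar> \<le> d" for x
  proof -
    define t where "t = 16 ^ n * (x - z)"
    have "\<bar>t\<bar> \<le> 16 ^ n * d" using that by (simp add: t_def abs_mult)
    then have t: "\<bar>t\<bar> \<le> bump_width n" by (simp add: d_def)
    have "16 ^ n * x = t + 2 * pi * of_int k" by (simp add: t_def z_def field_simps)
    then have "cos (16 ^ n * x) = cos t" using cos.plus_of_int[of t k] by (simp add: mult_ac)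
    moreover have "1 - t\<^sup>2 / 2 \<le> cos t"
    proof -
      have "cos t = 1 - 2 * (sin (t/2))\<^sup>2" using cos_double_sin[of "t/2"] by simp
      moreover have "(sin (t/2))\<^sup>2 \<le> (t/2)\<^sup>2" 
        by (rule iffD1[OF abs_le_square_iff abs_sin_x_le_abs_x])
      ultimately show ?thesis by (simp add: power2_eq_square)
    qed
    moreover have "t\<^sup>2 \<le> (bump_width n)\<^sup>2" using power_mono[OF t abs_ge_zero, of 2] by simp
    ultimately have "(bump_width n)\<^sup>2 / 2 \<le> cos (16 ^ n * x) - 1 + (bump_width n)\<^sup>2" by linarith
    also have "\<dots> \<le> bump n x" by (simp add: bump_def)
    finally have "(bump_width n)\<^sup>2 / 2 \<le> bump n x" .
    then have "?\<kappa> \<le> weight n * bump n x" using weight(1)[of n] by (intro mult_left_mono) auto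
    then show ?thesis using rough0_ge[of n x] by simp
  qed
  have mono: "H a \<le> H b" if "a \<le> b" for a b
  proof (rule DERIV_nonneg_imp_nondecreasing[OF that])
    fix x
    have "0 \<le> h x" using rough0_bounds(1)[of x] h[of x] by linarith
    then show "\<exists>y. (H has_field_derivative y) (at x) \<and> 0 \<le> y" using H[of x] by blast
  qed
  have "z - d < z + d" using d by simp
  then obtain y where y: "z - d < y" "y < z + d" "H (z + d) - H (z - d) = (z + d - (z - d)) * h y"
    using MVT2[of "z - d" "z + d" H h] H by blast
  have "2 * d * ?\<kappa> \<le> (z + d - (z - d)) * h y"
    using low[of y] h[of y] y(1,2) d by (intro mult_mono) (auto simp: abs_le_iff weight(1) less_imp_le)
  also have "\<dots> \<le> H (q + r) - H (q - r)"
    using mono[OF inside(1)] mono[OF inside(2)] y(3) by linarith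
  finally have "2 * d * ?\<kappa> \<le> H (q + r) - H (q - r)" .
  moreover have "2 * d * ?\<kappa> = 1 / (2 ^ 19 * 256 ^ n)"
  proof -
    have "2 * d * ?\<kappa> = weight n * bump_width n ^ 3 / 16 ^ n"
      by (simp add: d_def power3_eq_cube power2_eq_square)
    \<comment> \<open>The exponent is 4 n + 19: the part 4 n supplies a second factor 16 ^ n, and
      the rest is the constant 2 ^ 19.\<close>
    also have "weight n * bump_width n ^ 3 = (1/2) ^ (n + 1 + (n + 6) * 3)"
      unfolding weight_def bump_width_def power_mult power_add by simp
    also have "n + 1 + (n + 6) * 3 = 19 + 4 * n" by simp
    also have "(1/2::real) ^ (19 + 4 * n) / 16 ^ n = 1 / (2 ^ 19 * (16 ^ n * 16 ^ n))"
      by (simp add: power_add power_mult power_divide)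
    also have "(16::real) ^ n * 16 ^ n = 256 ^ n" by (simp flip: power_mult_distrib)
    finally show ?thesis .
  qed
  moreover have "r\<^sup>2 / (2 ^ 19 * 6400) \<le> 1 / (2 ^ 19 * 256 ^ n)"
  proof -
    have "r\<^sup>2 \<le> (80 / 16 ^ n)\<^sup>2" using rn r by (intro power_mono) auto
    also have "\<dots> = 6400 / 256 ^ n" by (simp add: power_divide power2_eq_square flip: power_mult_distrib)
    finally show ?thesis by (simp add: divide_simps)
  qed
  ultimately show ?thesis by linarith
qed

section \<open>Profiles that become constant away from the origin\<close>

definition m1 :: "real \<Rightarrow> real" where "m1 x = max 0 (x\<^sup>2 - 1)"
text \<open>The term \<open>m1\<close> vanishes on [-1, 1], where the fat zero set is kept, and
  pushes \<open>rough\<close> above 1 for \<open>2 \<le> \<bar>x\<bar>\<close>, so that truncated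
  profiles become constant there.\<close>

definition rough :: "real \<Rightarrow> real" where "rough x = rough0 x + m1 x"
definition smooth :: "real \<Rightarrow> real" where "smooth x = smooth0 x + m1 x ^ 3"
definition smooth' :: "real \<Rightarrow> real" where "smooth' x = smooth0' x + 3 * m1 x ^ 2 * (2 * x)"
definition smooth'' :: "real \<Rightarrow> real" where
  "smooth'' x = smooth0'' x + (3 * (2 * m1 x * (2 * x)) * (2 * x) + 2 * (3 * m1 x ^ 2))"
text \<open>A C^2 switch that is 0 exactly at the zeros of \<open>smooth\<close> and 1 as soon as
  \<open>smooth\<close> reaches 1.\<close>

definition \<theta> :: "real \<Rightarrow> real" where "\<theta> x = 1 - max 0 (1 - smooth x) ^ 3"
definition \<theta>' :: "real \<Rightarrow> real" where "\<theta>' x = 3 * max 0 (1 - smooth x) ^ 2 * smooth' x"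
definition \<theta>'' :: "real \<Rightarrow> real" where
  "\<theta>'' x = 3 * (2 * max 0 (1 - smooth x) * - smooth' x) * smooth' x + smooth'' x * (3 * max 0 (1 - smooth x) ^ 2)"

lemma positive_part_chain:
  assumes "(f has_field_derivative f') (at x)"
  shows "((\<lambda>x. max 0 (f x) ^ 3) has_field_derivative 3 * max 0 (f x) ^ 2 * f') (at (x::real))"
    "((\<lambda>x. max 0 (f x) ^ 2) has_field_derivative 2 * max 0 (f x) * f') (at x)"
proof -
  show "((\<lambda>x. max 0 (f x) ^ 3) has_field_derivative 3 * max 0 (f x) ^ 2 * f') (at x)"
    by (rule DERIV_chain2[where f = "\<lambda>t. max 0 t ^ 3", OF _ assms])
      (use positive_part_power_derivative[of 1 "f x"] in \<open>simp add: numeral_3_eq_3 numeral_2_eq_2\<close>)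
  show "((\<lambda>x. max 0 (f x) ^ 2) has_field_derivative 2 * max 0 (f x) * f') (at x)"
    by (rule DERIV_chain2[where f = "\<lambda>t. max 0 t ^ 2", OF _ assms])
      (use positive_part_power_derivative[of 0 "f x"] in \<open>simp add: numeral_2_eq_2\<close>)
qed

lemma m1_base: "((\<lambda>x::real. x\<^sup>2 - 1) has_field_derivative 2 * x) (at x)"
  by (auto intro!: derivative_eq_intros)

lemma smooth_derivative: "(smooth has_field_derivative smooth' x) (at x)"
  unfolding smooth_def[abs_def] smooth'_def m1_def
  by (intro DERIV_add smooth0_derivative positive_part_chain(1)[OF m1_base])

lemma smooth'_derivative: "(smooth' has_field_derivative smooth'' x) (at x)"
  unfolding smooth'_def[abs_def] smooth''_def m1_def
  by (intro DERIV_add smooth0'_derivative DERIV_mult DERIV_cmult positive_part_chain(2)[OF m1_base])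
    (auto intro!: derivative_eq_intros)

lemma one_minus_smooth_derivative: "((\<lambda>x. 1 - smooth x) has_field_derivative - smooth' x) (at x)"
  using DERIV_diff[OF DERIV_const smooth_derivative] by simp

lemma \<theta>_derivative: "(\<theta> has_field_derivative \<theta>' x) (at x)"
  using DERIV_diff[OF DERIV_const positive_part_chain(1)[OF one_minus_smooth_derivative]]
  unfolding \<theta>_def[abs_def] \<theta>'_def by simp

lemma \<theta>'_derivative: "(\<theta>' has_field_derivative \<theta>'' x) (at x)"
  unfolding \<theta>'_def[abs_def] \<theta>''_def
  by (intro DERIV_mult DERIV_cmult positive_part_chain(2)[OF one_minus_smooth_derivative] smooth'_derivative)

lemma DERIV_continuous_on_UNIV:
  assumes "\<And>x. (f has_field_derivative f' x) (at (x::real))"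
  shows "continuous_on UNIV f"
  using assms by (meson DERIV_isCont continuous_at_imp_continuous_on)

lemma continuous_on_\<theta>'': "continuous_on UNIV \<theta>''"
proof -
  have "continuous_on UNIV smooth''"
    unfolding smooth''_def[abs_def] m1_def by (intro continuous_intros continuous_on_smooth0'')
  then show ?thesis unfolding \<theta>''_def[abs_def]
    by (intro continuous_intros DERIV_continuous_on_UNIV[OF smooth_derivative] DERIV_continuous_on_UNIV[OF smooth'_derivative])
qed

lemma continuous_on_rough: "continuous_on UNIV rough"
  unfolding rough_def[abs_def] m1_def by (intro continuous_intros continuous_on_rough0)

lemma m1_nonneg: "0 \<le> m1 x" by (simp add: m1_def)

lemma rough_nonneg: "0 \<le> rough x" and smooth_nonneg: "0 \<le> smooth x"
  using m1_nonneg[of x] rough0_bounds(1)[of x] smooth0_bounds(1)[of x] by (simp_all add: rough_def smooth_def)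

lemma outer_large:
  assumes "2 \<le> \<bar>x\<bar>"
  shows "1 \<le> rough x" "1 \<le> smooth x" "\<theta> x = 1"
proof -
  have "2\<^sup>2 \<le> \<bar>x\<bar>\<^sup>2" using assms by (intro power_mono) auto
  then have m: "1 \<le> m1 x" by (simp add: m1_def)
  then show "1 \<le> rough x" using rough0_bounds(1)[of x] by (simp add: rough_def)
  show s: "1 \<le> smooth x" using one_le_power[OF m, of 3] smooth0_bounds(1)[of x] by (simp add: smooth_def)
  then show "\<theta> x = 1" by (simp add: \<theta>_def)
qed

lemma rough_theta_even: "rough (- x) = rough x" "\<theta> (- x) = \<theta> x"
  by (simp_all add: rough_def \<theta>_def smooth_def m1_def even0)

lemma smooth_bounds:
  assumes "\<bar>x\<bar> \<le> 2"
  shows "\<bar>smooth' x\<bar> \<le> 36 * rough x" "\<bar>smooth'' x\<bar> \<le> 114 * rough x" "rough x \<le> 4"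
proof -
  have x2: "x\<^sup>2 \<le> 2\<^sup>2" using power_mono[OF assms abs_ge_zero, of 2] by simp
  then have m: "m1 x \<le> 3" by (simp add: m1_def)
  have m2: "m1 x ^ 2 \<le> 3 * m1 x"
    using m m1_nonneg[of x] by (simp add: power2_eq_square mult_right_mono)
  have r: "rough0 x + m1 x = rough x" by (simp add: rough_def)
  have gen: "a + b \<le> 36 * (r + m)" if "a \<le> 3 * r" "b \<le> 36 * m" "0 \<le> r" for a b r m :: real
    using that by (simp add: distrib_left)
  have "\<bar>3 * m1 x ^ 2 * (2 * x)\<bar> = 6 * m1 x ^ 2 * \<bar>x\<bar>" by (simp add: abs_mult)
  also have "\<dots> \<le> 6 * (3 * m1 x) * 2"
    using m2 assms m1_nonneg[of x] by (intro mult_mono) auto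
  finally have "\<bar>3 * m1 x ^ 2 * (2 * x)\<bar> \<le> 36 * m1 x" by simp
  then show "\<bar>smooth' x\<bar> \<le> 36 * rough x"
    unfolding smooth'_def r[symmetric]
    by (rule order_trans[OF abs_triangle_ineq gen[OF smooth0_bounds(3) _ rough0_bounds(1)]])
  have "m1 x * x\<^sup>2 \<le> m1 x * 4" using x2 m1_nonneg[of x] by (intro mult_left_mono) auto
  then have "24 * (m1 x * x\<^sup>2) + 6 * m1 x ^ 2 \<le> 114 * m1 x" using m2 by simp
  moreover have "0 \<le> 24 * (m1 x * x\<^sup>2) + 6 * m1 x ^ 2" using m1_nonneg[of x] by simp
  moreover have eq: "3 * (2 * m1 x * (2 * x)) * (2 * x) + 2 * (3 * m1 x ^ 2) = 24 * (m1 x * x\<^sup>2) + 6 * m1 x ^ 2"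
    by (simp add: power2_eq_square)
  ultimately have "\<bar>3 * (2 * m1 x * (2 * x)) * (2 * x) + 2 * (3 * m1 x ^ 2)\<bar> \<le> 114 * m1 x"
    by (simp only: eq abs_of_nonneg)
  moreover have "a + b \<le> 114 * (r + m)" if "a \<le> 9 * r" "b \<le> 114 * m" "0 \<le> r" for a b r m :: real
    using that by (simp add: distrib_left)
  ultimately show "\<bar>smooth'' x\<bar> \<le> 114 * rough x"
    unfolding smooth''_def r[symmetric]
    using order_trans[OF abs_triangle_ineq] smooth0_bounds(4)[of x] rough0_bounds(1)[of x] by blast
  show "rough x \<le> 4" using m rough0_bounds(2)[of x] by (simp add: rough_def)
qed

lemma \<theta>_bounds: "0 \<le> \<theta> x" "\<theta> x \<le> 1"
proof -
  have "max 0 (1 - smooth x) \<le> 1" using smooth_nonneg[of x] by simp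
  then have "max 0 (1 - smooth x) ^ 3 \<le> 1" by (intro power_le_one) auto
  then show "0 \<le> \<theta> x" "\<theta> x \<le> 1" by (simp_all add: \<theta>_def)
qed

lemma \<theta>_eq_0_iff: "\<theta> x = 0 \<longleftrightarrow> rough x = 0"
proof -
  have "\<theta> x = 0 \<longleftrightarrow> smooth x = 0"
  proof
    assume "\<theta> x = 0"
    then have e: "max 0 (1 - smooth x) ^ 3 = 1" by (simp add: \<theta>_def)
    show "smooth x = 0"
    proof (rule ccontr)
      assume "smooth x \<noteq> 0"
      then have "max 0 (1 - smooth x) < 1" using smooth_nonneg[of x] by auto
      then have "max 0 (1 - smooth x) ^ 3 < 1 ^ 3" by (intro power_strict_mono) auto
      then show False using e by simp
    qed
  qed (simp add: \<theta>_def)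
  also have "\<dots> \<longleftrightarrow> smooth0 x = 0 \<and> m1 x ^ 3 = 0"
    unfolding smooth_def by (rule add_nonneg_eq_0_iff) (use smooth0_bounds m1_nonneg in auto)
  also have "\<dots> \<longleftrightarrow> rough0 x = 0 \<and> m1 x = 0" by (simp add: smooth0_eq_0_iff)
  also have "\<dots> \<longleftrightarrow> rough x = 0"
    unfolding rough_def by (rule add_nonneg_eq_0_iff[symmetric]) (use rough0_bounds m1_nonneg in auto)
  finally show ?thesis .
qed

text \<open>The factor \<open>min 1 (rough x)\<close> in the second bound is essential: it later
  lets \<open>g\<close> dominate \<open>G''\<close>. Such a factor is available because the
  derivatives of \<open>smooth\<close> are controlled by \<open>rough\<close> on [-2, 2], while
  beyond that interval the positive part in the definition is 0.\<close>

lemma \<theta>_derivative_bounds: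
  "\<bar>\<theta>' x\<bar> \<le> 10 ^ 6" "\<bar>\<theta>'' x\<bar> \<le> 10 ^ 6 * min 1 (rough x)"
proof -
  have "\<bar>\<theta>' x\<bar> \<le> 10 ^ 6 \<and> \<bar>\<theta>'' x\<bar> \<le> 10 ^ 6 * min 1 (rough x)"
  proof (cases "\<bar>x\<bar> \<le> 2")
    case False
    then have "1 \<le> smooth x" using outer_large(2)[of x] by simp
    then show ?thesis using rough_nonneg[of x] by (simp add: \<theta>'_def \<theta>''_def)
  next
    case True
    note b = smooth_bounds[OF True]
    define m where "m = max 0 (1 - smooth x)"
    have m: "0 \<le> m" "m \<le> 1" "m\<^sup>2 \<le> 1"
      using smooth_nonneg[of x] by (auto simp: m_def power_le_one)
    have R: "0 \<le> rough x" by (rule rough_nonneg)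
    have s1: "\<bar>smooth' x\<bar> \<le> 144" using b(1,3) by simp
    have "\<bar>\<theta>' x\<bar> = 3 * (m\<^sup>2 * \<bar>smooth' x\<bar>)" by (simp add: \<theta>'_def m_def abs_mult)
    also have "\<dots> \<le> 3 * (1 * 144)" using m s1 by (intro mult_left_mono mult_mono) auto
    finally have t1: "\<bar>\<theta>' x\<bar> \<le> 10 ^ 6" by simp
    have "\<bar>smooth' x\<bar> * \<bar>smooth' x\<bar> \<le> 144 * (36 * rough x)"
      using s1 b(1) by (intro mult_mono) auto
    then have "m * (\<bar>smooth' x\<bar> * \<bar>smooth' x\<bar>) \<le> 1 * (144 * (36 * rough x))"
      using m(1,2) by (rule_tac mult_mono) simp_all
    moreover have "m\<^sup>2 * \<bar>smooth'' x\<bar> \<le> 1 * (114 * rough x)"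
      using m b(2) by (intro mult_mono) auto
    moreover have "\<bar>\<theta>'' x\<bar> \<le> 6 * (m * (\<bar>smooth' x\<bar> * \<bar>smooth' x\<bar>)) + 3 * (m\<^sup>2 * \<bar>smooth'' x\<bar>)"
      unfolding \<theta>''_def m_def[symmetric]
      by (rule order_trans[OF abs_triangle_ineq]) (use m(1) in \<open>simp add: abs_mult\<close>)
    ultimately have "\<bar>\<theta>'' x\<bar> \<le> 40000 * rough x" using R by simp
    moreover have "rough x \<le> 4 * min 1 (rough x)" using b(3) R by (auto simp: min_def)
    ultimately have "\<bar>\<theta>'' x\<bar> \<le> 10 ^ 6 * min 1 (rough x)" using R by (auto simp: min_def)
    then show ?thesis using t1 by blast
  qed
  then show "\<bar>\<theta>' x\<bar> \<le> 10 ^ 6" "\<bar>\<theta>'' x\<bar> \<le> 10 ^ 6 * min 1 (rough x)" by auto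
qed

lemma rough_pos_dense:
  assumes "a < b"
  obtains x where "a < x" "x < b" "0 < rough x"
proof -
  have "0 < (b - a) / 7" using assms by simp
  then obtain n where n: "(1/16::real) ^ n < (b - a) / 7" using real_arch_pow_inv[of "(b - a) / 7" "1/16"] by auto
  define c where "c = 16 ^ n * b / (2 * pi)"
  \<comment> \<open>The ceiling minus 1 is the largest integer strictly below \<open>c\<close>, so
    the centre \<open>z\<close> lies strictly to the left of \<open>b\<close>, even if
    \<open>b\<close> is itself a centre.\<close>
  define k where "k = \<lceil>c\<rceil> - 1"
  define z where "z = of_int k * (2 * pi) / 16 ^ n"
  have "of_int k < c" "c \<le> of_int k + 1" unfolding k_def by linarith+
  then have "of_int k * (2 * pi) < c * (2 * pi)" "c * (2 * pi) \<le> (of_int k + 1) * (2 * pi)"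
    by (intro mult_strict_right_mono mult_right_mono; simp)+
  moreover have "c * (2 * pi) = 16 ^ n * b" by (simp add: c_def)
  moreover have "of_int k * (2 * pi) = 16 ^ n * z" by (simp add: z_def)
  moreover have "2 * pi < 7" using pi_approx by simp
  ultimately have "16 ^ n * z < 16 ^ n * b" and bz: "16 ^ n * b < 16 ^ n * z + 7"
    by (simp_all add: distrib_right)
  then have "z < b" by simp
  have "(z + 7 / 16 ^ n) * 16 ^ n = 16 ^ n * z + 7" by (simp add: distrib_right)
  then have "b * 16 ^ n < (z + 7 / 16 ^ n) * 16 ^ n" using bz by (simp only: mult.commute[of b])
  then have "b < z + 7 / 16 ^ n" by (rule mult_right_less_imp_less) simp
  then have "a < z" using n by (simp add: power_divide)
  have "16 ^ n * z = 0 + 2 * pi * of_int k" by (simp add: z_def)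
  then have "cos (16 ^ n * z) = 1" using cos.plus_of_int[of "0::real" k] by (simp add: mult_ac)
  then have "bump n z \<noteq> 0" using bump_width(1)[of n] by (simp add: bump_def)
  then have "rough0 z \<noteq> 0" using rough0_eq_0_iff by blast
  then have "0 < rough z" using rough0_bounds(1)[of z] m1_nonneg[of z] by (simp add: rough_def less_le)
  then show ?thesis using that \<open>a < z\<close> \<open>z < b\<close> by blast
qed

section \<open>Even profiles with a compactly supported double primitive\<close>

lemma continuous_antiderivative:
  fixes f :: "real \<Rightarrow> real"
  assumes "continuous_on UNIV f"
  shows "\<exists>F. F 0 = 0 \<and> (\<forall>x. (F has_field_derivative f x) (at x))"
proof -
  define F where "F x = (LBINT y=ereal 0..ereal x. f y)" for x :: real
  have D: "(F has_field_derivative f x) (at x)" for x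
  proof -
    define a where "a = - \<bar>x\<bar> - 1"
    define b where "b = \<bar>x\<bar> + 1"
    have ab: "a \<le> 0" "0 \<le> b" "a < x" "x < b" by (auto simp: a_def b_def)
    have V: "(F has_vector_derivative f x) (at x within {a..b})"
      unfolding F_def
      by (rule interval_integral_FTC2[OF ab(1,2) continuous_on_subset[OF assms subset_UNIV]
            less_imp_le[OF ab(3)] less_imp_le[OF ab(4)]])
    have "x \<in> interior {a..b}" using ab by simp
    then have "at x within {a..b} = at x" by (rule at_within_interior)
    with V show ?thesis
      by (simp only: has_real_derivative_iff_has_vector_derivative)
  qed
  have "F 0 = 0" unfolding F_def by (rule interval_integral_endpoints_same)
  with D show ?thesis by blast
qed

lemma zero_derivative_ray:
  assumes "\<And>x. (f has_field_derivative f' x) (at (x::real))" "\<And>x. a \<le> x \<Longrightarrow> f' x = 0" "a \<le> x"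
  shows "f x = f a"
proof (cases "a = x")
  case False
  then have "a < x" using assms(3) by simp
  then obtain z where "a < z" "z < x" "f x - f a = (x - a) * f' z"
    using MVT2[of a x f f'] assms(1) by blast
  then show ?thesis using assms(2)[of z] by simp
qed simp

text \<open>A double primitive of \<open>h - 1\<close> can have compact support only if
  \<open>h - 1\<close> has zero integral and zero first moment. The integral is corrected by adding
  mass to \<open>h0\<close>, with a nonnegative coefficient because \<open>h0 \<le> 1\<close>; the
  moment vanishes by evenness. The correction sits where \<open>h0 = 1\<close>, so \<open>h\<close>
  stays comparable to \<open>h0\<close> and has the same zeros.\<close>

lemma normalized_profile:
  fixes h0 :: "real \<Rightarrow> real"
  assumes cont: "continuous_on UNIV h0" and h0: "\<And>x. 0 \<le> h0 x" "\<And>x. h0 x \<le> 1"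
    and one: "\<And>x. 2 \<le> \<bar>x\<bar> \<Longrightarrow> h0 x = 1" and even: "\<And>x. h0 (- x) = h0 x"
  obtains h P P1 R M where "continuous_on UNIV h" "1 \<le> M"
    "\<And>x. h0 x \<le> h x" "\<And>x. h x \<le> M * h0 x"
    "\<And>x. (P has_field_derivative P1 x) (at x)" "\<And>x. (P1 has_field_derivative h x - 1) (at x)"
    "\<And>x. (R has_field_derivative P x) (at x)"
    "\<And>x. 4 \<le> \<bar>x\<bar> \<Longrightarrow> P x = 0" "\<And>x. \<bar>P x\<bar> \<le> M"
proof -
  \<comment> \<open>Two tents centred at 3 and -3, supported in the region
    \<open>2 \<le> \<bar>x\<bar>\<close> where \<open>h0\<close> is 1.\<close>
  define b :: "real \<Rightarrow> real" where "b x = max 0 (1 - \<bar>\<bar>x\<bar> - 3\<bar>)" for x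
  have cb: "continuous_on UNIV b" unfolding b_def by (intro continuous_intros)
  have b: "0 \<le> b x" "b x \<le> 1" for x by (auto simp: b_def)
  have beven: "b (- x) = b x" for x by (simp add: b_def)
  have "continuous_on UNIV (\<lambda>x. h0 x - 1)" by (intro continuous_intros cont)
  from continuous_antiderivative[OF this] obtain A
    where "A 0 = 0 \<and> (\<forall>x. (A has_field_derivative h0 x - 1) (at x))" ..
  then have A: "(A has_field_derivative h0 x - 1) (at x)" "A 0 = 0" for x by simp_all
  from continuous_antiderivative[OF cb] obtain B
    where "B 0 = 0 \<and> (\<forall>x. (B has_field_derivative b x) (at x))" ..
  then have B: "(B has_field_derivative b x) (at x)" "B 0 = 0" for x by simp_all
  have "\<exists>z>0. z < 4 \<and> A 4 - A 0 = (4 - 0) * (h0 z - 1)" by (rule MVT2) (simp_all add: A(1))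
  then obtain z where "A 4 - A 0 = (4 - 0) * (h0 z - 1)" by blast
  then have A4: "A 4 \<le> 0" using A(2) h0(2)[of z] by simp
  have Bmono: "B x \<le> B y" if "x \<le> y" for x y
    by (rule DERIV_nonneg_imp_nondecreasing[OF that], rule exI, rule conjI[OF B(1) b(1)])
  have "\<exists>y>5/2. y < 7/2 \<and> B (7/2) - B (5/2) = (7/2 - 5/2) * b y" by (rule MVT2) (simp_all add: B(1))
  then obtain y where y: "5/2 < y" "y < 7/2" "B (7/2) - B (5/2) = (7/2 - 5/2) * b y" by blast
  have "1/2 \<le> b y" unfolding b_def using y(1,2) by linarith
  then have B4: "0 < B 4" using y(3) Bmono[of 0 "5/2"] Bmono[of "7/2" 4] B(2) by simp
  \<comment> \<open>The coefficient is determined by the condition \<open>P1 4 = 0\<close>.\<close>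
  define m where "m = - A 4 / B 4"
  have m: "0 \<le> m" using A4 B4 by (simp add: m_def divide_nonpos_pos)
  define h where "h x = h0 x + m * b x" for x
  define P1 where "P1 x = A x + m * B x" for x
  have P1: "(P1 has_field_derivative h x - 1) (at x)" for x
    unfolding P1_def h_def by (rule DERIV_cong[OF DERIV_add[OF A(1) DERIV_cmult[OF B(1)]]]) simp
  have P1_4: "P1 4 = 0" using B4 by (simp add: P1_def m_def)
  have heven: "h (- x) = h x" for x by (simp add: h_def even beven)
  \<comment> \<open>Oddness of \<open>P1\<close>, and below evenness of \<open>P\<close>, carry the
    vanishing beyond 4 over to the left half-line.\<close>
  have P1_odd: "P1 (- x) = - P1 x" for x
  proof -
    have "((\<lambda>x. P1 x + P1 (- x)) has_field_derivative 0) (at x)" for x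
    proof -
      have "((\<lambda>x. P1 (- x)) has_field_derivative (h (- x) - 1) * - 1) (at x)"
        by (rule DERIV_chain2[OF P1]) (auto intro!: derivative_eq_intros)
      from DERIV_add[OF P1 this] show ?thesis by (simp add: heven)
    qed
    then have "P1 x + P1 (- x) = P1 0 + P1 (- 0)" by (rule DERIV_isconst_all[rule_format]) 
    then show ?thesis using A(2) B(2) by (simp add: P1_def)
  qed
  have h1: "h x = 1" if "4 \<le> \<bar>x\<bar>" for x using that one[of x] by (simp add: h_def b_def)
  have P1_out: "P1 x = 0" if "4 \<le> \<bar>x\<bar>" for x
  proof -
    have "P1 \<bar>x\<bar> = P1 4"
      by (rule zero_derivative_ray[OF P1 _ that]) (simp add: h1)
    then show ?thesis using P1_odd[of x] P1_4 by (cases "0 \<le> x") simp_all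
  qed
  have cP1: "continuous_on UNIV P1" by (rule DERIV_continuous_on_UNIV[OF P1])
  from continuous_antiderivative[OF cP1] obtain P0
    where "P0 0 = 0 \<and> (\<forall>x. (P0 has_field_derivative P1 x) (at x))" ..
  then have P0: "(P0 has_field_derivative P1 x) (at x)" for x by simp
  define P where "P x = P0 x - P0 4" for x
  have P: "(P has_field_derivative P1 x) (at x)" for x
    unfolding P_def using DERIV_diff[OF P0 DERIV_const] by simp
  have P_even: "P (- x) = P x" for x
  proof -
    have "((\<lambda>x. P x - P (- x)) has_field_derivative 0) (at x)" for x
    proof -
      have "((\<lambda>x. P (- x)) has_field_derivative P1 (- x) * - 1) (at x)"
        by (rule DERIV_chain2[OF P]) (auto intro!: derivative_eq_intros)
      from DERIV_diff[OF P this] show ?thesis by (simp add: P1_odd)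
    qed
    then have "P x - P (- x) = P 0 - P (- 0)" by (rule DERIV_isconst_all[rule_format])
    then show ?thesis by simp
  qed
  have P_out: "P x = 0" if "4 \<le> \<bar>x\<bar>" for x
  proof -
    have "P \<bar>x\<bar> = P 4"
      by (rule zero_derivative_ray[OF P _ that]) (simp add: P1_out)
    also have "P 4 = 0" by (simp add: P_def)
    finally show ?thesis using P_even[of x] by (cases "0 \<le> x") simp_all
  qed
  have cP: "continuous_on UNIV P" by (rule DERIV_continuous_on_UNIV[OF P])
  from continuous_antiderivative[OF cP] obtain R
    where "R 0 = 0 \<and> (\<forall>x. (R has_field_derivative P x) (at x))" ..
  then have R: "(R has_field_derivative P x) (at x)" for x by simp
  have "bounded (P ` {-4..4})"
    by (intro compact_imp_bounded compact_continuous_image continuous_on_subset[OF cP]) auto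
  then obtain M1 where M1: "\<forall>x\<in>{-4..4}. \<bar>P x\<bar> \<le> M1" by (auto simp: bounded_iff)
  have P_bound: "\<bar>P x\<bar> \<le> \<bar>M1\<bar>" for x
  proof (cases "4 \<le> \<bar>x\<bar>")
    case False
    then have "x \<in> {-4..4}" by auto
    then show ?thesis using M1 abs_ge_self[of M1] by (meson order_trans)
  qed (simp add: P_out)
  define M where "M = 1 + m + \<bar>M1\<bar>"
  have hM: "h x \<le> M * h0 x" for x
  proof (cases "2 \<le> \<bar>x\<bar>")
    case True
    have "m * b x \<le> m" using m b(2)[of x] by (simp add: mult_left_le)
    then show ?thesis using one[OF True] by (simp add: h_def M_def)
  next
    case False
    then have "b x = 0" by (auto simp: b_def)
    moreover have "1 * h0 x \<le> M * h0 x" using m h0(1)[of x] by (intro mult_right_mono) (auto simp: M_def)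
    ultimately show ?thesis by (simp add: h_def)
  qed
  show ?thesis
  proof (rule that[of h M P P1 R])
    show "continuous_on UNIV h" unfolding h_def by (intro continuous_intros cont cb)
    show "1 \<le> M" using m by (simp add: M_def)
    show "h0 x \<le> h x" for x using m b(1)[of x] by (simp add: h_def)
    show "\<bar>P x\<bar> \<le> M" for x using P_bound[of x] m by (simp add: M_def)
  qed (fact hM P P1 R P_out)+
qed

section \<open>The product zero set has positive measure\<close>

lemma half_le_sin:
  assumes "0 \<le> s" "s \<le> pi / 2"
  shows "s / 2 \<le> sin s"
\<comment> \<open>Below \<open>pi / 3\<close> the cosine is at least 1/2 and the mean value theorem
  applies; above it, \<open>sin s\<close> is at least half of \<open>sqrt 3\<close>, hence at least
  17/20, while s/2 is less than 4/5.\<close>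
proof (cases "s \<le> pi / 3")
  case True
  show ?thesis
  proof (cases "s = 0")
    case False
    have "\<exists>z>0. z < s \<and> sin s - sin 0 = (s - 0) * cos z"
      by (rule MVT2) (use False assms in auto)
    then obtain z where z: "0 < z" "z < s" "sin s - sin 0 = (s - 0) * cos z" by blast
    have "cos (pi / 3) \<le> cos z" using z True assms by (intro cos_monotone_0_pi_le) auto
    then have "s * (1/2) \<le> s * cos z" using assms by (intro mult_left_mono) (auto simp: cos_60)
    then show ?thesis using z(3) by simp
  qed simp
next
  case False
  have "sin (pi / 3) \<le> sin s" using False assms by (intro sin_monotone_2pi_le) auto
  moreover have "(17/10)\<^sup>2 \<le> (3::real)" by (simp add: power2_eq_square)
  then have "17/10 \<le> sqrt 3" by (rule real_le_rsqrt)
  moreover have "pi < 16/5" using pi_approx by simp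
  ultimately show ?thesis using assms by (simp add: sin_60)
qed

text \<open>Since 1 - cos t = 2 sin^2 (t/2) is at least t^2 / 8, the hypothesis gives t^2 at most 8
  e^2. This bounds the support of a bump.\<close>

lemma abs_le_if_cos_gt:
  assumes "\<bar>t\<bar> \<le> pi" "1 - e\<^sup>2 < cos t" "0 < e"
  shows "\<bar>t\<bar> \<le> 3 * e"
proof -
  have "\<bar>t\<bar> / 2 / 2 \<le> sin (\<bar>t\<bar> / 2)" by (rule half_le_sin) (use assms in auto)
  then have "(\<bar>t\<bar> / 2 / 2)\<^sup>2 \<le> (sin (\<bar>t\<bar> / 2))\<^sup>2" by (intro power_mono) auto
  moreover have "cos (2 * (\<bar>t\<bar> / 2)) = 1 - 2 * (sin (\<bar>t\<bar> / 2))\<^sup>2" by (rule cos_double_sin)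
  then have "cos t = 1 - 2 * (sin (\<bar>t\<bar> / 2))\<^sup>2" by simp
  moreover have "(\<bar>t\<bar> / 2 / 2)\<^sup>2 = \<bar>t\<bar>\<^sup>2 / 16" by (simp add: power2_eq_square)
  ultimately have "\<bar>t\<bar>\<^sup>2 \<le> 8 * e\<^sup>2" using assms(2) by linarith
  also have "\<dots> \<le> (3 * e)\<^sup>2" by (simp add: power_mult_distrib)
  finally show ?thesis by (rule power2_le_imp_le) (use assms(3) in simp)
qed

text \<open>A nonzero bump confines x to a short interval around one of its centres. The restriction
  to [0, 1] leaves at most 16 ^ n + 1 centres at level n, so the intervals can be counted.\<close>

lemma rough_nonzero_near:
  assumes "0 \<le> x" "x \<le> 1" "rough x \<noteq> 0"
  obtains n k where "k \<le> 16 ^ n" "\<bar>16 ^ n * x - 2 * pi * real k\<bar> \<le> 3 * bump_width n"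
proof -
  have "x\<^sup>2 \<le> 1" using assms by (simp add: power_le_one)
  then have "rough0 x \<noteq> 0" using assms(3) by (simp add: rough_def m1_def)
  then obtain n where n: "bump n x \<noteq> 0" using rough0_eq_0_iff by blast
  define y where "y = 16 ^ n * x"
  define k where "k = \<lfloor>y / (2 * pi) + 1/2\<rfloor>"
  define t where "t = y - 2 * pi * of_int k"
  have y: "0 \<le> y" "y \<le> 16 ^ n" using assms by (auto simp: y_def mult_left_le)
  then have "0 \<le> k" unfolding k_def by (simp add: add_nonneg_nonneg)
  have "\<bar>y / (2 * pi) - of_int k\<bar> \<le> 1/2" unfolding k_def by linarith
  then have "\<bar>y / (2 * pi) - of_int k\<bar> * (2 * pi) \<le> 1/2 * (2 * pi)" by (intro mult_right_mono) auto
  moreover have "t = (y / (2 * pi) - of_int k) * (2 * pi)" by (simp add: t_def left_diff_distrib)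
  then have "\<bar>t\<bar> = \<bar>y / (2 * pi) - of_int k\<bar> * (2 * pi)" by (simp add: abs_mult)
  ultimately have tpi: "\<bar>t\<bar> \<le> pi" by simp
  have "cos y = cos t" using cos.plus_of_int[of t k] by (simp add: t_def mult_ac)
  then have "1 - (bump_width n)\<^sup>2 < cos t" using n by (auto simp: bump_def y_def max_def split: if_splits)
  from abs_le_if_cos_gt[OF tpi this bump_width(1)] have near: "\<bar>y - 2 * pi * of_int k\<bar> \<le> 3 * bump_width n"
    by (simp add: t_def)
  have "2 * pi * of_int k \<le> y + pi" using tpi by (simp add: t_def)
  moreover have "pi * 1 \<le> pi * 16 ^ n" by (intro mult_left_mono) auto
  moreover have "1 * (16::real) ^ n \<le> pi * 16 ^ n" using pi_gt3 by (intro mult_right_mono) auto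
  ultimately have "2 * pi * of_int k \<le> 2 * pi * 16 ^ n" using y by linarith
  then have "of_int k \<le> (16::real) ^ n" by simp
  then have "real (nat k) \<le> real (16 ^ n)" using \<open>0 \<le> k\<close> by simp
  then have "nat k \<le> 16 ^ n" by (simp only: of_nat_le_iff)
  then show ?thesis using that[of "nat k" n] near \<open>0 \<le> k\<close> by (simp add: y_def)
qed

lemma emeasure_cbox_pt:
  assumes "a \<le> c" "b \<le> d"
  shows "emeasure lebesgue (cbox (pt a b) (pt c d)) = ennreal ((c - a) * (d - b))"
proof -
  have "cbox (pt a b) (pt c d) \<noteq> {}" using assms by (simp add: interval_ne_empty_cart forall_2)
  then have "measure lborel (cbox (pt a b) (pt c d)) = (c - a) * (d - b)"
    by (simp add: content_cbox_cart prod_2 UNIV_2)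
  moreover have "emeasure lebesgue (cbox (pt a b) (pt c d)) = ennreal (measure lebesgue (cbox (pt a b) (pt c d)))"
    by (rule emeasure_eq_measure2[OF lmeasurable_cbox])
  ultimately show ?thesis by (simp add: measure_completion)
qed

definition strip1 :: "real \<Rightarrow> real \<Rightarrow> nat \<Rightarrow> nat \<Rightarrow> (real^2) set" where
  "strip1 a b n k = cbox (pt (a * ((2 * pi * real k - 3 * bump_width n) / 16 ^ n)) 0)
     (pt (a * ((2 * pi * real k + 3 * bump_width n) / 16 ^ n)) b)"
definition strip2 :: "real \<Rightarrow> real \<Rightarrow> nat \<Rightarrow> nat \<Rightarrow> (real^2) set" where
  "strip2 a b n k = cbox (pt 0 (b * ((2 * pi * real k - 3 * bump_width n) / 16 ^ n)))
     (pt a (b * ((2 * pi * real k + 3 * bump_width n) / 16 ^ n)))"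

lemma emeasure_strip:
  assumes "0 < a" "0 < b"
  shows "emeasure lebesgue (strip1 a b n k) = ennreal (6 * bump_width n / 16 ^ n * (a * b))"
    "emeasure lebesgue (strip2 a b n k) = ennreal (6 * bump_width n / 16 ^ n * (a * b))"
proof -
  let ?l = "(2 * pi * real k - 3 * bump_width n) / 16 ^ n" and ?u = "(2 * pi * real k + 3 * bump_width n) / 16 ^ n"
  have le: "?l \<le> ?u" using bump_width(1)[of n] by (intro divide_right_mono) auto
  have d: "?u - ?l = 6 * bump_width n / 16 ^ n" by (simp add: diff_divide_distrib[symmetric])
  have "c * ?u - c * ?l = c * (6 * bump_width n / 16 ^ n)" for c by (simp only: d flip: right_diff_distrib)
  note * = this[of a] this[of b]
  show "emeasure lebesgue (strip1 a b n k) = ennreal (6 * bump_width n / 16 ^ n * (a * b))"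
    unfolding strip1_def emeasure_cbox_pt[OF mult_left_mono[OF le less_imp_le[OF assms(1)]] less_imp_le[OF assms(2)]] *(1)
    by (simp add: mult_ac)
  show "emeasure lebesgue (strip2 a b n k) = ennreal (6 * bump_width n / 16 ^ n * (a * b))"
    unfolding strip2_def emeasure_cbox_pt[OF less_imp_le[OF assms(1)] mult_left_mono[OF le less_imp_le[OF assms(2)]]] *(2)
    by (simp add: mult_ac)
qed

text \<open>A point of the box outside the product set lies in some strip. Level n has 2 (16 ^ n +
  1) strips of area \<open>6 * bump_width n / 16 ^ n * (a * b)\<close>, together at most 3/8 * 2 ^
  (- n) of the box, so all levels cover at most 3/4 of it. The offset 6 in the exponent of
  \<open>bump_width\<close> keeps this total below 1.\<close>

lemma zero_set_not_negligible:
  assumes a: "0 < a" and b: "0 < b"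
  shows "\<not> negligible {z :: real^2. rough (z$1 / a) = 0 \<and> rough (z$2 / b) = 0}"
    (is "\<not> negligible ?S")
proof
  assume neg: "negligible ?S"
  let ?Box = "cbox (pt 0 0) (pt a b)"
  define T where "T n = (\<Union>k\<le>16 ^ n. strip1 a b n k) \<union> (\<Union>k\<le>16 ^ n. strip2 a b n k)" for n
  have Ts: "T n \<in> sets lebesgue" for n unfolding T_def strip1_def strip2_def by (intro sets.Un sets.finite_UN) auto
  have fin: "finite {..(16::nat) ^ n}" for n by simp
  have bound: "emeasure lebesgue (T n) \<le> ennreal (3/8 * (a * b) * (1/2) ^ n)" for n
  proof -
    let ?e = "6 * bump_width n / 16 ^ n * (a * b)"
    have e: "0 \<le> ?e" using bump_width(1)[of n] a b by simp
    have "0 \<le> (16::real) ^ n + 1" by (simp add: add_nonneg_nonneg)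
    then have e': "0 \<le> ((16::real) ^ n + 1) * ?e" using e by (rule mult_nonneg_nonneg)
    have 1: "emeasure lebesgue (\<Union>k\<le>16 ^ n. strip1 a b n k) \<le> (\<Sum>k\<le>16 ^ n. emeasure lebesgue (strip1 a b n k))"
      "emeasure lebesgue (\<Union>k\<le>16 ^ n. strip2 a b n k) \<le> (\<Sum>k\<le>16 ^ n. emeasure lebesgue (strip2 a b n k))"
      by (intro emeasure_subadditive_finite[OF fin]; force simp: strip1_def strip2_def)+
    have 2: "(\<Sum>k\<le>(16::nat) ^ n. ennreal ?e) = ennreal ((16 ^ n + 1) * ?e)"
      using e by (subst sum_ennreal) (simp_all add: add.commute)
    have "emeasure lebesgue (T n) \<le> emeasure lebesgue (\<Union>k\<le>16 ^ n. strip1 a b n k) + emeasure lebesgue (\<Union>k\<le>16 ^ n. strip2 a b n k)"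
      unfolding T_def by (intro emeasure_subadditive sets.finite_UN) (auto simp: strip1_def strip2_def)
    also have "\<dots> \<le> ennreal ((16 ^ n + 1) * ?e) + ennreal ((16 ^ n + 1) * ?e)"
      using add_mono[OF 1] by (simp only: emeasure_strip[OF a b] 2)
    also have "\<dots> = ennreal (2 * ((16 ^ n + 1) * ?e))" 
      by (simp only: mult_2 ennreal_plus[OF e' e'])
    also have "\<dots> \<le> ennreal (3/8 * (a * b) * (1/2) ^ n)"
    proof (rule ennreal_leI)
      have "(16::real) ^ n + 1 \<le> 2 * 16 ^ n" by simp
      then have "((16::real) ^ n + 1) * ?e \<le> (2 * 16 ^ n) * ?e" using e by (rule mult_right_mono)
      also have "\<dots> = 12 * bump_width n * (a * b)" by simp
      also have "\<dots> = 12 / 64 * (a * b) * (1/2) ^ n" by (simp add: bump_width_def power_add power_divide)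
      finally show "2 * ((16 ^ n + 1) * ?e) \<le> 3/8 * (a * b) * (1/2) ^ n" by simp
    qed
    finally show ?thesis .
  qed
  have cover: "?Box \<subseteq> ?S \<union> (\<Union>n. T n)"
  proof
    fix z assume "z \<in> ?Box"
    then have z: "0 \<le> z$1" "z$1 \<le> a" "0 \<le> z$2" "z$2 \<le> b" by (simp_all add: mem_box_cart forall_2)
    have scale: "c * ((2 * pi * real k - 3 * bump_width n) / 16 ^ n) \<le> y \<and> y \<le> c * ((2 * pi * real k + 3 * bump_width n) / 16 ^ n)"
      if "0 < c" "\<bar>16 ^ n * (y / c) - 2 * pi * real k\<bar> \<le> 3 * bump_width n" for c y n k
    proof -
      have "2 * pi * real k - 3 * bump_width n \<le> 16 ^ n * (y / c)" "16 ^ n * (y / c) \<le> 2 * pi * real k + 3 * bump_width n"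
        using that(2) by linarith+
      then have "(2 * pi * real k - 3 * bump_width n) / 16 ^ n \<le> y / c" "y / c \<le> (2 * pi * real k + 3 * bump_width n) / 16 ^ n"
        by (simp_all add: pos_divide_le_eq pos_le_divide_eq mult.commute)
      then have "c * ((2 * pi * real k - 3 * bump_width n) / 16 ^ n) \<le> c * (y / c)" "c * (y / c) \<le> c * ((2 * pi * real k + 3 * bump_width n) / 16 ^ n)"
        using that(1) by (intro mult_left_mono; simp)+
      then show ?thesis using that(1) by simp
    qed
    show "z \<in> ?S \<union> (\<Union>n. T n)"
    proof (cases "rough (z$1 / a) = 0")
      case False
      have "0 \<le> z$1 / a" "z$1 / a \<le> 1" using z a by simp_all
      then obtain n k where nk: "k \<le> 16 ^ n" "\<bar>16 ^ n * (z$1 / a) - 2 * pi * real k\<bar> \<le> 3 * bump_width n"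
        using rough_nonzero_near[OF _ _ False] by blast
      have "z \<in> strip1 a b n k"
        using scale[OF a nk(2)] z by (simp add: strip1_def mem_box_cart forall_2)
      then have "z \<in> T n" using nk(1) by (auto simp: T_def)
      then show ?thesis by blast
    next
      case True
      show ?thesis
      proof (cases "rough (z$2 / b) = 0")
        case False
        have "0 \<le> z$2 / b" "z$2 / b \<le> 1" using z b by simp_all
        then obtain n k where nk: "k \<le> 16 ^ n" "\<bar>16 ^ n * (z$2 / b) - 2 * pi * real k\<bar> \<le> 3 * bump_width n"
          using rough_nonzero_near[OF _ _ False] by blast
        have "z \<in> strip2 a b n k"
          using scale[OF b nk(2)] z by (simp add: strip2_def mem_box_cart forall_2)
        then have "z \<in> T n" using nk(1) by (auto simp: T_def)
        then show ?thesis by blast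
      qed (use True in blast)
    qed
  qed
  have S: "?S \<in> null_sets lebesgue" using neg by (simp add: negligible_iff_null_sets)
  have sums: "(\<lambda>n. 3/8 * (a * b) * (1/2) ^ n) sums (3/8 * (a * b) * (1 / (1 - 1/2)))"
    by (intro sums_mult geometric_sums) simp
  have "emeasure lebesgue ?Box \<le> emeasure lebesgue (?S \<union> (\<Union>n. T n))"
    using null_setsD2[OF S] Ts by (intro emeasure_mono cover sets.Un sets.countable_UN) auto
  also have "\<dots> \<le> emeasure lebesgue ?S + emeasure lebesgue (\<Union>n. T n)"
    using null_setsD2[OF S] Ts by (intro emeasure_subadditive sets.countable_UN) auto
  also have "\<dots> = emeasure lebesgue (\<Union>n. T n)" using null_setsD1[OF S] by simp
  also have "\<dots> \<le> (\<Sum>n. emeasure lebesgue (T n))" using Ts by (intro emeasure_subadditive_countably) auto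
  also have "\<dots> \<le> (\<Sum>n. ennreal (3/8 * (a * b) * (1/2) ^ n))" by (intro suminf_le bound) auto
  also have "\<dots> = ennreal (3/8 * (a * b) * (1 / (1 - 1/2)))"
    using a b sums by (intro suminf_ennreal_eq) auto
  finally have "ennreal ((a - 0) * (b - 0)) \<le> ennreal (3/8 * (a * b) * (1 / (1 - 1/2)))"
    using emeasure_cbox_pt[of 0 a 0 b] a b by simp
  moreover have "0 < a * b" using a b by simp
  ultimately show False by (simp add: ennreal_le_iff)
qed

section \<open>The degenerate generating function\<close>

definition ramp :: "real \<Rightarrow> real" where "ramp x = max 0 ((16 * x\<^sup>2 - 1) / 3)"
text \<open>\<open>ramp\<close> is 0 up to \<open>\<bar>x\<bar> = 1/4\<close> and reaches 1 at
  \<open>\<bar>x\<bar> = 1/2\<close>. The inner cube makes the start of the transition C^2, the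
  outer cube its end.\<close>

definition cutoff :: "real \<Rightarrow> real" where "cutoff x = max 0 (1 - ramp x ^ 3) ^ 3"
definition cutoff' :: "real \<Rightarrow> real" where
  "cutoff' x = 3 * max 0 (1 - ramp x ^ 3) ^ 2 * (- (3 * ramp x ^ 2 * (32 / 3 * x)))"
definition cutoff'' :: "real \<Rightarrow> real" where
  "cutoff'' x = 3 * (2 * max 0 (1 - ramp x ^ 3) * (- (3 * ramp x ^ 2 * (32 / 3 * x)))) * (- (3 * ramp x ^ 2 * (32 / 3 * x)))
     + (- (3 * (2 * ramp x * (32 / 3 * x)) * (32 / 3 * x) + 32 / 3 * (3 * ramp x ^ 2))) * (3 * max 0 (1 - ramp x ^ 3) ^ 2)"

lemma ramp_base: "((\<lambda>x::real. (16 * x\<^sup>2 - 1) / 3) has_field_derivative 32 / 3 * x) (at x)"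
  by (auto intro!: derivative_eq_intros)

lemma ramp3_derivative:
  "((\<lambda>x. 1 - ramp x ^ 3) has_field_derivative - (3 * ramp x ^ 2 * (32 / 3 * x))) (at x)"
  using DERIV_diff[OF DERIV_const positive_part_chain(1)[OF ramp_base]]
  unfolding ramp_def[abs_def] by simp

lemma cutoff_derivative: "(cutoff has_field_derivative cutoff' x) (at x)"
  unfolding cutoff_def[abs_def] cutoff'_def by (rule positive_part_chain(1)[OF ramp3_derivative])

lemma cutoff'_derivative: "(cutoff' has_field_derivative cutoff'' x) (at x)"
proof -
  have "((\<lambda>x. ramp x ^ 2) has_field_derivative 2 * ramp x * (32 / 3 * x)) (at x)"
    unfolding ramp_def[abs_def] ramp_def by (rule positive_part_chain(2)[OF ramp_base])
  moreover have "((\<lambda>x. 32 / 3 * x) has_field_derivative 32 / 3) (at x)"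
    by (auto intro!: derivative_eq_intros)
  ultimately show ?thesis
    unfolding cutoff'_def[abs_def] cutoff''_def
    by (intro DERIV_mult DERIV_cmult DERIV_minus positive_part_chain(2)[OF ramp3_derivative])
qed

lemma continuous_on_cutoff'': "continuous_on UNIV cutoff''"
proof -
  have "continuous_on UNIV ramp" unfolding ramp_def[abs_def] by (intro continuous_intros) auto
  then show ?thesis
    unfolding cutoff''_def[abs_def]
    by (intro continuous_on_add continuous_on_mult continuous_on_minus continuous_on_max continuous_on_diff
        continuous_on_power continuous_on_const continuous_on_id)
qed

lemma ramp_inner:
  assumes "\<bar>x\<bar> \<le> 1/4" shows "ramp x = 0"
proof -
  have "\<bar>x\<bar>\<^sup>2 \<le> (1/4)\<^sup>2" using assms by (intro power_mono) auto
  then show ?thesis by (simp add: ramp_def power_divide)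
qed

lemma cutoff_inner:
  assumes "\<bar>x\<bar> \<le> 1/4" shows "cutoff x = 1" "cutoff' x = 0" "cutoff'' x = 0"
  using ramp_inner[OF assms] by (simp_all add: cutoff_def cutoff'_def cutoff''_def)

lemma cutoff_outer:
  assumes "1/2 \<le> \<bar>x\<bar>" shows "cutoff x = 0"
proof -
  have "(1/2)\<^sup>2 \<le> \<bar>x\<bar>\<^sup>2" using assms by (intro power_mono) auto
  then have "1 \<le> ramp x" by (simp add: ramp_def power_divide)
  from one_le_power[OF this, of 3] show ?thesis by (simp add: cutoff_def)
qed

lemma cutoff_bounds: "0 \<le> cutoff x" "cutoff x \<le> 1"
proof -
  have "max 0 (1 - ramp x ^ 3) \<le> 1" by (simp add: ramp_def)
  then show "0 \<le> cutoff x" "cutoff x \<le> 1" by (auto simp: cutoff_def intro: power_le_one)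
qed

lemma cutoff_derivative_bounds: "\<bar>cutoff' x\<bar> \<le> 3000" "\<bar>cutoff'' x\<bar> \<le> 3000"
proof -
  have "\<bar>cutoff' x\<bar> \<le> 3000 \<and> \<bar>cutoff'' x\<bar> \<le> 3000"
  proof (cases "\<bar>x\<bar> \<le> 1/2")
    case False
    then have "(1/2)\<^sup>2 \<le> \<bar>x\<bar>\<^sup>2" by (intro power_mono) auto
    then have "1 \<le> ramp x" by (simp add: ramp_def power_divide)
    from one_le_power[OF this, of 3] show ?thesis by (simp add: cutoff'_def cutoff''_def)
  next
    case True
    define p where "p = ramp x"
    define s where "s = max 0 (1 - p ^ 3)"
    define a where "a = 32 / 3 * x"
    define e where "e = 3 * p\<^sup>2 * a"
    have "\<bar>x\<bar>\<^sup>2 \<le> (1/2)\<^sup>2" using True by (intro power_mono) auto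
    then have p: "0 \<le> p" "p \<le> 1" by (simp_all add: p_def ramp_def power_divide)
    have s: "0 \<le> s" "s \<le> 1" using p(1) by (simp_all add: s_def)
    have a: "\<bar>a\<bar> \<le> 6" using True by (simp add: a_def abs_mult)
    have p2: "p\<^sup>2 \<le> 1" and s2: "s\<^sup>2 \<le> 1" using p s by (simp_all add: power_le_one)
    have "\<bar>e\<bar> = 3 * (p\<^sup>2 * \<bar>a\<bar>)" by (simp add: e_def abs_mult)
    also have "\<dots> \<le> 3 * (1 * 6)" using p2 a by (intro mult_left_mono mult_mono) auto
    finally have e: "\<bar>e\<bar> \<le> 18" by simp
    have "\<bar>cutoff' x\<bar> = 3 * (s\<^sup>2 * \<bar>e\<bar>)"
      by (simp add: cutoff'_def s_def p_def e_def a_def abs_mult)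
    also have "\<dots> \<le> 3 * (1 * 18)" using s2 e by (intro mult_left_mono mult_mono) auto
    finally have 1: "\<bar>cutoff' x\<bar> \<le> 3000" by simp
    have c2: "cutoff'' x = 3 * (2 * s * (- e)) * (- e) + (- (3 * (2 * p * a) * a + 32 / 3 * (3 * p\<^sup>2))) * (3 * s\<^sup>2)"
      by (simp add: cutoff''_def s_def p_def e_def a_def)
    have "\<bar>3 * (2 * s * (- e)) * (- e)\<bar> = 6 * (s * (\<bar>e\<bar> * \<bar>e\<bar>))" using s by (simp add: abs_mult)
    also have "\<dots> \<le> 6 * (1 * (18 * 18))" using s e by (intro mult_left_mono mult_mono) auto
    finally have t1: "\<bar>3 * (2 * s * (- e)) * (- e)\<bar> \<le> 1944" by simp
    have "\<bar>3 * (2 * p * a) * a\<bar> = 6 * (p * (\<bar>a\<bar> * \<bar>a\<bar>))" using p by (simp add: abs_mult)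
    also have "\<dots> \<le> 6 * (1 * (6 * 6))" using p a by (intro mult_left_mono mult_mono) auto
    finally have "\<bar>3 * (2 * p * a) * a\<bar> \<le> 216" by simp
    moreover have "\<bar>32 / 3 * (3 * p\<^sup>2)\<bar> \<le> 32" using p2 by simp
    ultimately have "\<bar>3 * (2 * p * a) * a + 32 / 3 * (3 * p\<^sup>2)\<bar> \<le> 216 + 32"
      by (rule order_trans[OF abs_triangle_ineq add_mono])
    then have "\<bar>- (3 * (2 * p * a) * a + 32 / 3 * (3 * p\<^sup>2))\<bar> \<le> 216 + 32" by (simp only: abs_minus_cancel)
    moreover have "\<bar>3 * s\<^sup>2\<bar> \<le> 3" using s2 by simp
    ultimately have t2: "\<bar>(- (3 * (2 * p * a) * a + 32 / 3 * (3 * p\<^sup>2))) * (3 * s\<^sup>2)\<bar> \<le> (216 + 32) * 3"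
      unfolding abs_mult by (intro mult_mono) auto
    have "\<bar>cutoff'' x\<bar> \<le> 1944 + (216 + 32) * 3"
      unfolding c2 by (rule order_trans[OF abs_triangle_ineq add_mono[OF t1 t2]])
    then show ?thesis using 1 by simp
  qed
  then show "\<bar>cutoff' x\<bar> \<le> 3000" "\<bar>cutoff'' x\<bar> \<le> 3000" by auto
qed

text \<open>The tangent bound 1 - (1 - s)^3 \<le> 3 s, together with
  \<open>smooth \<le> 9 * rough\<close> on [-2, 2], where \<open>m1 \<le> 3\<close>.\<close>

lemma \<theta>_le: "\<theta> x \<le> 27 * min 1 (rough x)"
proof (cases "\<bar>x\<bar> \<le> 2")
  case False
  then have "1 \<le> rough x" using outer_large(1)[of x] by simp
  then show ?thesis using \<theta>_bounds(2)[of x] by simp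
next
  case True
  have cube: "1 - 3 * s \<le> max 0 (1 - s) ^ 3" if "0 \<le> s" for s :: real
  proof (cases "s \<le> 1")
    case True
    have "(1 - s) ^ 3 - (1 - 3 * s) = s\<^sup>2 * (3 - s)"
      by (simp add: power2_eq_square power3_eq_cube algebra_simps)
    moreover have "0 \<le> s\<^sup>2 * (3 - s)" using True by simp
    ultimately have "1 - 3 * s \<le> (1 - s) ^ 3" by linarith
    then show ?thesis using True by simp
  qed simp
  have "\<theta> x \<le> 3 * smooth x" using cube[OF smooth_nonneg[of x]] unfolding \<theta>_def by linarith
  moreover have "smooth x \<le> 9 * rough x"
  proof -
    have "x\<^sup>2 \<le> 2\<^sup>2" using power_mono[OF True abs_ge_zero, of 2] by simp
    then have "m1 x \<le> 3" by (simp add: m1_def)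
    then have "m1 x ^ 2 \<le> 3 ^ 2" by (intro power_mono m1_nonneg)
    then have "m1 x ^ 2 * m1 x \<le> 3 ^ 2 * m1 x" by (intro mult_right_mono m1_nonneg)
    then have "m1 x ^ 3 \<le> 9 * m1 x" by (simp add: power3_eq_cube power2_eq_square)
    then show ?thesis using smooth0_bounds(2)[of x] rough0_bounds(1)[of x] by (simp add: smooth_def rough_def)
  qed
  ultimately have "\<theta> x \<le> 27 * rough x" by simp
  then show ?thesis using \<theta>_bounds(2)[of x] by (simp add: min_def)
qed

lemma strictly_increasing_if_derivative_pos_dense:
  fixes f :: "real \<Rightarrow> real"
  assumes f: "\<And>x. (f has_field_derivative f' x) (at x)" and nn: "\<And>x. 0 \<le> f' x"
    and dense: "\<And>a b. a < b \<Longrightarrow> \<exists>x. a < x \<and> x < b \<and> 0 < f' x" and st: "s < t"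
  shows "f s < f t"
proof -
  have mono: "f x \<le> f y" if "x \<le> y" for x y
    by (rule DERIV_nonneg_imp_nondecreasing[OF that], rule exI, rule conjI[OF f nn])
  obtain x where x: "s < x" "x < t" "0 < f' x" using dense[OF st] by blast
  obtain d where d: "0 < d" "\<forall>h>0. h < d \<longrightarrow> f x < f (x + h)"
    using DERIV_pos_inc_right[OF f x(3)] by blast
  define h where "h = min (d / 2) (t - x)"
  have h: "0 < h" "h < d" "x + h \<le> t" using d(1) x(2) by (auto simp: h_def min_def)
  have "f s \<le> f x" using x(1) by (intro mono) simp
  also have "\<dots> < f (x + h)" using d(2) h by blast
  also have "\<dots> \<le> f t" by (rule mono[OF h(3)])
  finally show ?thesis .
qed

lemma increment_bound:
  assumes f: "\<And>x. (f has_field_derivative f' x) (at (x::real))" and b: "\<And>x. a \<le> x \<Longrightarrow> x \<le> c \<Longrightarrow> \<bar>f' x\<bar> \<le> K" and "a \<le> c"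
  shows "\<bar>f c - f a\<bar> \<le> (c - a) * K"
proof (cases "a = c")
  case False
  then have "a < c" using assms(3) by simp
  then have "\<exists>z>a. z < c \<and> f c - f a = (c - a) * f' z" by (rule MVT2) (rule f)
  then obtain z where z: "a < z" "z < c" "f c - f a = (c - a) * f' z" by blast
  then have "\<bar>f c - f a\<bar> = (c - a) * \<bar>f' z\<bar>" by (simp add: abs_mult)
  also have "\<dots> \<le> (c - a) * K" using b[of z] z by (intro mult_left_mono) auto
  finally show ?thesis .
qed simp

lemma C1_diff:
  assumes "C1 f a b" "C1 g c d"
  shows "C1 (\<lambda>z. f z - g z) (\<lambda>z. a z - c z) (\<lambda>z. b z - d z)"
  using C1_add[OF assms(1) C1_cmult[OF assms(2), of "- 1"]] by simp

text \<open>The rules for \<open>C1\<close> compute partial derivatives by resolution; this rule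
  then replaces them by the intended formulas, leaving only algebraic identities.\<close>

lemma C1_cong:
  assumes "C1 f a b" "\<And>z. f' z = f z" "\<And>z. a' z = a z" "\<And>z. b' z = b z"
  shows "C1 f' a' b'"
proof -
  have "f' = f" "a' = a" "b' = b" using assms by auto
  then show ?thesis using assms(1) by simp
qed

lemma C1_fst:
  assumes "\<And>x. (f has_field_derivative f' x) (at x)" "continuous_on UNIV f'"
  shows "C1 (\<lambda>z. f (z$1)) (\<lambda>z. f' (z$1)) (\<lambda>_. 0)"
  using C1_compose[OF C1_nth(1) assms(1)] continuous_on_compose2[OF assms(2), of UNIV "\<lambda>z. z$1"]
  by (simp add: continuous_on_component)

lemma C1_snd:
  assumes "\<And>x. (f has_field_derivative f' x) (at x)" "continuous_on UNIV f'"
  shows "C1 (\<lambda>z. f (z$2)) (\<lambda>_. 0) (\<lambda>z. f' (z$2))"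
  using C1_compose[OF C1_nth(2) assms(1)] continuous_on_compose2[OF assms(2), of UNIV "\<lambda>z. z$2"]
  by (simp add: continuous_on_component)

lemma DERIV_scaled:
  assumes "\<And>x. (f has_field_derivative f' x) (at x)"
  shows "((\<lambda>x. f (x / c)) has_field_derivative f' (x / c) / c) (at (x::real))"
proof -
  have "((\<lambda>x. x / c) has_field_derivative 1 / c) (at x)"
    using DERIV_cdivide[OF DERIV_ident] .
  from DERIV_chain2[OF assms this] show ?thesis by simp
qed

lemma continuous_on_scaled:
  fixes f :: "real \<Rightarrow> real"
  assumes "continuous_on UNIV f"
  shows "continuous_on UNIV (\<lambda>x. f (x / c))"
proof -
  have "continuous_on UNIV (\<lambda>x::real. x * inverse c)" by (intro continuous_on_mult continuous_on_id continuous_on_const)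
  from continuous_on_compose2[OF assms this] show ?thesis by (simp add: divide_inverse)
qed

lemma continuous_on_\<theta>: "continuous_on UNIV \<theta>" "continuous_on UNIV \<theta>'"
  using \<theta>_derivative \<theta>'_derivative by (auto intro: DERIV_continuous_on_UNIV)

text \<open>Up to constant factors \<open>g\<close> is \<open>min 1 (rough x)\<close> and
  \<open>\<nu>\<close> is \<open>\<theta> ^ 4\<close>, normalised so that \<open>g - 1\<close> and
  \<open>\<nu> - 1\<close> have compactly supported double primitives \<open>P\<close> and
  \<open>Q\<close>. In \<open>small_w\<close> the factor 10 ^ 10 is the bound for \<open>G''\<close>
  and 16 M is twice the constant of \<open>D_ge\<close>; \<open>small_l\<close> makes the window
  term small after the vertical scaling has cost 1 / w^2.\<close>

locale profile =
  fixes g P P1 R \<nu> Q Q1 :: "real \<Rightarrow> real" and M N l w :: real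
  assumes cont_g: "continuous_on UNIV g" and M: "1 \<le> M"
    and g_ge: "\<And>x. min 1 (rough x) \<le> g x" and g_le: "\<And>x. g x \<le> M * min 1 (rough x)"
    and P: "\<And>x. (P has_field_derivative P1 x) (at x)" and P1: "\<And>x. (P1 has_field_derivative g x - 1) (at x)"
    and R: "\<And>x. (R has_field_derivative P x) (at x)"
    and P_out: "\<And>x. 4 \<le> \<bar>x\<bar> \<Longrightarrow> P x = 0" and P_bound: "\<And>x. \<bar>P x\<bar> \<le> M"
    and cont_\<nu>: "continuous_on UNIV \<nu>" and N: "1 \<le> N"
    and \<nu>_ge: "\<And>x. \<theta> x ^ 4 \<le> \<nu> x" and \<nu>_le: "\<And>x. \<nu> x \<le> N * \<theta> x ^ 4"
    and Q: "\<And>x. (Q has_field_derivative Q1 x) (at x)" and Q1: "\<And>x. (Q1 has_field_derivative \<nu> x - 1) (at x)"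
    and Q_out: "\<And>x. 4 \<le> \<bar>x\<bar> \<Longrightarrow> Q x = 0" and Q_bound: "\<And>x. \<bar>Q x\<bar> \<le> N"
    and l: "0 < l" "l \<le> 1/10" and w: "0 < w" "w \<le> 1/10"
    and small_w: "16 * 10 ^ 10 * M * N * w\<^sup>2 \<le> 1"
    and small_l: "160 * 10 ^ 12 * M * l\<^sup>2 \<le> w\<^sup>2"
begin

text \<open>Squaring \<open>\<theta>\<close> gives \<open>rad'^2 = O(rad)\<close> with
  \<open>rad''\<close> bounded, as the chain rule for the window term requires; the factor 1/2 makes
  the largest radius 1/2, where \<open>k\<close> vanishes.\<close>

definition rad :: "real \<Rightarrow> real" where "rad y = \<theta> (y / w) ^ 2 / 2"
definition rad' :: "real \<Rightarrow> real" where "rad' y = \<theta> (y / w) * \<theta>' (y / w) / w"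
definition rad'' :: "real \<Rightarrow> real" where "rad'' y = (\<theta>' (y / w) ^ 2 + \<theta> (y / w) * \<theta>'' (y / w)) / w\<^sup>2"
text \<open>\<open>1 - G\<close> is the part of \<open>- v_yy\<close> that survives where \<open>\<nu>\<close> vanishes. It has to be positive wherever \<open>g > 0\<close>
  (otherwise the Monge-Ampere density would vanish on a set of positive measure), to equal 1 for large \<open>x\<close>, and
  to satisfy \<open>\<bar>G''\<bar> \<le> C g\<close>; the factor \<open>l\<^sup>2\<close> makes the last bound uniform in \<open>l\<close>.\<close>

definition G :: "real \<Rightarrow> real" where "G x = cutoff x * (1 - l\<^sup>2 * \<theta> (x / l))"
definition G' :: "real \<Rightarrow> real" where
  "G' x = cutoff' x * (1 - l\<^sup>2 * \<theta> (x / l)) + - (l * \<theta>' (x / l)) * cutoff x"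
definition G'' :: "real \<Rightarrow> real" where
  "G'' x = cutoff'' x * (1 - l\<^sup>2 * \<theta> (x / l)) + - (l * \<theta>' (x / l)) * cutoff' x
     + (- \<theta>'' (x / l) * cutoff x + cutoff' x * - (l * \<theta>' (x / l)))"
text \<open>Chosen with \<open>S'' = \<nu> (y / w) - 1\<close>, so that \<open>1 + G S''\<close> is
  the convex combination \<open>(1 - G) + G \<nu>\<close>. While \<open>S''\<close> is not small,
  \<open>S\<close> itself is O(w^2).\<close>

definition S :: "real \<Rightarrow> real" where "S y = w\<^sup>2 * Q (y / w)"
definition S' :: "real \<Rightarrow> real" where "S' y = w * Q1 (y / w)"
definition S'' :: "real \<Rightarrow> real" where "S'' y = \<nu> (y / w) - 1"

lemma rad_derivative: "(rad has_field_derivative rad' y) (at y)"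
proof -
  have "((\<lambda>y. \<theta> (y / w) * \<theta> (y / w) / 2) has_field_derivative
     (\<theta>' (y / w) / w * \<theta> (y / w) + \<theta>' (y / w) / w * \<theta> (y / w)) / 2) (at y)"
    by (intro DERIV_cdivide DERIV_mult DERIV_scaled[OF \<theta>_derivative])
  then show ?thesis unfolding rad_def[abs_def] rad'_def power2_eq_square
    by (rule DERIV_cong) (simp add: mult_ac)
qed

lemma rad'_derivative: "(rad' has_field_derivative rad'' y) (at y)"
proof -
  have "((\<lambda>y. \<theta> (y / w) * \<theta>' (y / w) / w) has_field_derivative
     (\<theta>' (y / w) / w * \<theta>' (y / w) + \<theta>'' (y / w) / w * \<theta> (y / w)) / w) (at y)"
    by (intro DERIV_cdivide DERIV_mult DERIV_scaled[OF \<theta>_derivative] DERIV_scaled[OF \<theta>'_derivative])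
  then show ?thesis unfolding rad'_def[abs_def] rad''_def
    by (rule DERIV_cong) (simp add: power2_eq_square add_divide_distrib mult_ac)
qed

lemma continuous_on_rad'': "continuous_on UNIV rad''"
  unfolding rad''_def[abs_def]
  using w by (intro continuous_on_divide continuous_on_add continuous_on_mult continuous_on_power continuous_on_const
    continuous_on_scaled[OF continuous_on_\<theta>(1)] continuous_on_scaled[OF continuous_on_\<theta>(2)]
    continuous_on_scaled[OF continuous_on_\<theta>'']) auto

lemma inner_G_derivative: "((\<lambda>x. 1 - l\<^sup>2 * \<theta> (x / l)) has_field_derivative - (l * \<theta>' (x / l))) (at x)"
proof -
  have "((\<lambda>x. 1 - l\<^sup>2 * \<theta> (x / l)) has_field_derivative 0 - l\<^sup>2 * (\<theta>' (x / l) / l)) (at x)"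
    by (intro DERIV_diff DERIV_const DERIV_cmult DERIV_scaled[OF \<theta>_derivative])
  then show ?thesis using l by (simp add: power2_eq_square)
qed

lemma inner_G'_derivative: "((\<lambda>x. - (l * \<theta>' (x / l))) has_field_derivative - \<theta>'' (x / l)) (at x)"
proof -
  have "((\<lambda>x. - (l * \<theta>' (x / l))) has_field_derivative - (l * (\<theta>'' (x / l) / l))) (at x)"
    by (intro DERIV_minus DERIV_cmult DERIV_scaled[OF \<theta>'_derivative])
  then show ?thesis using l by simp
qed

lemma G_derivative: "(G has_field_derivative G' x) (at x)"
  unfolding G_def[abs_def] G'_def by (intro DERIV_mult cutoff_derivative inner_G_derivative)

lemma G'_derivative: "(G' has_field_derivative G'' x) (at x)"
  unfolding G'_def[abs_def] G''_def
  by (intro DERIV_add DERIV_mult cutoff_derivative cutoff'_derivative inner_G_derivative inner_G'_derivative)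

lemma continuous_on_G'': "continuous_on UNIV G''"
  unfolding G''_def[abs_def]
  by (intro continuous_on_add continuous_on_mult continuous_on_minus continuous_on_diff continuous_on_const
    continuous_on_scaled[OF continuous_on_\<theta>(1)] continuous_on_scaled[OF continuous_on_\<theta>(2)]
    continuous_on_scaled[OF continuous_on_\<theta>''] continuous_on_cutoff''
    DERIV_continuous_on_UNIV[OF cutoff_derivative] DERIV_continuous_on_UNIV[OF cutoff'_derivative])

lemma S_derivative: "(S has_field_derivative S' y) (at y)"
proof -
  have "((\<lambda>y. w\<^sup>2 * Q (y / w)) has_field_derivative w\<^sup>2 * (Q1 (y / w) / w)) (at y)"
    by (intro DERIV_cmult DERIV_scaled[OF Q])
  then show ?thesis unfolding S_def[abs_def] S'_def
    by (rule DERIV_cong) (use w in \<open>simp add: power2_eq_square\<close>)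
qed

lemma S'_derivative: "(S' has_field_derivative S'' y) (at y)"
proof -
  have "((\<lambda>y. w * Q1 (y / w)) has_field_derivative w * ((\<nu> (y / w) - 1) / w)) (at y)"
    by (intro DERIV_cmult DERIV_scaled[where f = Q1 and f' = "\<lambda>x. \<nu> x - 1", OF Q1])
  then show ?thesis unfolding S'_def[abs_def] S''_def by (rule DERIV_cong) (use w in simp)
qed

lemma continuous_on_S'': "continuous_on UNIV S''"
  unfolding S''_def[abs_def] by (intro continuous_on_diff continuous_on_scaled[OF cont_\<nu>] continuous_on_const)

text \<open>\<open>B q r\<close> averages \<open>P\<close> over the window of radius \<open>r\<close>; the weight \<open>1 - 2r\<close> of \<open>P q\<close> cancels the first-order term of
  the average, so that \<open>Br = O(r\<^sup>2)\<close>. The factor \<open>k\<close> switches the correction off at the maximal radius \<open>r = 1/2\<close>,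
  and differs from 1 only by \<open>O(r\<^sup>3)\<close>.\<close>

definition k :: "real \<Rightarrow> real" where "k r = 1 - 8 * r ^ 3"
definition B :: "real \<Rightarrow> real \<Rightarrow> real" where "B q r = (1 - 2 * r) * P q + (R (q + r) - R (q - r))"
definition Bq :: "real \<Rightarrow> real \<Rightarrow> real" where "Bq q r = (1 - 2 * r) * P1 q + (P (q + r) - P (q - r))"
definition Bqq :: "real \<Rightarrow> real \<Rightarrow> real" where "Bqq q r = (1 - 2 * r) * (g q - 1) + (P1 (q + r) - P1 (q - r))"
definition Br :: "real \<Rightarrow> real \<Rightarrow> real" where "Br q r = P (q + r) + P (q - r) - 2 * P q"
definition Bqr :: "real \<Rightarrow> real \<Rightarrow> real" where "Bqr q r = P1 (q + r) + P1 (q - r) - 2 * P1 q"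
definition Brr :: "real \<Rightarrow> real \<Rightarrow> real" where "Brr q r = P1 (q + r) - P1 (q - r)"

abbreviation (input) qz :: "real^2 \<Rightarrow> real" where "qz z \<equiv> z$1 / l"
abbreviation (input) rz :: "real^2 \<Rightarrow> real" where "rz z \<equiv> rad (z$2)"

lemma C1_q: "C1 (\<lambda>z. qz z) (\<lambda>_. 1 / l) (\<lambda>_. 0)"
  by (rule C1_cong[OF C1_cmult[OF C1_nth(1), of "1 / l"]]) simp_all

lemma C1_r: "C1 (\<lambda>z. rz z) (\<lambda>_. 0) (\<lambda>z. rad' (z$2))"
  by (rule C1_snd[OF rad_derivative DERIV_continuous_on_UNIV[OF rad'_derivative]])

lemma C1_at:
  assumes f: "\<And>x. (f has_field_derivative f' x) (at x)" and c: "continuous_on UNIV f'"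
  shows "C1 (\<lambda>z. f (qz z)) (\<lambda>z. f' (qz z) / l) (\<lambda>_. 0)"
    "C1 (\<lambda>z. f (qz z + rz z)) (\<lambda>z. f' (qz z + rz z) / l) (\<lambda>z. f' (qz z + rz z) * rad' (z$2))"
    "C1 (\<lambda>z. f (qz z - rz z)) (\<lambda>z. f' (qz z - rz z) / l) (\<lambda>z. - f' (qz z - rz z) * rad' (z$2))"
proof -
  have *: "C1 (\<lambda>z. f (h z)) (\<lambda>z. f' (h z) * a z) (\<lambda>z. f' (h z) * b z)" if h: "C1 h a b" for h a b
    by (rule C1_compose[OF h f]) (rule continuous_on_compose2[OF c C1_D(4)[OF h] subset_UNIV])
  show "C1 (\<lambda>z. f (qz z)) (\<lambda>z. f' (qz z) / l) (\<lambda>_. 0)"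
    by (rule C1_cong[OF *[OF C1_q]]) simp_all
  show "C1 (\<lambda>z. f (qz z + rz z)) (\<lambda>z. f' (qz z + rz z) / l) (\<lambda>z. f' (qz z + rz z) * rad' (z$2))"
    by (rule C1_cong[OF *[OF C1_add[OF C1_q C1_r]]]) simp_all
  show "C1 (\<lambda>z. f (qz z - rz z)) (\<lambda>z. f' (qz z - rz z) / l) (\<lambda>z. - f' (qz z - rz z) * rad' (z$2))"
    by (rule C1_cong[OF *[OF C1_diff[OF C1_q C1_r]]]) simp_all
qed

lemma cont_P: "continuous_on UNIV P" "continuous_on UNIV P1" "continuous_on UNIV (\<lambda>x. g x - 1)"
  by (rule DERIV_continuous_on_UNIV[OF P], rule DERIV_continuous_on_UNIV[OF P1],
      intro continuous_on_diff cont_g continuous_on_const)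

lemmas C1_P = C1_at[OF P cont_P(2)]
lemmas C1_P1 = C1_at[where f = P1 and f' = "\<lambda>x. g x - 1", OF P1 cont_P(3)]
lemmas C1_R = C1_at[OF R cont_P(1)]

lemma C1_1_2r: "C1 (\<lambda>z. 1 - 2 * rz z) (\<lambda>_. 0) (\<lambda>z. - 2 * rad' (z$2))"
  by (rule C1_cong[OF C1_diff[OF C1_const[of 1] C1_cmult[OF C1_r, of 2]]]) simp_all

lemma C1_B: "C1 (\<lambda>z. B (qz z) (rz z)) (\<lambda>z. Bq (qz z) (rz z) / l) (\<lambda>z. Br (qz z) (rz z) * rad' (z$2))"
  unfolding B_def
  by (rule C1_cong[OF C1_add[OF C1_mult[OF C1_1_2r C1_P(1)] C1_diff[OF C1_R(2,3)]]])
    (simp_all add: Bq_def Br_def add_divide_distrib diff_divide_distrib algebra_simps)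

lemma C1_Bq: "C1 (\<lambda>z. Bq (qz z) (rz z)) (\<lambda>z. Bqq (qz z) (rz z) / l) (\<lambda>z. Bqr (qz z) (rz z) * rad' (z$2))"
  unfolding Bq_def
  by (rule C1_cong[OF C1_add[OF C1_mult[OF C1_1_2r C1_P1(1)] C1_diff[OF C1_P(2,3)]]])
    (simp_all add: Bqq_def Bqr_def add_divide_distrib diff_divide_distrib algebra_simps)

lemma C1_Br: "C1 (\<lambda>z. Br (qz z) (rz z)) (\<lambda>z. Bqr (qz z) (rz z) / l) (\<lambda>z. Brr (qz z) (rz z) * rad' (z$2))"
  unfolding Br_def
  by (rule C1_cong[OF C1_diff[OF C1_add[OF C1_P(2,3)] C1_cmult[OF C1_P(1), of 2]]])
    (simp_all add: Bqr_def Brr_def add_divide_distrib diff_divide_distrib algebra_simps)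

lemma C1_r2: "C1 (\<lambda>z. - 24 * (rz z)\<^sup>2) (\<lambda>_. 0) (\<lambda>z. - 48 * rz z * rad' (z$2))"
  unfolding power2_eq_square
  by (rule C1_cong[OF C1_cmult[OF C1_mult[OF C1_r C1_r], of "- 24"]]) simp_all

lemma C1_k: "C1 (\<lambda>z. k (rz z)) (\<lambda>_. 0) (\<lambda>z. - 24 * (rz z)\<^sup>2 * rad' (z$2))"
  unfolding k_def power3_eq_cube power2_eq_square
  by (rule C1_cong[OF C1_diff[OF C1_const[of 1] C1_cmult[OF C1_mult[OF C1_mult[OF C1_r C1_r] C1_r], of 8]]]) simp_all

definition Wr :: "real \<Rightarrow> real \<Rightarrow> real" where "Wr q r = - 24 * r\<^sup>2 * B q r + k r * Br q r"
definition Wqr :: "real \<Rightarrow> real \<Rightarrow> real" where "Wqr q r = - 24 * r\<^sup>2 * Bq q r + k r * Bqr q r"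
definition Wrr :: "real \<Rightarrow> real \<Rightarrow> real" where
  "Wrr q r = - 48 * r * B q r + - 24 * r\<^sup>2 * Br q r + (- 24 * r\<^sup>2 * Br q r + k r * Brr q r)"

lemma C1_W: "C1 (\<lambda>z. k (rz z) * B (qz z) (rz z)) (\<lambda>z. k (rz z) * Bq (qz z) (rz z) / l) (\<lambda>z. Wr (qz z) (rz z) * rad' (z$2))"
  by (rule C1_cong[OF C1_mult[OF C1_k C1_B]]) (simp_all add: Wr_def algebra_simps)

lemma C1_Wq: "C1 (\<lambda>z. k (rz z) * Bq (qz z) (rz z)) (\<lambda>z. k (rz z) * Bqq (qz z) (rz z) / l) (\<lambda>z. Wqr (qz z) (rz z) * rad' (z$2))"
  by (rule C1_cong[OF C1_mult[OF C1_k C1_Bq]]) (simp_all add: Wqr_def algebra_simps)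

lemma C1_Wr: "C1 (\<lambda>z. Wr (qz z) (rz z)) (\<lambda>z. Wqr (qz z) (rz z) / l) (\<lambda>z. Wrr (qz z) (rz z) * rad' (z$2))"
  unfolding Wr_def
  by (rule C1_cong[OF C1_add[OF C1_mult[OF C1_r2 C1_B] C1_mult[OF C1_k C1_Br]]])
    (simp_all add: Wqr_def Wrr_def add_divide_distrib diff_divide_distrib algebra_simps)

text \<open>The factor \<open>l^2\<close> compensates the two x-derivatives of the window term,
  which contributes \<open>k Bqq\<close> to \<open>vxx\<close> at full size but only O(l^2) to
  \<open>vyy\<close>. The last term has the opposite character: full size in \<open>vyy\<close>,
  O(w^2) in \<open>vxx\<close>.\<close>

definition v :: "real^2 \<Rightarrow> real" where
  "v z = ((z$1)\<^sup>2 - (z$2)\<^sup>2 + 1) / 2 + l\<^sup>2 * (k (rz z) * B (qz z) (rz z)) - G (z$1) * S (z$2)"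
definition vx :: "real^2 \<Rightarrow> real" where
  "vx z = z$1 + l * (k (rz z) * Bq (qz z) (rz z)) - G' (z$1) * S (z$2)"
definition vy :: "real^2 \<Rightarrow> real" where
  "vy z = - (z$2) + l\<^sup>2 * (Wr (qz z) (rz z) * rad' (z$2)) - G (z$1) * S' (z$2)"
definition vxx :: "real^2 \<Rightarrow> real" where
  "vxx z = 1 + k (rz z) * Bqq (qz z) (rz z) - G'' (z$1) * S (z$2)"
definition vxy :: "real^2 \<Rightarrow> real" where
  "vxy z = l * (Wqr (qz z) (rz z) * rad' (z$2)) - G' (z$1) * S' (z$2)"
definition vyy :: "real^2 \<Rightarrow> real" where
  "vyy z = - 1 + l\<^sup>2 * (Wrr (qz z) (rz z) * rad' (z$2) * rad' (z$2) + Wr (qz z) (rz z) * rad'' (z$2)) - G (z$1) * S'' (z$2)"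

lemmas C1_G = C1_fst[OF G_derivative DERIV_continuous_on_UNIV[OF G'_derivative]]
lemmas C1_G' = C1_fst[OF G'_derivative continuous_on_G'']
lemmas C1_S = C1_snd[OF S_derivative DERIV_continuous_on_UNIV[OF S'_derivative]]
lemmas C1_S' = C1_snd[OF S'_derivative continuous_on_S'']

lemma C1_quadratic: "C1 (\<lambda>z. ((z$1)\<^sup>2 - (z$2)\<^sup>2 + 1) / 2) (\<lambda>z. z$1) (\<lambda>z. - (z$2))"
  by (rule C1_cong[OF C1_add[OF C1_diff[OF C1_cmult[OF C1_mult[OF C1_nth(1) C1_nth(1)], of "1/2"]
        C1_cmult[OF C1_mult[OF C1_nth(2) C1_nth(2)], of "1/2"]] C1_const[of "1/2"]]])
    (simp_all add: power2_eq_square add_divide_distrib diff_divide_distrib)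

lemma C1_v: "C1 v vx vy"
  by (rule C1_cong[OF C1_diff[OF C1_add[OF C1_quadratic C1_cmult[OF C1_W, of "l\<^sup>2"]] C1_mult[OF C1_G C1_S]]])
    (use l in \<open>simp_all add: v_def vx_def vy_def power2_eq_square\<close>)

lemma C1_vx: "C1 vx vxx vxy"
  by (rule C1_cong[OF C1_diff[OF C1_add[OF C1_nth(1) C1_cmult[OF C1_Wq, of l]] C1_mult[OF C1_G' C1_S]]])
    (use l in \<open>simp_all add: vx_def vxx_def vxy_def\<close>)

lemma C1_vy: "C1 vy vxy vyy"
  by (rule C1_cong[OF C1_diff[OF C1_add[OF C1_cmult[OF C1_nth(2), of "- 1"]
        C1_cmult[OF C1_mult[OF C1_Wr C1_snd[OF rad'_derivative continuous_on_rad'']], of "l\<^sup>2"]] C1_mult[OF C1_G C1_S']]])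
    (use l in \<open>simp_all add: vy_def vxy_def vyy_def power2_eq_square\<close>)

end

section \<open>Comparison of \<open>vxx\<close> and \<open>- vyy\<close> with explicit model
  quantities\<close>

context profile
begin

abbreviation (input) C0 :: real where "C0 \<equiv> 2 ^ 19 * 6400"

lemma g_bounds: "0 \<le> g x" "g x \<le> M" "\<bar>g x - 1\<bar> \<le> M"
proof -
  show 0: "0 \<le> g x" using g_ge[of x] rough_nonneg[of x] by (simp add: min_def split: if_splits)
  have "M * min 1 (rough x) \<le> M * 1" using M by (intro mult_left_mono) auto
  then show 1: "g x \<le> M" using g_le[of x] by simp
  show "\<bar>g x - 1\<bar> \<le> M" using 0 1 M by (auto simp: abs_if)
qed

lemma g_eq_0: "rough x = 0 \<Longrightarrow> g x = 0"
  using g_le[of x] g_bounds(1)[of x] by simp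

lemma g_outer: "2 \<le> \<bar>x\<bar> \<Longrightarrow> 1 \<le> g x"
  using g_ge[of x] outer_large(1)[of x] by simp

text \<open>The function \<open>P1 x + x\<close> is a primitive of \<open>g\<close>, so the
  right-hand side is the integral of \<open>g\<close> over the window.\<close>

lemma window:
  assumes "0 < r" "r \<le> 1/2"
  shows "r\<^sup>2 / C0 \<le> P1 (q + r) - P1 (q - r) + 2 * r"
proof -
  have "r\<^sup>2 / C0 \<le> (\<lambda>x. P1 x + x) (q + r) - (\<lambda>x. P1 x + x) (q - r)"
  proof (rule rough0_window[OF _ _ assms])
    show "((\<lambda>x. P1 x + x) has_field_derivative g x) (at x)" for x
      using DERIV_add[OF P1 DERIV_ident, of x] by simp
    show "rough0 x \<le> g x" for x
      using g_ge[of x] rough0_bounds[of x] m1_nonneg[of x] by (simp add: rough_def min_def split: if_splits)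
  qed
  then show ?thesis by simp
qed

lemma rad_bounds: "0 \<le> rad y" "rad y \<le> 1/2" "4 * (rad y)\<^sup>2 = \<theta> (y / w) ^ 4"
proof -
  have "\<theta> (y / w) ^ 2 \<le> 1" using \<theta>_bounds[of "y / w"] by (intro power_le_one)
  then show "0 \<le> rad y" "rad y \<le> 1/2" by (simp_all add: rad_def)
  have "(\<theta> (y / w) ^ 2)\<^sup>2 = \<theta> (y / w) ^ 4" by (simp flip: power_mult)
  then show "4 * (rad y)\<^sup>2 = \<theta> (y / w) ^ 4" by (simp add: rad_def power_divide)
qed

context
  fixes r :: real
  assumes r: "0 \<le> r" "r \<le> 1/2"
begin

lemma k_bounds: "0 \<le> k r" "k r \<le> 1"
proof -
  have "r ^ 3 \<le> (1/2) ^ 3" using r by (intro power_mono)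
  then show "0 \<le> k r" by (simp add: k_def power_divide)
  show "k r \<le> 1" using r by (simp add: k_def)
qed

lemma B_bound: "\<bar>B q r\<bar> \<le> M"
proof -
  have "\<bar>R (q + r) - R (q - r)\<bar> \<le> (q + r - (q - r)) * M"
    by (rule increment_bound[OF R P_bound]) (use r in simp)
  then have 1: "\<bar>R (q + r) - R (q - r)\<bar> \<le> 2 * r * M" by simp
  have "\<bar>(1 - 2 * r) * P q\<bar> = (1 - 2 * r) * \<bar>P q\<bar>" using r by (simp add: abs_mult)
  also have "\<dots> \<le> (1 - 2 * r) * M" using r P_bound by (intro mult_left_mono) auto
  finally have "\<bar>B q r\<bar> \<le> (1 - 2 * r) * M + 2 * r * M"
    unfolding B_def using 1 by (intro order_trans[OF abs_triangle_ineq] add_mono)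
  then show ?thesis by (simp add: algebra_simps)
qed

lemma Brr_bound: "\<bar>Brr q r\<bar> \<le> 2 * r * M"
proof -
  have "\<bar>P1 (q + r) - P1 (q - r)\<bar> \<le> (q + r - (q - r)) * M"
    by (rule increment_bound[where f' = "\<lambda>x. g x - 1", OF P1 g_bounds(3)]) (use r in simp)
  then show ?thesis by (simp add: Brr_def)
qed

end

text \<open>\<open>Br q r\<close> is the centred second difference of \<open>P\<close>: it vanishes
  at r = 0, and its derivative in r is O(r).\<close>

lemma Br_bound:
  assumes r: "0 \<le> r" "r \<le> 1/2"
  shows "\<bar>Br q r\<bar> \<le> 2 * M * r\<^sup>2"
proof -
  have d: "(Br q has_field_derivative Brr q s) (at s)" for s
  proof -
    have "((\<lambda>s. q + s) has_field_derivative 1) (at s)" "((\<lambda>s. q - s) has_field_derivative - 1) (at s)"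
      by (auto intro!: derivative_eq_intros)
    from DERIV_add[OF DERIV_chain2[OF P this(1)] DERIV_chain2[OF P this(2)]]
    have "((\<lambda>s. P (q + s) + P (q - s) - 2 * P q) has_field_derivative P1 (q + s) * 1 + P1 (q - s) * - 1 - 0) (at s)"
      by (rule DERIV_diff) (rule DERIV_const)
    then show ?thesis unfolding Br_def[abs_def] Brr_def by simp
  qed
  have "\<bar>Br q r - Br q 0\<bar> \<le> (r - 0) * (2 * r * M)"
  proof (rule increment_bound[OF d])
    fix s assume s: "0 \<le> s" "s \<le> r"
    have "\<bar>Brr q s\<bar> \<le> 2 * s * M" by (rule Brr_bound) (use s r in auto)
    also have "\<dots> \<le> 2 * r * M" using s M by (intro mult_right_mono) auto
    finally show "\<bar>Brr q s\<bar> \<le> 2 * r * M" .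
  qed (use r in simp)
  moreover have "Br q 0 = 0" by (simp add: Br_def)
  ultimately show ?thesis by (simp add: power2_eq_square mult_ac)
qed

lemma Wr_bound:
  assumes r: "0 \<le> r" "r \<le> 1/2"
  shows "\<bar>Wr q r\<bar> \<le> 26 * M * r\<^sup>2"
proof -
  have "\<bar>- 24 * r\<^sup>2 * B q r\<bar> = 24 * r\<^sup>2 * \<bar>B q r\<bar>" by (simp add: abs_mult)
  also have "\<dots> \<le> 24 * r\<^sup>2 * M" by (intro mult_left_mono B_bound r) simp
  finally have 1: "\<bar>- 24 * r\<^sup>2 * B q r\<bar> \<le> 24 * r\<^sup>2 * M" .
  have "\<bar>k r * Br q r\<bar> \<le> 1 * (2 * M * r\<^sup>2)"
    unfolding abs_mult using k_bounds[OF r] Br_bound[OF r] by (intro mult_mono) auto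
  then have "\<bar>Wr q r\<bar> \<le> 24 * r\<^sup>2 * M + 1 * (2 * M * r\<^sup>2)"
    unfolding Wr_def using 1 by (intro order_trans[OF abs_triangle_ineq] add_mono)
  then show ?thesis by simp
qed

lemma Wrr_bound:
  assumes r: "0 \<le> r" "r \<le> 1/2"
  shows "\<bar>Wrr q r\<bar> \<le> 62 * M * r"
proof -
  have "\<bar>- 48 * r * B q r\<bar> = 48 * r * \<bar>B q r\<bar>" using r by (simp add: abs_mult)
  also have "\<dots> \<le> 48 * r * M" using r by (intro mult_left_mono B_bound) auto
  finally have 1: "\<bar>- 48 * r * B q r\<bar> \<le> 48 * r * M" .
  have "r * r\<^sup>2 \<le> 1/2 * (1/2)\<^sup>2" using r by (intro mult_mono power_mono) auto
  then have r3: "r ^ 3 \<le> 1/8" by (simp add: power2_eq_square power3_eq_cube)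
  have "\<bar>- 24 * r\<^sup>2 * Br q r\<bar> = 24 * r\<^sup>2 * \<bar>Br q r\<bar>" by (simp add: abs_mult)
  also have "\<dots> \<le> 24 * r\<^sup>2 * (2 * M * r\<^sup>2)" by (intro mult_left_mono Br_bound r) simp
  also have "\<dots> = 48 * M * r * r ^ 3" by (simp add: power2_eq_square power3_eq_cube)
  also have "\<dots> \<le> 48 * M * r * (1/8)" using r3 r M by (intro mult_left_mono) auto
  finally have 2: "\<bar>- 24 * r\<^sup>2 * Br q r\<bar> \<le> 6 * M * r" by simp
  have 3: "\<bar>k r * Brr q r\<bar> \<le> 1 * (2 * r * M)"
    unfolding abs_mult using k_bounds[OF r] Brr_bound[OF r] by (intro mult_mono) auto
  have "\<bar>Wrr q r\<bar> \<le> (48 * r * M + 6 * M * r) + (6 * M * r + 1 * (2 * r * M))"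
    unfolding Wrr_def by (intro order_trans[OF abs_triangle_ineq] add_mono 1 2 3)
  then show ?thesis by simp
qed

definition D :: "real \<Rightarrow> real \<Rightarrow> real" where "D q r = 1 + k r * Bqq q r"

text \<open>\<open>D\<close> is \<open>8 r^3 + k ((1 - 2 r) g + window integral of g)\<close>, a sum
  of nonnegative terms. For r at least 1/4 the cubic term gives both bounds; for smaller r the
  factor \<open>k\<close> is at least 7/8, and the window integral and \<open>g\<close> itself give
  one bound each. The bound in r^2 serves \<open>\<nu>\<close>, the bound in \<open>g\<close> serves
  \<open>1 - G\<close> and \<open>G''\<close>.\<close>

lemma D_ge:
  assumes r: "0 \<le> r" "r \<le> 1/2"
  shows "r\<^sup>2 / (2 * C0) \<le> D q r" "g q / (8 * M) \<le> D q r"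
proof -
  define win where "win = P1 (q + r) - P1 (q - r) + 2 * r"
  have D: "D q r = 8 * r ^ 3 + k r * ((1 - 2 * r) * g q) + k r * win"
    by (simp add: D_def Bqq_def win_def k_def algebra_simps)
  have win: "r\<^sup>2 / C0 \<le> win"
  proof (cases "r = 0")
    case False
    then show ?thesis using window[of r q] r by (simp add: win_def)
  qed (simp add: win_def)
  have "0 \<le> r\<^sup>2 / C0" by simp
  then have win0: "0 \<le> win" using win by linarith
  have g: "0 \<le> g q" "g q \<le> M" by (rule g_bounds)+
  have "1 * g q \<le> M * g q" using g(1) M by (intro mult_right_mono) auto
  then have gM: "g q / (8 * M) \<le> 1/8" "g q / (8 * M) \<le> g q / 8"
    using g M by (simp_all add: field_simps)
  have pos: "0 \<le> k r * ((1 - 2 * r) * g q)" "0 \<le> k r * win" "0 \<le> 8 * r ^ 3"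
    using k_bounds[OF r] g(1) r win0 by simp_all
  have "r\<^sup>2 / (2 * C0) \<le> D q r \<and> g q / (8 * M) \<le> D q r"
  proof (cases "1/4 \<le> r")
    case True
    have "(1/4) * r\<^sup>2 \<le> r * r\<^sup>2" using True by (intro mult_right_mono) auto
    then have a: "2 * r\<^sup>2 \<le> 8 * r ^ 3" by (simp add: power2_eq_square power3_eq_cube)
    have "(1/4)\<^sup>2 \<le> r\<^sup>2" using True by (intro power_mono) auto
    then have b: "1/8 \<le> 2 * r\<^sup>2" by (simp add: power2_eq_square)
    have "r\<^sup>2 / (2 * C0) \<le> 2 * r\<^sup>2" by simp
    then have "r\<^sup>2 / (2 * C0) \<le> 8 * r ^ 3" "g q / (8 * M) \<le> 8 * r ^ 3" using a b gM(1) by (meson order_trans)+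
    then show ?thesis unfolding D using pos by linarith
  next
    case False
    have "r ^ 3 \<le> (1/4) ^ 3" using False r by (intro power_mono) auto
    then have k: "7/8 \<le> k r" by (simp add: k_def power_divide)
    have "1/2 * win \<le> k r * win" using k win0 by (intro mult_right_mono) auto
    then have "r\<^sup>2 / (2 * C0) \<le> k r * win" using win by simp
    moreover have gq: "1/2 * g q \<le> (1 - 2 * r) * g q" using False g by (intro mult_right_mono) auto
    have "7/8 * (1/2 * g q) \<le> k r * ((1 - 2 * r) * g q)"
      by (rule mult_mono[OF k gq]) (use k_bounds[OF r] g in auto)
    then have "g q / (8 * M) \<le> k r * ((1 - 2 * r) * g q)" using gM(2) g(1) by simp
    ultimately show ?thesis unfolding D using pos by linarith
  qed
  then show "r\<^sup>2 / (2 * C0) \<le> D q r" "g q / (8 * M) \<le> D q r" by auto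
qed

lemma D_nonneg: "0 \<le> r \<Longrightarrow> r \<le> 1/2 \<Longrightarrow> 0 \<le> D q r"
  by (rule order_trans[OF _ D_ge(1)]) simp_all

lemma rad_derivative_bounds: "(rad' y)\<^sup>2 \<le> 2 * 10 ^ 12 * rad y / w\<^sup>2" "\<bar>rad'' y\<bar> \<le> 2 * 10 ^ 12 / w\<^sup>2"
proof -
  have t: "\<bar>\<theta>' (y / w)\<bar> \<le> 10 ^ 6" by (rule \<theta>_derivative_bounds)
  have t2: "\<theta>' (y / w) ^ 2 \<le> 10 ^ 12" using power_mono[OF t abs_ge_zero, of 2] by simp
  have "\<bar>\<theta>'' (y / w)\<bar> \<le> 10 ^ 6 * min 1 (rough (y / w))" by (rule \<theta>_derivative_bounds)
  also have "\<dots> \<le> 10 ^ 6 * 1" by (intro mult_left_mono) auto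
  finally have t3: "\<bar>\<theta>'' (y / w)\<bar> \<le> 10 ^ 6" by simp
  have "(\<theta> (y / w) * \<theta>' (y / w))\<^sup>2 \<le> \<theta> (y / w) ^ 2 * 10 ^ 12"
    unfolding power_mult_distrib using t2 by (intro mult_left_mono) auto
  also have "\<dots> = 2 * 10 ^ 12 * rad y" by (simp add: rad_def)
  finally have "(\<theta> (y / w) * \<theta>' (y / w))\<^sup>2 / w\<^sup>2 \<le> 2 * 10 ^ 12 * rad y / w\<^sup>2" by (rule divide_right_mono) simp
  then show "(rad' y)\<^sup>2 \<le> 2 * 10 ^ 12 * rad y / w\<^sup>2" by (simp add: rad'_def power_divide)
  have "\<bar>\<theta> (y / w) * \<theta>'' (y / w)\<bar> \<le> 1 * 10 ^ 6"
    unfolding abs_mult using \<theta>_bounds[of "y / w"] t3 by (intro mult_mono) auto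
  then have "\<bar>\<theta>' (y / w) ^ 2 + \<theta> (y / w) * \<theta>'' (y / w)\<bar> \<le> 10 ^ 12 + 1 * 10 ^ 6"
    using t2 by (intro order_trans[OF abs_triangle_ineq] add_mono) auto
  then have "\<bar>\<theta>' (y / w) ^ 2 + \<theta> (y / w) * \<theta>'' (y / w)\<bar> \<le> 2 * 10 ^ 12" by simp
  then have "\<bar>\<theta>' (y / w) ^ 2 + \<theta> (y / w) * \<theta>'' (y / w)\<bar> / w\<^sup>2 \<le> 2 * 10 ^ 12 / w\<^sup>2" by (rule divide_right_mono) simp
  then show "\<bar>rad'' y\<bar> \<le> 2 * 10 ^ 12 / w\<^sup>2" by (simp add: rad''_def)
qed

text \<open>The orders match: \<open>Wrr = O(r)\<close> meets \<open>rad'^2 = O(r / w^2)\<close>,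
  and \<open>Wr = O(r^2)\<close> meets \<open>rad'' = O(1 / w^2)\<close>. Both products are O(r^2 /
  w^2), where 4 r^2 is exactly \<open>\<theta> ^ 4\<close>.\<close>

lemma second_order_error:
  "\<bar>l\<^sup>2 * (Wrr q (rad y) * rad' y * rad' y + Wr q (rad y) * rad'' y)\<bar> \<le> \<theta> (y / w) ^ 4 / 2"
proof -
  let ?r = "rad y"
  note r = rad_bounds(1,2)[of y]
  have "\<bar>Wrr q ?r * rad' y * rad' y\<bar> = \<bar>Wrr q ?r\<bar> * (rad' y)\<^sup>2" by (simp add: abs_mult power2_eq_square)
  also have "\<dots> \<le> (62 * M * ?r) * (2 * 10 ^ 12 * ?r / w\<^sup>2)"
    using Wrr_bound[OF r] rad_derivative_bounds(1) r M by (intro mult_mono) auto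
  also have "\<dots> = 124 * 10 ^ 12 * M * ?r\<^sup>2 / w\<^sup>2" by (simp add: power2_eq_square)
  finally have 1: "\<bar>Wrr q ?r * rad' y * rad' y\<bar> \<le> 124 * 10 ^ 12 * M * ?r\<^sup>2 / w\<^sup>2" .
  have "\<bar>Wr q ?r * rad'' y\<bar> \<le> (26 * M * ?r\<^sup>2) * (2 * 10 ^ 12 / w\<^sup>2)"
    unfolding abs_mult using Wr_bound[OF r] rad_derivative_bounds(2) M by (intro mult_mono) auto
  also have "\<dots> = 52 * 10 ^ 12 * M * ?r\<^sup>2 / w\<^sup>2" by simp
  finally have 2: "\<bar>Wr q ?r * rad'' y\<bar> \<le> 52 * 10 ^ 12 * M * ?r\<^sup>2 / w\<^sup>2" .
  have "\<bar>Wrr q ?r * rad' y * rad' y + Wr q ?r * rad'' y\<bar>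
      \<le> 124 * 10 ^ 12 * M * ?r\<^sup>2 / w\<^sup>2 + 52 * 10 ^ 12 * M * ?r\<^sup>2 / w\<^sup>2"
    by (rule order_trans[OF abs_triangle_ineq add_mono[OF 1 2]])
  also have "\<dots> = 44 * 10 ^ 12 * M * (4 * ?r\<^sup>2) / w\<^sup>2" by (simp add: add_divide_distrib[symmetric])
  also have "\<dots> = 44 * 10 ^ 12 * M * \<theta> (y / w) ^ 4 / w\<^sup>2" by (simp only: rad_bounds(3))
  finally have "l\<^sup>2 * \<bar>Wrr q ?r * rad' y * rad' y + Wr q ?r * rad'' y\<bar> \<le> l\<^sup>2 * (44 * 10 ^ 12 * M * \<theta> (y / w) ^ 4 / w\<^sup>2)"
    by (rule mult_left_mono) simp
  also have "\<dots> = (44 * 10 ^ 12 * M * l\<^sup>2 / w\<^sup>2) * \<theta> (y / w) ^ 4" by simp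
  also have "\<dots> \<le> 1/2 * \<theta> (y / w) ^ 4"
  proof (rule mult_right_mono)
    have "44 * 10 ^ 12 * M * l\<^sup>2 \<le> 80 * 10 ^ 12 * M * l\<^sup>2" using M by (intro mult_right_mono) auto
    also have "\<dots> \<le> 1/2 * w\<^sup>2" using small_l by simp
    finally show "44 * 10 ^ 12 * M * l\<^sup>2 / w\<^sup>2 \<le> 1/2" using w by (simp add: pos_divide_le_eq)
  qed simp
  finally show ?thesis by (simp add: abs_mult)
qed

text \<open>In 28 = 27 + 1 the 27 comes from \<open>\<theta>_le\<close>. The 1 pays for
  \<open>cutoff\<close>, which differs from 1 only where \<open>\<bar>x\<bar>\<close> exceeds 1/4;
  there \<open>x / l\<close> is beyond 2 because \<open>l \<le> 1/10\<close>, so \<open>g\<close> is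
  at least 1.\<close>

lemma G_bounds: "0 \<le> G x" "G x \<le> 1" "1 - G x \<le> 28 * g (x / l)"
proof -
  let ?t = "l\<^sup>2 * \<theta> (x / l)"
  have l2: "l\<^sup>2 \<le> 1" using l by (intro power_le_one) auto
  have t: "0 \<le> ?t" "?t \<le> \<theta> (x / l)" using \<theta>_bounds[of "x / l"] l2 by (auto intro: mult_left_le_one_le)
  then have t1: "?t \<le> 1" using \<theta>_bounds(2)[of "x / l"] by simp
  note c = cutoff_bounds[of x]
  show "0 \<le> G x" unfolding G_def using c t1 by (intro mult_nonneg_nonneg) auto
  show "G x \<le> 1" unfolding G_def using c t t1 by (intro mult_le_one) auto
  have "cutoff x * ?t \<le> 1 * ?t" using c t by (intro mult_right_mono) auto
  then have "1 - G x \<le> (1 - cutoff x) + ?t" unfolding G_def by (simp add: right_diff_distrib)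
  also have "?t \<le> 27 * g (x / l)" using t(2) \<theta>_le[of "x / l"] g_ge[of "x / l"] by simp
  also have "1 - cutoff x \<le> g (x / l)"
  proof (cases "\<bar>x\<bar> \<le> 1/4")
    case True
    then show ?thesis using cutoff_inner(1)[OF True] g_bounds(1) by simp
  next
    case False
    have "2 * l \<le> \<bar>x\<bar>" using False l by simp
    then have "2 \<le> \<bar>x / l\<bar>" using l by (simp add: abs_divide pos_le_divide_eq)
    then show ?thesis using g_outer[of "x / l"] c by simp
  qed
  finally show "1 - G x \<le> 28 * g (x / l)" by simp
qed

text \<open>The second derivative of \<open>\<theta>\<close> carries the factor
  \<open>min 1 (rough x)\<close>, which \<open>g\<close> dominates. The first derivative comes
  without such a factor, but here it is always multiplied by \<open>cutoff'\<close>, which vanishes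
  unless \<open>g\<close> is at least 1.\<close>

lemma G''_bound: "\<bar>G'' x\<bar> \<le> 10 ^ 10 * g (x / l)"
proof -
  let ?g = "g (x / l)"
  have l2: "l\<^sup>2 \<le> 1" using l by (intro power_le_one) auto
  have t: "0 \<le> l\<^sup>2 * \<theta> (x / l)" "l\<^sup>2 * \<theta> (x / l) \<le> 1"
    using \<theta>_bounds[of "x / l"] l2 by (auto intro: mult_le_one)
  have c: "\<bar>cutoff' x\<bar> \<le> 3000 * ?g" "\<bar>cutoff'' x\<bar> \<le> 3000 * ?g"
  proof -
    have "\<bar>cutoff' x\<bar> \<le> 3000 * ?g \<and> \<bar>cutoff'' x\<bar> \<le> 3000 * ?g"
    proof (cases "\<bar>x\<bar> \<le> 1/4")
      case True
      then show ?thesis using cutoff_inner(2,3)[OF True] g_bounds(1) by simp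
    next
      case False
      have "2 * l \<le> \<bar>x\<bar>" using False l by simp
      then have "2 \<le> \<bar>x / l\<bar>" using l by (simp add: abs_divide pos_le_divide_eq)
      then have "3000 * 1 \<le> 3000 * ?g" using g_outer[of "x / l"] by (intro mult_left_mono) auto
      then show ?thesis using cutoff_derivative_bounds[of x] by simp
    qed
    then show "\<bar>cutoff' x\<bar> \<le> 3000 * ?g" "\<bar>cutoff'' x\<bar> \<le> 3000 * ?g" by auto
  qed
  have lt: "\<bar>l * \<theta>' (x / l)\<bar> \<le> 1 * 10 ^ 6"
    unfolding abs_mult using l \<theta>_derivative_bounds(1) by (intro mult_mono) auto
  have 1: "\<bar>cutoff'' x * (1 - l\<^sup>2 * \<theta> (x / l))\<bar> \<le> (3000 * ?g) * 1"
    unfolding abs_mult using c t by (intro mult_mono) auto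
  have 2: "\<bar>- (l * \<theta>' (x / l)) * cutoff' x\<bar> \<le> (1 * 10 ^ 6) * (3000 * ?g)"
  proof -
    have "\<bar>- (l * \<theta>' (x / l)) * cutoff' x\<bar> = \<bar>l * \<theta>' (x / l)\<bar> * \<bar>cutoff' x\<bar>"
      by (simp only: abs_mult abs_minus_cancel)
    also have "\<dots> \<le> (1 * 10 ^ 6) * (3000 * ?g)" by (rule mult_mono[OF lt c(1)]) auto
    finally show ?thesis .
  qed
  have "\<bar>\<theta>'' (x / l)\<bar> \<le> 10 ^ 6 * ?g"
    using \<theta>_derivative_bounds(2)[of "x / l"] g_ge[of "x / l"] by simp
  then have 3: "\<bar>- \<theta>'' (x / l) * cutoff x\<bar> \<le> (10 ^ 6 * ?g) * 1"
    unfolding abs_mult abs_minus_cancel using cutoff_bounds[of x] g_bounds(1) by (intro mult_mono) auto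
  have 4: "\<bar>cutoff' x * - (l * \<theta>' (x / l))\<bar> \<le> (1 * 10 ^ 6) * (3000 * ?g)"
    using 2 by (simp add: mult.commute)
  have "\<bar>G'' x\<bar> \<le> ((3000 * ?g) * 1 + (1 * 10 ^ 6) * (3000 * ?g)) + ((10 ^ 6 * ?g) * 1 + (1 * 10 ^ 6) * (3000 * ?g))"
    unfolding G''_def
    by (intro order_trans[OF abs_triangle_ineq] add_mono 1 2 3 4)
  then show ?thesis using g_bounds(1)[of "x / l"] by simp
qed

text \<open>The term \<open>G'' S\<close> is at most \<open>10 ^ 10 * g * (w^2 N)\<close>, which by
  \<open>small_w\<close> is at most \<open>g / (16 M)\<close>, and this is half of the lower bound
  for \<open>D\<close> in terms of \<open>g\<close>.\<close>

lemma vxx_bounds: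
  "\<bar>vxx z - D (qz z) (rz z)\<bar> \<le> D (qz z) (rz z) / 2"
proof -
  let ?g = "g (qz z)"
  have "\<bar>S (z$2)\<bar> \<le> w\<^sup>2 * N"
    unfolding S_def abs_mult using Q_bound by (simp add: mult_left_mono)
  then have "\<bar>G'' (z$1) * S (z$2)\<bar> \<le> (10 ^ 10 * ?g) * (w\<^sup>2 * N)"
    unfolding abs_mult using G''_bound g_bounds(1) by (intro mult_mono) auto
  also have "\<dots> = (16 * 10 ^ 10 * M * N * w\<^sup>2) * (?g / (16 * M))" using M by simp
  also have "\<dots> \<le> 1 * (?g / (16 * M))" using small_w M g_bounds(1) by (intro mult_right_mono) auto
  also have "\<dots> = (?g / (8 * M)) / 2" by simp
  also have "\<dots> \<le> D (qz z) (rz z) / 2" by (intro divide_right_mono D_ge rad_bounds) simp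
  finally show ?thesis by (simp add: vxx_def D_def)
qed

text \<open>The main part of \<open>- vyy\<close>, that is, without the window term.\<close>

definition m :: "real^2 \<Rightarrow> real" where "m z = (1 - G (z$1)) + G (z$1) * \<nu> (z$2 / w)"

lemma m_ge: "\<theta> (z$2 / w) ^ 4 \<le> m z"
proof -
  have "\<theta> (z$2 / w) ^ 4 \<le> 1" using \<theta>_bounds by (intro power_le_one)
  then have "(1 - G (z$1)) * \<theta> (z$2 / w) ^ 4 \<le> (1 - G (z$1)) * 1" using G_bounds by (intro mult_left_mono) auto
  moreover have "G (z$1) * \<theta> (z$2 / w) ^ 4 \<le> G (z$1) * \<nu> (z$2 / w)" using G_bounds \<nu>_ge by (intro mult_left_mono)
  ultimately show ?thesis unfolding m_def by (simp add: left_diff_distrib)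
qed

text \<open>This is the source of the constant \<open>K\<close>. The summand \<open>1 - G\<close> is
  controlled by \<open>g\<close>, the summand with \<open>\<nu>\<close> by r^2, and \<open>D\<close>
  dominates both quantities by \<open>D_ge\<close>.\<close>

lemma m_le: "m z \<le> (224 * M + 8 * N * C0) * D (qz z) (rz z)"
proof -
  let ?D = "D (qz z) (rz z)"
  have "g (qz z) / (8 * M) \<le> ?D" by (intro D_ge rad_bounds)
  then have "g (qz z) \<le> 8 * M * ?D" using M by (simp add: pos_divide_le_eq mult_ac)
  then have 1: "1 - G (z$1) \<le> 28 * (8 * M * ?D)" using G_bounds(3)[of "z$1"] by linarith
  have "(rz z)\<^sup>2 / (2 * C0) \<le> ?D" by (intro D_ge rad_bounds)
  then have r: "(rz z)\<^sup>2 \<le> 2 * C0 * ?D" by (simp add: pos_divide_le_eq mult_ac)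
  have \<nu>0: "0 \<le> \<nu> (z$2 / w)" using \<nu>_ge[of "z$2 / w"] by (rule order_trans[rotated]) (simp add: \<theta>_bounds)
  have "G (z$1) * \<nu> (z$2 / w) \<le> 1 * \<nu> (z$2 / w)" using G_bounds \<nu>0 by (intro mult_right_mono)
  also have "\<dots> \<le> N * \<theta> (z$2 / w) ^ 4" using \<nu>_le by simp
  also have "\<dots> = 4 * N * (rz z)\<^sup>2" by (simp flip: rad_bounds(3))
  also have "\<dots> \<le> 4 * N * (2 * C0 * ?D)" using N r by (intro mult_left_mono) auto
  finally have 2: "G (z$1) * \<nu> (z$2 / w) \<le> 4 * N * (2 * C0 * ?D)" .
  have "m z \<le> 28 * (8 * M * ?D) + 4 * N * (2 * C0 * ?D)" unfolding m_def by (rule add_mono[OF 1 2])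
  then show ?thesis by (simp add: algebra_simps)
qed

lemma vyy_bounds: "\<bar>vyy z + m z\<bar> \<le> m z / 2"
proof -
  have "vyy z + m z = l\<^sup>2 * (Wrr (qz z) (rz z) * rad' (z$2) * rad' (z$2) + Wr (qz z) (rz z) * rad'' (z$2))"
    by (simp add: vyy_def m_def S''_def algebra_simps)
  then show ?thesis using second_order_error[of "qz z" "z$2"] m_ge[of z] by simp
qed

text \<open>Radius 3/4 exceeds the half-diagonal of the square of half-side 1/2, so one coordinate
  is at least 1/2 in size. A large first coordinate puts \<open>x / l\<close> beyond 5, so the whole
  window lies where \<open>P = 0\<close>, and \<open>G = 0\<close>. A large second coordinate gives
  r = 1/2, hence \<open>k = 0\<close>, and \<open>S = 0\<close>.\<close>

lemma v_outside:
  assumes "3/4 \<le> norm z"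
  shows "v z = ((z$1)\<^sup>2 - (z$2)\<^sup>2 + 1) / 2"
proof -
  have "1/2 \<le> \<bar>z$1\<bar> \<or> 1/2 \<le> \<bar>z$2\<bar>"
  proof (rule ccontr)
    assume "\<not> ?thesis"
    then have "\<bar>z$1\<bar> < 1/2" "\<bar>z$2\<bar> < 1/2" by auto
    from power_strict_mono[OF this(1) abs_ge_zero, of 2] power_strict_mono[OF this(2) abs_ge_zero, of 2]
    have "(z$1)\<^sup>2 < (1/2)\<^sup>2" "(z$2)\<^sup>2 < (1/2)\<^sup>2" by simp_all
    moreover have "(norm z)\<^sup>2 = (z$1)\<^sup>2 + (z$2)\<^sup>2" by (simp add: norm_vec_def L2_set_def sum_2)
    moreover have "(3/4)\<^sup>2 \<le> (norm z)\<^sup>2" using assms by (intro power_mono) auto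
    ultimately show False by (simp add: power2_eq_square)
  qed
  then have "k (rz z) * B (qz z) (rz z) = 0 \<and> G (z$1) * S (z$2) = 0"
  proof
    assume x: "1/2 \<le> \<bar>z$1\<bar>"
    have "5 * l \<le> \<bar>z$1\<bar>" using x l by simp
    then have q: "5 \<le> \<bar>qz z\<bar>" using l by (simp add: abs_divide pos_le_divide_eq)
    note r = rad_bounds(1,2)[of "z$2"]
    have "\<bar>R (qz z + rz z) - R (qz z - rz z)\<bar> \<le> (qz z + rz z - (qz z - rz z)) * 0"
    proof (rule increment_bound[OF R])
      fix x assume "qz z - rz z \<le> x" "x \<le> qz z + rz z"
      then have "4 \<le> \<bar>x\<bar>" using q r by linarith
      then show "\<bar>P x\<bar> \<le> 0" by (simp add: P_out)
    qed (use r in simp)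
    moreover have "P (qz z) = 0" using q by (intro P_out) simp
    ultimately have "B (qz z) (rz z) = 0" by (simp add: B_def)
    moreover have "G (z$1) = 0" using cutoff_outer[OF x] by (simp add: G_def)
    ultimately show ?thesis by simp
  next
    assume y: "1/2 \<le> \<bar>z$2\<bar>"
    have "4 * w \<le> \<bar>z$2\<bar>" using y w by simp
    then have q: "4 \<le> \<bar>z$2 / w\<bar>" using w by (simp add: abs_divide pos_le_divide_eq)
    then have "\<theta> (z$2 / w) = 1" by (intro outer_large) simp
    then have "k (rz z) = 0" by (simp add: k_def rad_def power_divide)
    moreover have "S (z$2) = 0" using Q_out[OF q] by (simp add: S_def)
    ultimately show ?thesis by simp
  qed
  then have eq: "k (rz z) * B (qz z) (rz z) = 0" "G (z$1) * S (z$2) = 0" by auto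
  show ?thesis unfolding v_def eq by simp
qed

lemma partial_legendre_v:
  "partial_legendre v vx vy vxx vxy vxy vyy (3 * (224 * M + 8 * N * C0))"
proof
  let ?K = "224 * M + 8 * N * C0"
  have K: "0 < ?K" using M N by (intro add_pos_pos mult_pos_pos) auto
  have D0: "0 \<le> D (qz z) (rz z)" for z by (intro D_nonneg rad_bounds)
  have \<nu>0: "0 \<le> \<nu> x" for x using \<nu>_ge[of x] by (rule order_trans[rotated]) (simp add: \<theta>_bounds)
  have m0: "0 \<le> m z" for z using m_ge[of z] by (rule order_trans[rotated]) (simp add: \<theta>_bounds)
  have vxxD: "D (qz z) (rz z) / 2 \<le> vxx z" for z
    using abs_le_D2[OF vxx_bounds[of z]] by linarith
  have vyym: "m z / 2 \<le> - vyy z" "- vyy z \<le> 3 / 2 * m z" for z 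
    using abs_le_D1[OF vyy_bounds[of z]] abs_le_D2[OF vyy_bounds[of z]] by linarith+
  have vxx0: "0 \<le> vxx z" for z using vxxD[of z] D0[of z] by linarith
  show "C1 v vx vy" "C1 vx vxx vxy" "C1 vy vxy vyy" by (rule C1_v C1_vx C1_vy)+
  show "v z = ((z$1)\<^sup>2 - (z$2)\<^sup>2 + 1) / 2" if "3/4 \<le> norm z" for z by (rule v_outside[OF that])
  show "vyy z \<le> 0" for z using vyym(1)[of z] m0[of z] by linarith
  show "0 < 3 * ?K" using K by simp
  \<comment> \<open>The factor 3 combines \<open>- vyy \<le> 3 / 2 * m\<close> with
    \<open>D / 2 \<le> vxx\<close>.\<close>
  show "- vyy z \<le> 3 * ?K * vxx z" for z
  proof -
    have "- vyy z \<le> 3 / 2 * (?K * D (qz z) (rz z))" using vyym(2)[of z] m_le[of z] by linarith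
    also have "\<dots> = 3 * ?K * (D (qz z) (rz z) / 2)" by simp
    also have "\<dots> \<le> 3 * ?K * vxx z" using vxxD[of z] K by (intro mult_left_mono) auto
    finally show ?thesis .
  qed
  have degenerate: "vxx z = 0" if "\<theta> (z$2 / w) = 0" "g (qz z) = 0" for z
  proof -
    have "D (qz z) (rz z) = 0" using that by (simp add: D_def k_def Bqq_def rad_def)
    then show ?thesis using vxx_bounds[of z] by simp
  qed
  \<comment> \<open>From \<open>vyy = 0\<close> follows \<open>m = 0\<close>, which forces
    \<open>\<theta> (z$2 / w) = 0\<close> and \<open>G = 1\<close>. The latter leaves no room for
    the term \<open>l^2 \<theta>\<close> inside \<open>G\<close>, so
    \<open>\<theta> (z$1 / l) = 0\<close> as well. This is why \<open>G\<close> contains that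
    term.\<close>
  show "vxx z = 0" if "vyy z = 0" for z
  proof -
    have m: "m z = 0" using vyym(1)[of z] m0[of z] that by simp
    then have t4: "\<theta> (z$2 / w) ^ 4 = 0" using m_ge[of z] \<theta>_bounds(1)[of "z$2 / w"] by (intro antisym) auto
    have "0 \<le> G (z$1) * \<nu> (z$2 / w)" using G_bounds \<nu>0 by (intro mult_nonneg_nonneg)
    then have G1: "G (z$1) = 1" using m G_bounds(2)[of "z$1"] unfolding m_def by linarith
    have "\<theta> (qz z) = 0"
    proof (rule ccontr)
      assume "\<theta> (qz z) \<noteq> 0"
      then have "0 < l\<^sup>2 * \<theta> (qz z)" using \<theta>_bounds(1)[of "qz z"] l by simp
      moreover have l2: "l\<^sup>2 \<le> 1" using l by (intro power_le_one) auto
      then have "l\<^sup>2 * \<theta> (qz z) \<le> 1" using \<theta>_bounds[of "qz z"] by (intro mult_le_one) auto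
      ultimately have "cutoff (z$1) * (1 - l\<^sup>2 * \<theta> (qz z)) \<le> 1 * (1 - l\<^sup>2 * \<theta> (qz z))"
        using cutoff_bounds by (intro mult_right_mono) auto
      then show False using G1 \<open>0 < l\<^sup>2 * \<theta> (qz z)\<close> by (simp add: G_def)
    qed
    then have "g (qz z) = 0" using \<theta>_eq_0_iff g_eq_0 by simp
    then show ?thesis using t4 by (intro degenerate) simp_all
  qed
  show "vx (pt s y) < vx (pt t y)" if "s < t" for s t y
  proof (rule strictly_increasing_if_derivative_pos_dense[where f = "\<lambda>t. vx (pt t y)" and f' = "\<lambda>t. vxx (pt t y)", OF _ _ _ that])
    show "((\<lambda>t. vx (pt t y)) has_field_derivative vxx (pt x y)) (at x)" for x
    proof -
      have "((\<lambda>t. pt t y) has_derivative (\<lambda>h. pt h 0)) (at x)"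
        by (rule has_derivative_pt) (auto intro!: derivative_eq_intros)
      from has_derivative_compose[OF this C1_D(3)[OF C1_vx, of _ UNIV]] show ?thesis
        by (rule has_derivative_imp_has_field_derivative) simp
    qed
    show "0 \<le> vxx (pt x y)" for x by (rule vxx0)
    fix a b :: real assume "a < b"
    then have "a / l < b / l" using l by (simp add: divide_strict_right_mono)
    then obtain x where x: "a / l < x" "x < b / l" "0 < rough x" by (rule rough_pos_dense)
    have "0 < g x" using g_ge[of x] x(3) by (simp add: min_def split: if_splits)
    then have "0 < g (qz (pt (l * x) y)) / (8 * M)" using M l by simp
    also have "\<dots> \<le> D (qz (pt (l * x) y)) (rz (pt (l * x) y))" by (intro D_ge rad_bounds)
    finally have "0 < vxx (pt (l * x) y)" using vxxD[of "pt (l * x) y"] by linarith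
    moreover have "a < l * x" "l * x < b" using x(1,2) l by (simp_all add: pos_divide_less_eq pos_less_divide_eq mult.commute)
    ultimately show "\<exists>x. a < x \<and> x < b \<and> 0 < vxx (pt x y)" by blast
  qed
  show "vy (pt x t) < vy (pt x s)" if "s < t" for x s t
  proof -
    have "- vy (pt x s) < - vy (pt x t)"
    proof (rule strictly_increasing_if_derivative_pos_dense[where f = "\<lambda>t. - vy (pt x t)" and f' = "\<lambda>t. - vyy (pt x t)", OF _ _ _ that])
      show "((\<lambda>t. - vy (pt x t)) has_field_derivative - vyy (pt x y)) (at y)" for y
      proof -
        have "((\<lambda>t. pt x t) has_derivative (\<lambda>h. pt 0 h)) (at y)"
          by (rule has_derivative_pt) (auto intro!: derivative_eq_intros)
        from has_derivative_compose[OF this C1_D(3)[OF C1_vy, of _ UNIV]]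
        have "((\<lambda>t. vy (pt x t)) has_field_derivative vyy (pt x y)) (at y)"
          by (rule has_derivative_imp_has_field_derivative) simp
        then show ?thesis by (rule DERIV_minus)
      qed
      show "0 \<le> - vyy (pt x y)" for y using vyym(1)[of "pt x y"] m0[of "pt x y"] by linarith
      fix a b :: real assume "a < b"
      then have "a / w < b / w" using w by (simp add: divide_strict_right_mono)
      then obtain y where y: "a / w < y" "y < b / w" "0 < rough y" by (rule rough_pos_dense)
      have "\<theta> y \<noteq> 0" using y(3) \<theta>_eq_0_iff by simp
      then have "0 < \<theta> y ^ 4" using \<theta>_bounds(1)[of y] by simp
      also have "\<dots> \<le> m (pt x (w * y))" using m_ge[of "pt x (w * y)"] w by simp
      finally have "0 < - vyy (pt x (w * y))" using vyym(1)[of "pt x (w * y)"] by linarith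
      moreover have "a < w * y" "w * y < b" using y(1,2) w by (simp_all add: pos_divide_less_eq pos_less_divide_eq mult.commute)
      ultimately show "\<exists>y. a < y \<and> y < b \<and> 0 < - vyy (pt x y)" by blast
    qed
    then show ?thesis by simp
  qed
  \<comment> \<open>Over this product set \<open>g\<close> and the window radius both vanish, so
    \<open>D = 0\<close>, and \<open>vxx_bounds\<close> leaves \<open>vxx = 0\<close>.\<close>
  have "{z :: real^2. rough (z$1 / l) = 0 \<and> rough (z$2 / w) = 0} \<subseteq> {z. vxx z = 0}"
    using degenerate g_eq_0 \<theta>_eq_0_iff by blast
  then show "\<not> negligible {z. vxx z = 0}"
    using zero_set_not_negligible[OF l(1) w(1)] negligible_subset by blast
qed

end

section \<open>Choice of the profiles and of the two scales\<close>

lemma profile_exists: "\<exists>g P P1 R \<nu> Q Q1 M N l w. profile g P P1 R \<nu> Q Q1 M N l w"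
proof -
  have cont: "continuous_on UNIV (\<lambda>x. min 1 (rough x))"
    by (intro continuous_on_min continuous_on_const continuous_on_rough)
  have h0: "0 \<le> min 1 (rough x)" "min 1 (rough x) \<le> 1" for x using rough_nonneg[of x] by auto
  have one: "min 1 (rough x) = 1" if "2 \<le> \<bar>x\<bar>" for x using outer_large(1)[OF that] by simp
  have ev: "min 1 (rough (- x)) = min 1 (rough x)" for x by (simp add: rough_theta_even)
  obtain g M P P1 R where g: "continuous_on UNIV g" "1 \<le> M"
    "\<And>x. min 1 (rough x) \<le> g x" "\<And>x. g x \<le> M * min 1 (rough x)"
    "\<And>x. (P has_field_derivative P1 x) (at x)" "\<And>x. (P1 has_field_derivative g x - 1) (at x)"
    "\<And>x. (R has_field_derivative P x) (at x)"
    "\<And>x. 4 \<le> \<bar>x\<bar> \<Longrightarrow> P x = 0" "\<And>x. \<bar>P x\<bar> \<le> M"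
    using normalized_profile[where ?h0.0 = "\<lambda>x. min 1 (rough x)", OF cont h0 one ev] by metis
  have cont': "continuous_on UNIV (\<lambda>x. \<theta> x ^ 4)"
    by (intro continuous_on_power continuous_on_\<theta>)
  have h0': "0 \<le> \<theta> x ^ 4" "\<theta> x ^ 4 \<le> 1" for x using \<theta>_bounds[of x] by (auto intro: power_le_one)
  have one': "\<theta> x ^ 4 = 1" if "2 \<le> \<bar>x\<bar>" for x using outer_large(3)[OF that] by simp
  have ev': "\<theta> (- x) ^ 4 = \<theta> x ^ 4" for x by (simp add: rough_theta_even)
  obtain \<nu> N Q Q1 where \<nu>: "continuous_on UNIV \<nu>" "1 \<le> N"
    "\<And>x. \<theta> x ^ 4 \<le> \<nu> x" "\<And>x. \<nu> x \<le> N * \<theta> x ^ 4"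
    "\<And>x. (Q has_field_derivative Q1 x) (at x)" "\<And>x. (Q1 has_field_derivative \<nu> x - 1) (at x)"
    "\<And>x. 4 \<le> \<bar>x\<bar> \<Longrightarrow> Q x = 0" "\<And>x. \<bar>Q x\<bar> \<le> N"
    using normalized_profile[where ?h0.0 = "\<lambda>x. \<theta> x ^ 4", OF cont' h0' one' ev'] by metis
  have small: "\<exists>x. 0 < x \<and> x \<le> 1/10 \<and> A * x\<^sup>2 \<le> b" if "0 < A" "0 < b" for A b :: real
  proof -
    define x where "x = min (1/10) (sqrt (b / A))"
    have x: "0 < x" "x \<le> 1/10" using that by (auto simp: x_def)
    have "x\<^sup>2 \<le> (sqrt (b / A))\<^sup>2" using x by (intro power_mono) (auto simp: x_def)
    then have "x\<^sup>2 \<le> b / A" using that by simp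
    then have "A * x\<^sup>2 \<le> b" using that by (simp add: pos_le_divide_eq mult.commute)
    then show ?thesis using x by blast
  qed
  have "0 < 16 * 10 ^ 10 * M * N" "0 < 160 * 10 ^ 12 * M" using g(2) \<nu>(2) by auto
  note pos = this
  \<comment> \<open>The scale w depends only on \<open>M\<close> and \<open>N\<close>; l is chosen
    afterwards because its bound involves \<open>w^2\<close>.\<close>
  obtain w where w: "0 < w" "w \<le> 1/10" "16 * 10 ^ 10 * M * N * w\<^sup>2 \<le> 1" using small[OF pos(1), of 1] by auto
  obtain l where l: "0 < l" "l \<le> 1/10" "160 * 10 ^ 12 * M * l\<^sup>2 \<le> w\<^sup>2" using small[OF pos(2), of "w\<^sup>2"] w(1) by auto
  have "profile g P P1 R \<nu> Q Q1 M N l w"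
    by unfold_locales (fact g \<nu> w l)+
  then show ?thesis by blast
qed

theorem theorem1p1:
  shows "\<exists>(u :: real^2 \<Rightarrow> real) (Du :: real^2 \<Rightarrow> real^2) (f :: real^2 \<Rightarrow> real).
     \<comment> \<open>u in C^1 of the closed disc, with gradient Du continuous up to the boundary\<close>
     continuous_on (cball 0 1) Du \<and>
     (\<forall>x\<in>cball 0 1. (u has_derivative (\<lambda>h. Du x \<bullet> h)) (at x within cball 0 1)) \<and>
     \<comment> \<open>Du in BV(B_1; R^2)\<close>
     (\<forall>j. BV (ball 0 1) (\<lambda>x. Du x $ j)) \<and>
     \<comment> \<open>u = 0 on the boundary, u strictly convex\<close>
     (\<forall>x\<in>sphere 0 1. u x = 0) \<and>
     strictly_convex_on (ball 0 1) u \<and>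
     \<comment> \<open>Monge-Ampere measure mu_u = f dx with 0 < f <= 1 a.e.\<close>
     f \<in> borel_measurable lebesgue \<and>
     (AE x in lebesgue. x \<in> ball 0 1 \<longrightarrow> 0 < f x \<and> f x \<le> 1) \<and>
     (\<forall>E \<in> sets borel. E \<subseteq> ball 0 1 \<longrightarrow>
        subdiff_set (ball 0 1) u E \<in> sets lebesgue \<and>
        emeasure lebesgue (subdiff_set (ball 0 1) u E) = (\<integral>\<^sup>+ x\<in>E. ennreal (f x) \<partial>lebesgue)) \<and>
     \<comment> \<open>but u is not in W^{2,1}(B_1)\<close>
     \<not> W21 (ball 0 1) u"
proof -
  obtain g P P1 R \<nu> Q Q1 M N l w where "profile g P P1 R \<nu> Q Q1 M N l w"
    using profile_exists by metis
  then show ?thesis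
    by (rule partial_legendre.counterexample[OF profile.partial_legendre_v])
qed

end
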